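(* Let $\{w^k\}=\{(x^k,y^k,V_k)\}$ be an infinite sequence generated by Algorithm 2 (with scaling matrices equal to the identity) and suppose that Assumptions B and C hold. Then the update in Step 2-3 (that is, $w^{k+1}=w^k_+$) is eventually adopted, i.e. it is adopted for all sufficiently large $k$, and $$\|w^{k+1}-w^\ast\|=O\left(\|w^k-w^\ast\|^{1+c\alpha}\right).$$ Hence $\{w^k\}$ converges to $w^\ast$ two-step superlinearly with the order $1+c\alpha\in\left(1,\frac43\right)$.
   Context: Notation. $S^m$, $S^m_+$, $S^m_{++}$: real symmetric, positive semidefinite, positive definite $m\times m$ matrices. $X\circ Y=(XY+YX)/2$, $X\bullet Y=\mathrm{Tr}(XY)$, $\mathcal{L}_X(Z)=X\circ Z$ on $S^m$; $\mathrm{svec}(X)=(X_{11},\sqrt2X_{21},\ldots,\sqrt2X_{m1},X_{22},\sqrt2X_{32},\ldots,X_{mm})^\top$, and $X$ is identified with $\mathrm{svec}(X)$. $(\zeta)_+=\max(\zeta,0)$; $(F_i\bullet V)_{i=1}^n=(F_1\bullet V,\ldots,F_n\bullet V)^\top$. $\mathcal{M}_+(T)$ is the set of nonnegative finite regular Borel measures on $T$; $\mathrm{supp}(y)=\{\tau\in T:y(\{\tau\})\neq0\}$. Problem (SISDP). Minimize $f(x)$ over $x\in\mathbb{R}^n$ subject to $g(x,\tau)\le0$ for all $\tau\in T$ and $F(x)\in S^m_+$, where $f$ is continuously differentiable, $g:\mathbb{R}^n\times T\to\mathbb{R}$ is continuous with $g(\cdot,\tau)$ convex and continuously differentiable, $F(x)=F_0+\sum_{i=1}^nx_iF_i$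 with $F_i\in S^m$, and $T\subset\mathbb{R}^q$ is a bounded closed set formed by finitely many sufficiently smooth inequality constraints. The solution set is nonempty. A KKT point is $(x,y,V)$ with $\nabla f(x)+\int_T\nabla_xg(x,\tau)\,dy(\tau)-(F_i\bullet V)_{i=1}^n=0$; $F(x)\circ V=O$, $F(x),V\in S^m_+$; $\int_Tg(x,\tau)\,dy(\tau)=0$, $g(x,\tau)\le0$ $(\tau\in T)$, $y\in\mathcal{M}_+(T)$. For $\mu\ge0$, $R_\mu(x,y,V)=\sqrt{\theta(x)^2+\|\phi_1\|^2+\phi_2^2+\|\phi_3\|^2}$ with $\theta(x)=\max_{\tau\in T}(g(x,\tau))_+$, $\phi_1=\nabla f(x)+\int_T\nabla_xg(x,\tau)\,dy(\tau)-(F_i\bullet V)_{i=1}^n$, $\phi_2=\int_Tg(x,\tau)\,dy(\tau)$, $\phi_3=\mathrm{svec}(F(x)\circ V-\mu I)$; $\mathcal{N}_\mu^\varepsilon=\{w=(x,y,V)\in\mathbb{R}^n\times\mathcal{M}_+(T)\times S^m_{++}:R_\mu(w)\le\varepsilon,\ F(x)\in S^m_{++}\}$. Local reduction. Fix $\sigma>0$. Let $S(x)$ be the set of all local maximizers of $\max_{\tau\in T}g(x,\tau)$ and $S_\sigma(x)=\{\tau\in S(x):g(x,\tau)>\max_{\tau'\in T}g(x,\tau')-\sigma\}$. A point $\bar x$ is nondegenerate if $|S_\sigma(\bar x)|<\infty$ and the linear independence constraint qualification, the second-order sufficient conditions and strict complementarity for $\max_{\tau\in T}g(\bar x,\tau)$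 hold at every $\tau\in S_\sigma(\bar x)$. Then there are an open neighborhood $U(\bar x)$, $p(\bar x)=|S_\sigma(\bar x)|$, and twice continuously differentiable $\tau^i_{\bar x}:U(\bar x)\to T$ ($1\le i\le p(\bar x)$) such that for $x\in U(\bar x)$ one has $S_\sigma(x)=\{\tau^i_{\bar x}(x)\}_{i}$ and these are strict local maximizers of $g(x,\cdot)$ on $T$. Put $\hat g_i(x)=g(x,\tau^i_{\bar x}(x))$, $\hat g=(\hat g_i)_i$, $L(x,y)=f(x)+\sum_iy_i\hat g_i(x)-F(x)\bullet V$ (its Hessian $\nabla^2_{xx}L$ in $x$ does not depend on $V$). A discrete measure supported on $\{\tau^i_{\bar x}(x)\}_i$ is identified with the vector of its masses $y_i=y(\{\tau^i_{\bar x}(x)\})$. Algorithm 2 (with all scaling matrices equal to the identity). Parameters: $0<\alpha<1$, $0<\beta<1$, $\gamma_1,\gamma_2>0$, $\delta\in(0,1)$, $\mu_0>0$, $0<c\le\frac1{\alpha+2}$; $\varepsilon_0=\gamma_1\mu_0^{1+\alpha}$; $w^0=(x^0,y^0,V_0)$ with $y^0\in\mathcal{M}_+(T)$, $F(x^0),V_0\in S^m_{++}$. For $k=0,1,\ldots$ (stop if $w^k$ is a KKT point; here the sequence is infinite): Step 2-1. With $\hat g$ defined at $\bar x=x^k$, find $\Delta_{1/2}w^k=(\Delta_{1/2}x^k,\Delta_{1/2}y^k,\Delta_{1/2}V_k)$ as a solution $(\Delta x,\Delta y,\Delta V)$, at $(x,y,V)=w^k$ and $\mu=\mu_k$, of (a)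 $\nabla f(x)+\nabla^2_{xx}L(x,y)\Delta x+\nabla\hat g(x)(y+\Delta y)-(F_i\bullet(V+\Delta V))_{i=1}^n=0$, (b) $F(x)\circ(V+\Delta V)+\frac12\left(\mathcal{L}_V+\mathcal{L}_{F(x)}\mathcal{L}_V\mathcal{L}_{F(x)}^{-1}\right)\sum_{i=1}^n\Delta x_iF_i=\mu I$, (c) $0\le y+\Delta y\perp\hat g(x)+\nabla\hat g(x)^\top\Delta x\le0$. Set $w^{k+1/2}=(x^{k+1/2},y^{k+1/2},V_{k+1/2})=w^k+s^k_{1/2}\Delta_{1/2}w^k$. Let $J_a^k=\{i:\hat g_i(x^k)+\nabla\hat g_i(x^k)^\top\Delta_{1/2}x^k=0\}$. Step 2-2. Solve at $(x,y,V)=w^{k+1/2}$, $\mu=\mu_k$, the linear equations consisting of (a), (b) and $\hat g_i(x)+\nabla\hat g_i(x)^\top\Delta x=0$ $(i\in J_a^k)$, $y_i+\Delta y_i=0$ $(i\notin J_a^k)$. If solvable, call a solution $\Delta_1w^k=(\Delta_1x^k,\Delta_1y^k,\Delta_1V_k)$ and compute $s^k_1$; if not solvable or not well-defined (the functions $\hat g_i$, $i\in J_a^k$, defined at $x^k$ not being valid at $x^{k+1/2}$), go to Step 2-4. Step 2-3. If $w^k_+:=w^{k+1/2}+s^k_1\Delta_1w^k\in\mathcal{N}_{\mu_k}^{\varepsilon_k}$, set $w^{k+1}=w^k_+$ and go to Step 3; otherwise go to Step 2-4. Step 2-4. Find some $w^{k+1}\in\mathcal{N}_{\mu_k}^{\varepsilon_k}$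 (by an auxiliary interior-point SQP method). Step 3. $\mu_{k+1}=\min(\beta\mu_k,\gamma_2\mu_k^{1+c\alpha})$, $\varepsilon_{k+1}=\gamma_1\mu_{k+1}^{1+\alpha}$. Step sizes, $j\in\{\frac12,1\}$: $s^k_j=\min(t^k_j,u^k_j)$, where with $\lambda=\lambda_{\min}\left(F(x^{k+j-1/2})^{-1}\sum_i(\Delta_jx^k)_iF_i\right)$, $t^k_j=-\delta/\lambda$ if $\lambda\le-1$ and $t^k_j=1$ otherwise; $u^k_j$ is defined likewise with $\lambda=\lambda_{\min}(V_{k+j-1/2}^{-1}\Delta_jV_k)$. Assumption B. (1) $\lim_{k\to\infty}w^k=w^\ast=(x^\ast,y^\ast,V_\ast)$, where $w^\ast$ is a KKT point of the SISDP. (2) $x^\ast$ is nondegenerate. (3) For sufficiently large $k$, $\{\tau^i_{x^k}(\cdot)\}_{i=1}^{p(x^k)}=\{\tau^i_{x^\ast}(\cdot)\}_{i=1}^{p(x^\ast)}$ and $\mathrm{supp}(y^k)\subseteq\{\tau^1_{x^\ast}(x^k),\ldots,\tau^{p(x^\ast)}_{x^\ast}(x^k)\}$. Accordingly $y^k$ and $y^\ast$ are identified with vectors in $\mathbb{R}^{p(x^\ast)}$ with entries $y^k_i=y^k(\{\tau^i_{x^\ast}(x^k)\})$, $y^\ast_i=y^\ast(\{\tau^i_{x^\ast}(x^\ast)\})$, and norms such as $\|w^k-w^\ast\|$ are Euclidean norms under this identification. Assumption C. Let $I_a(x^\ast)=\{i:\hat g_i(x^\ast)=0\}$. (1) $f$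 and $g(\cdot,\tau)$ ($\tau\in T$) are three times continuously differentiable. (2) $J_a^k=I_a(x^\ast)$ for all sufficiently large $k$. (3) $F(x^\ast)+V_\ast\in S^m_{++}$ and $-\hat g_i(x^\ast)+y^\ast_i>0$ $(i=1,\ldots,p(x^\ast))$. (4) The Jacobian at $(x^\ast,(y^\ast_i)_{i\in I_a(x^\ast)},\mathrm{svec}(V_\ast))$ of the map $\Phi_0(x,\tilde y,\mathrm{svec}(V))=\left(\nabla f(x)+\sum_{i\in I_a(x^\ast)}y_i\nabla\hat g_i(x)-(F_i\bullet V)_{i=1}^n,\ (\hat g_i(x))_{i\in I_a(x^\ast)},\ \mathrm{svec}(F(x)\circ V)\right)$, $\tilde y=(y_i)_{i\in I_a(x^\ast)}$, is nonsingular.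
   Formalization: Assumption C(1) is strengthened: g is three times continuously differentiable jointly in (x,τ) near R^n×T, since smoothness in x for each τ alone does not give ĝ_i a (Lipschitz) Hessian; B(3) states explicitly that y^k is eventually discrete, as its identification with a vector presupposes. *)

theory Defs
  imports "HOL-Analysis.Analysis" "HOL-Library.Landau_Symbols"
begin

section \<open>Calculus\<close>

text \<open>For open S: f is k times continuously differentiable on S.\<close>

primrec Ck_on :: "nat \<Rightarrow> 'a::euclidean_space set \<Rightarrow> ('a \<Rightarrow> 'b::real_normed_vector) \<Rightarrow> bool" where
  "Ck_on 0 S f \<longleftrightarrow> continuous_on S f"
| "Ck_on (Suc k) S f \<longleftrightarrow>
     (\<exists>f'. (\<forall>x\<in>S. (f has_derivative f' x) (at x)) \<and> (\<forall>v. Ck_on k S (\<lambda>x. f' x v)))"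

definition grad :: "(real^'d \<Rightarrow> real) \<Rightarrow> real^'d \<Rightarrow> real^'d::finite" where
  "grad f x = (\<chi> i. frechet_derivative f (at x) (axis i 1))"

definition hess :: "(real^'d \<Rightarrow> real) \<Rightarrow> real^'d \<Rightarrow> real^'d^'d::finite" where
  "hess f x = matrix (frechet_derivative (grad f) (at x))"


section \<open>Symmetric matrices\<close>

definition symm :: "real^'m^'m::finite \<Rightarrow> bool" where
  "symm X \<longleftrightarrow> transpose X = X"

definition psd :: "real^'m^'m::finite \<Rightarrow> bool" where
  "psd X \<longleftrightarrow> symm X \<and> (\<forall>v. 0 \<le> v \<bullet> (X *v v))"

definition posdef :: "real^'m^'m::finite \<Rightarrow> bool" where
  "posdef X \<longleftrightarrow> symm X \<and> (\<forall>v. v \<noteq> 0 \<longrightarrow> 0 < v \<bullet> (X *v v))"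

definition sprod :: "real^'m^'m::finite \<Rightarrow> real^'m^'m \<Rightarrow> real^'m^'m" where
  "sprod X Y = (1/2) *\<^sub>R (X ** Y + Y ** X)"

definition mdot :: "real^'m^'m::finite \<Rightarrow> real^'m^'m \<Rightarrow> real" where
  "mdot X Y = trace (X ** Y)"

text \<open>Inverse of the operator Z \<mapsto> X \<circ> Z on the space of symmetric matrices.\<close>

definition lyap_inv :: "real^'m^'m::finite \<Rightarrow> real^'m^'m \<Rightarrow> real^'m^'m" where
  "lyap_inv X = inv_into {Z. symm Z} (sprod X)"

text \<open>
  The m(m+1)/2 entries of svec X sit at the positions (i,j) with j \<le> i of a vector indexed by
  all pairs; the remaining positions are filled with 0, so that Euclidean norms are unaffected.
\<close>

definition svec :: "real^('m::{finite,linorder})^('m::{finite,linorder}) \<Rightarrow> real^('m \<times> 'm)" where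
  "svec X = (\<chi> p. if fst p = snd p then X $ fst p $ fst p
                   else if snd p < fst p then sqrt 2 * X $ fst p $ snd p else 0)"

definition smat :: "real^('m \<times> 'm) \<Rightarrow> real^('m::{finite,linorder})^('m::{finite,linorder})" where
  "smat = inv_into {X. symm X} svec"

definition lambda_min :: "real^'m^'m::finite \<Rightarrow> real" where
  "lambda_min A = Min {l. \<exists>v. v \<noteq> 0 \<and> A *v v = l *\<^sub>R v}"


section \<open>The problem\<close>

text \<open>The index set T is described by the inequalities \<open>tcon P j \<tau> \<le> 0\<close>, \<open>j < ntcon P\<close>.\<close>

record ('n, 'm, 'q) sisdp =
  obj :: "real^'n \<Rightarrow> real"
  con :: "real^'n \<Rightarrow> real^'q \<Rightarrow> real"
  Fconst :: "real^'m^'m"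
  Fcoef :: "'n \<Rightarrow> real^'m^'m"
  ntcon :: nat
  tcon :: "nat \<Rightarrow> real^'q \<Rightarrow> real"

definition Tset :: "('n::finite, 'm::finite, 'q::finite) sisdp \<Rightarrow> (real^'q) set" where
  "Tset P = {\<tau>. \<forall>j<ntcon P. tcon P j \<tau> \<le> 0}"

definition Flin :: "('n::finite, 'm::finite, 'q::finite) sisdp \<Rightarrow> real^'n \<Rightarrow> real^'m^'m" where
  "Flin P d = (\<Sum>i\<in>UNIV. d $ i *\<^sub>R Fcoef P i)"

definition Fmap :: "('n::finite, 'm::finite, 'q::finite) sisdp \<Rightarrow> real^'n \<Rightarrow> real^'m^'m" where
  "Fmap P x = Fconst P + Flin P x"

definition Fadj :: "('n::finite, 'm::finite, 'q::finite) sisdp \<Rightarrow> real^'m^'m \<Rightarrow> real^'n" where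
  "Fadj P V = (\<chi> i. mdot (Fcoef P i) V)"

definition feasible :: "('n::finite, 'm::finite, 'q::finite) sisdp \<Rightarrow> (real^'n) set" where
  "feasible P = {x. (\<forall>\<tau>\<in>Tset P. con P x \<tau> \<le> 0) \<and> psd (Fmap P x)}"

text \<open>
  T is required to be nonempty because maxima over T are taken throughout.
\<close>

definition wf_sisdp :: "('n::finite, 'm::finite, 'q::finite) sisdp \<Rightarrow> bool" where
  "wf_sisdp P \<longleftrightarrow>
     Ck_on 1 UNIV (obj P) \<and>
     continuous_on (UNIV \<times> Tset P) (\<lambda>(x, \<tau>). con P x \<tau>) \<and>
     (\<forall>\<tau>\<in>Tset P. convex_on UNIV (\<lambda>x. con P x \<tau>) \<and> Ck_on 1 UNIV (\<lambda>x. con P x \<tau>)) \<and>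
     symm (Fconst P) \<and> (\<forall>i. symm (Fcoef P i)) \<and>
     (\<forall>j<ntcon P. Ck_on 2 UNIV (tcon P j)) \<and>
     bounded (Tset P) \<and> closed (Tset P) \<and> Tset P \<noteq> {} \<and>
     (\<exists>x\<in>feasible P. \<forall>x'\<in>feasible P. obj P x \<le> obj P x')"

text \<open>Nonnegative finite regular Borel measures on T.\<close>

definition Mplus :: "('n::finite, 'm::finite, 'q::finite) sisdp \<Rightarrow> (real^'q) measure set" where
  "Mplus P = {y. sets y = sets (restrict_space borel (Tset P)) \<and> finite_measure y \<and>
     (\<forall>A\<in>sets y.
        emeasure y A = (SUP K\<in>{K. compact K \<and> K \<subseteq> A}. emeasure y K) \<and>
        emeasure y A = (INF G\<in>{G. open G \<and> A \<subseteq> G}. emeasure y (G \<inter> Tset P)))}"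

definition msupp :: "('n::finite, 'm::finite, 'q::finite) sisdp \<Rightarrow> (real^'q) measure \<Rightarrow> (real^'q) set" where
  "msupp P y = {\<tau>\<in>Tset P. emeasure y {\<tau>} \<noteq> 0}"

text \<open>
  Since \<open>msupp\<close> only sees atoms, discreteness has to be required separately: a measure without
  atoms has empty \<open>msupp\<close>.
\<close>

definition discrete_measure :: "('n::finite, 'm::finite, 'q::finite) sisdp \<Rightarrow> (real^'q) measure \<Rightarrow> bool" where
  "discrete_measure P y \<longleftrightarrow> emeasure y (Tset P - msupp P y) = 0"

type_synonym ('n, 'm, 'q) iterate = "(real^'n) \<times> (real^'q) measure \<times> (real^'m^'m)"

definition phi1 :: "('n::finite, 'm::finite, 'q::finite) sisdp \<Rightarrow> ('n, 'm, 'q) iterate \<Rightarrow> real^'n" where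
  "phi1 P = (\<lambda>(x, y, V).
     grad (obj P) x + integral\<^sup>L y (\<lambda>\<tau>. grad (\<lambda>z. con P z \<tau>) x) - Fadj P V)"

definition phi2 :: "('n::finite, 'm::finite, 'q::finite) sisdp \<Rightarrow> ('n, 'm, 'q) iterate \<Rightarrow> real" where
  "phi2 P = (\<lambda>(x, y, V). integral\<^sup>L y (\<lambda>\<tau>. con P x \<tau>))"

definition phi3 :: "('n::finite, 'm::{finite,linorder}, 'q::finite) sisdp \<Rightarrow> real \<Rightarrow>
    ('n, 'm, 'q) iterate \<Rightarrow> real^('m \<times> 'm)" where
  "phi3 P \<mu> = (\<lambda>(x, y, V). svec (sprod (Fmap P x) V - \<mu> *\<^sub>R mat 1))"

definition theta :: "('n::finite, 'm::finite, 'q::finite) sisdp \<Rightarrow> real^'n \<Rightarrow> real" where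
  "theta P x = (SUP \<tau>\<in>Tset P. max (con P x \<tau>) 0)"

definition KKT :: "('n::finite, 'm::finite, 'q::finite) sisdp \<Rightarrow> ('n, 'm, 'q) iterate \<Rightarrow> bool" where
  "KKT P = (\<lambda>(x, y, V).
     phi1 P (x, y, V) = 0 \<and>
     sprod (Fmap P x) V = 0 \<and> psd (Fmap P x) \<and> psd V \<and>
     phi2 P (x, y, V) = 0 \<and> (\<forall>\<tau>\<in>Tset P. con P x \<tau> \<le> 0) \<and> y \<in> Mplus P)"

definition Rres :: "('n::finite, 'm::{finite,linorder}, 'q::finite) sisdp \<Rightarrow> real \<Rightarrow>
    ('n, 'm, 'q) iterate \<Rightarrow> real" where
  "Rres P \<mu> w = sqrt ((theta P (fst w))\<^sup>2 + (norm (phi1 P w))\<^sup>2 + (phi2 P w)\<^sup>2 + (norm (phi3 P \<mu> w))\<^sup>2)"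

definition Nset :: "('n::finite, 'm::{finite,linorder}, 'q::finite) sisdp \<Rightarrow> real \<Rightarrow> real \<Rightarrow>
    ('n, 'm, 'q) iterate set" where
  "Nset P \<mu> \<epsilon> = {(x, y, V). y \<in> Mplus P \<and> posdef V \<and> Rres P \<mu> (x, y, V) \<le> \<epsilon> \<and> posdef (Fmap P x)}"


section \<open>Local reduction\<close>

definition local_max :: "('n::finite, 'm::finite, 'q::finite) sisdp \<Rightarrow> real^'n \<Rightarrow> real^'q \<Rightarrow> bool" where
  "local_max P x \<tau> \<longleftrightarrow> \<tau> \<in> Tset P \<and>
     (\<exists>e>0. \<forall>\<tau>'\<in>Tset P \<inter> ball \<tau> e. con P x \<tau>' \<le> con P x \<tau>)"

definition strict_local_max :: "('n::finite, 'm::finite, 'q::finite) sisdp \<Rightarrow> real^'n \<Rightarrow> real^'q \<Rightarrow> bool" where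
  "strict_local_max P x \<tau> \<longleftrightarrow> \<tau> \<in> Tset P \<and>
     (\<exists>e>0. \<forall>\<tau>'\<in>Tset P \<inter> ball \<tau> e. \<tau>' \<noteq> \<tau> \<longrightarrow> con P x \<tau>' < con P x \<tau>)"

definition Ssig :: "('n::finite, 'm::finite, 'q::finite) sisdp \<Rightarrow> real \<Rightarrow> real^'n \<Rightarrow> (real^'q) set" where
  "Ssig P \<sigma> x = {\<tau>. local_max P x \<tau> \<and> con P x \<tau> > (SUP \<tau>'\<in>Tset P. con P x \<tau>') - \<sigma>}"

definition tactive :: "('n::finite, 'm::finite, 'q::finite) sisdp \<Rightarrow> real^'q \<Rightarrow> nat set" where
  "tactive P \<tau> = {j. j < ntcon P \<and> tcon P j \<tau> = 0}"

definition LICQ :: "('n::finite, 'm::finite, 'q::finite) sisdp \<Rightarrow> real^'q \<Rightarrow> bool" where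
  "LICQ P \<tau> \<longleftrightarrow> inj_on (\<lambda>j. grad (tcon P j) \<tau>) (tactive P \<tau>) \<and>
                  independent ((\<lambda>j. grad (tcon P j) \<tau>) ` tactive P \<tau>)"

definition lower_multiplier :: "('n::finite, 'm::finite, 'q::finite) sisdp \<Rightarrow> real^'n \<Rightarrow> real^'q \<Rightarrow>
    (nat \<Rightarrow> real) \<Rightarrow> bool" where
  "lower_multiplier P x \<tau> l \<longleftrightarrow>
     (\<forall>j\<in>tactive P \<tau>. 0 \<le> l j) \<and>
     grad (con P x) \<tau> = (\<Sum>j\<in>tactive P \<tau>. l j *\<^sub>R grad (tcon P j) \<tau>)"

definition SOSC :: "('n::finite, 'm::finite, 'q::finite) sisdp \<Rightarrow> real^'n \<Rightarrow> real^'q \<Rightarrow>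
    (nat \<Rightarrow> real) \<Rightarrow> bool" where
  "SOSC P x \<tau> l \<longleftrightarrow>
     (\<forall>d. d \<noteq> 0 \<longrightarrow>
        (\<forall>j\<in>tactive P \<tau>. grad (tcon P j) \<tau> \<bullet> d \<le> 0 \<and> (0 < l j \<longrightarrow> grad (tcon P j) \<tau> \<bullet> d = 0)) \<longrightarrow>
        d \<bullet> ((hess (con P x) \<tau> - (\<Sum>j\<in>tactive P \<tau>. l j *\<^sub>R hess (tcon P j) \<tau>)) *v d) < 0)"

definition nondegenerate :: "('n::finite, 'm::finite, 'q::finite) sisdp \<Rightarrow> real \<Rightarrow> real^'n \<Rightarrow> bool" where
  "nondegenerate P \<sigma> x \<longleftrightarrow> finite (Ssig P \<sigma> x) \<and>
     (\<forall>\<tau>\<in>Ssig P \<sigma> x. LICQ P \<tau> \<and>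
        (\<exists>l. lower_multiplier P x \<tau> l \<and> SOSC P x \<tau> l \<and> (\<forall>j\<in>tactive P \<tau>. 0 < l j)))"

text \<open>
  Neighbourhoods and implicit functions attached to base points. Since p(x) depends on the base
  point x, the functions are numbered by a subset \<open>idx x\<close> of a finite type, and vectors of length
  p(x) are vectors over this type that vanish off \<open>idx x\<close>. In \<open>tau xb i x\<close>, \<open>xb\<close> is the base
  point and \<open>x\<close> the argument.
\<close>

record ('n, 'q, 'p) reduction =
  nbhd :: "real^'n \<Rightarrow> (real^'n) set"
  idx :: "real^'n \<Rightarrow> 'p set"
  tau :: "real^'n \<Rightarrow> 'p \<Rightarrow> real^'n \<Rightarrow> real^'q"

definition reduction_at :: "('n::finite, 'm::finite, 'q::finite) sisdp \<Rightarrow> real \<Rightarrow>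
    ('n, 'q, 'p::finite) reduction \<Rightarrow> real^'n \<Rightarrow> bool" where
  "reduction_at P \<sigma> r xb \<longleftrightarrow>
     open (nbhd r xb) \<and> xb \<in> nbhd r xb \<and>
     finite (Ssig P \<sigma> xb) \<and> card (idx r xb) = card (Ssig P \<sigma> xb) \<and>
     (\<forall>i\<in>idx r xb. Ck_on 2 (nbhd r xb) (tau r xb i)) \<and>
     (\<forall>x\<in>nbhd r xb. Ssig P \<sigma> x = (\<lambda>i. tau r xb i x) ` idx r xb \<and>
        (\<forall>i\<in>idx r xb. tau r xb i x \<in> Tset P \<and> strict_local_max P x (tau r xb i x)))"

definition ghat :: "('n::finite, 'm::finite, 'q::finite) sisdp \<Rightarrow> ('n, 'q, 'p::finite) reduction \<Rightarrow>
    real^'n \<Rightarrow> 'p \<Rightarrow> real^'n \<Rightarrow> real" where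
  "ghat P r xb i x = con P x (tau r xb i x)"

definition lagr :: "('n::finite, 'm::finite, 'q::finite) sisdp \<Rightarrow> ('n, 'q, 'p::finite) reduction \<Rightarrow>
    real^'n \<Rightarrow> real^'p \<Rightarrow> real^'m^'m \<Rightarrow> real^'n \<Rightarrow> real" where
  "lagr P r xb y V x = obj P x + (\<Sum>i\<in>idx r xb. y $ i * ghat P r xb i x) - mdot (Fmap P x) V"

definition vecs :: "'p set \<Rightarrow> (real^'p::finite) set" where
  "vecs I = {v. \<forall>i. i \<notin> I \<longrightarrow> v $ i = 0}"

type_synonym ('n, 'm, 'p) vpoint = "(real^'n) \<times> (real^'p) \<times> (real^'m^'m)"

text \<open>Identification of discrete measures with their vectors of masses, in both directions.\<close>

definition to_vec :: "('n, 'q, 'p) reduction \<Rightarrow> real^'n \<Rightarrow> ('n::finite, 'm::finite, 'q::finite) iterate \<Rightarrow>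
    ('n, 'm, 'p::finite) vpoint" where
  "to_vec r xb = (\<lambda>(x, y, V).
     (x, (\<chi> i. if i \<in> idx r xb then measure y {tau r xb i x} else 0), V))"

definition of_vec :: "('n::finite, 'm::finite, 'q::finite) sisdp \<Rightarrow> ('n, 'q, 'p::finite) reduction \<Rightarrow>
    real^'n \<Rightarrow> ('n, 'm, 'p) vpoint \<Rightarrow> ('n, 'm, 'q) iterate" where
  "of_vec P r xb = (\<lambda>(x, v, V).
     (x, measure_of (Tset P) (sets (restrict_space borel (Tset P)))
           (\<lambda>A. \<Sum>i\<in>idx r xb. ennreal (v $ i) * indicator A (tau r xb i x)), V))"

definition coords :: "('n, 'q, 'p) reduction \<Rightarrow> real^'n \<Rightarrow>
    ('n::finite, 'm::{finite,linorder}, 'q::finite) iterate \<Rightarrow>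
    (real^'n) \<times> (real^'p::finite) \<times> (real^('m \<times> 'm))" where
  "coords r xb w = (case to_vec r xb w of (x, v, V) \<Rightarrow> (x, v, svec V))"


text \<open>Distance of the k-th iterate to the limit \<open>ws\<close>.\<close>

definition err :: "('n, 'q, 'p::finite) reduction \<Rightarrow>
    (nat \<Rightarrow> ('n::finite, 'm::{finite,linorder}, 'q::finite) iterate) \<Rightarrow> ('n, 'm, 'q) iterate \<Rightarrow>
    nat \<Rightarrow> real" where
  "err r w ws k = norm (coords r (fst ws) (w k) - coords r (fst ws) ws)"


section \<open>The algorithm\<close>

record params =
  alpha :: real
  beta :: real
  gamma1 :: real
  gamma2 :: real
  delta :: real
  mu0 :: real
  cpar :: real

definition wf_params :: "params \<Rightarrow> bool" where
  "wf_params a \<longleftrightarrow> 0 < alpha a \<and> alpha a < 1 \<and> 0 < beta a \<and> beta a < 1 \<and>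
     0 < gamma1 a \<and> 0 < gamma2 a \<and> 0 < delta a \<and> delta a < 1 \<and> 0 < mu0 a \<and>
     0 < cpar a \<and> cpar a \<le> 1 / (alpha a + 2)"

primrec mu :: "params \<Rightarrow> nat \<Rightarrow> real" where
  "mu a 0 = mu0 a"
| "mu a (Suc k) = min (beta a * mu a k) (gamma2 a * mu a k powr (1 + cpar a * alpha a))"

definition eps :: "params \<Rightarrow> nat \<Rightarrow> real" where
  "eps a k = gamma1 a * mu a k powr (1 + alpha a)"

definition newton_a :: "('n::finite, 'm::finite, 'q::finite) sisdp \<Rightarrow> ('n, 'q, 'p::finite) reduction \<Rightarrow>
    real^'n \<Rightarrow> ('n, 'm, 'p) vpoint \<Rightarrow> ('n, 'm, 'p) vpoint \<Rightarrow> bool" where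
  "newton_a P r xb = (\<lambda>(x, y, V) (dx, dy, dV).
     grad (obj P) x + hess (lagr P r xb y V) x *v dx
       + (\<Sum>i\<in>idx r xb. (y $ i + dy $ i) *\<^sub>R grad (ghat P r xb i) x) - Fadj P (V + dV) = 0)"

definition newton_b :: "('n::finite, 'm::finite, 'q::finite) sisdp \<Rightarrow> real \<Rightarrow>
    ('n, 'm, 'p::finite) vpoint \<Rightarrow> ('n, 'm, 'p) vpoint \<Rightarrow> bool" where
  "newton_b P \<mu> = (\<lambda>(x, y, V) (dx, dy, dV).
     sprod (Fmap P x) (V + dV)
       + (1/2) *\<^sub>R (sprod V (Flin P dx)
           + sprod (Fmap P x) (sprod V (lyap_inv (Fmap P x) (Flin P dx))))
     = \<mu> *\<^sub>R mat 1)"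

definition lin_ghat :: "('n::finite, 'm::finite, 'q::finite) sisdp \<Rightarrow> ('n, 'q, 'p::finite) reduction \<Rightarrow>
    real^'n \<Rightarrow> real^'n \<Rightarrow> real^'n \<Rightarrow> 'p \<Rightarrow> real" where
  "lin_ghat P r xb x dx i = ghat P r xb i x + grad (ghat P r xb i) x \<bullet> dx"

definition step21 :: "('n::finite, 'm::finite, 'q::finite) sisdp \<Rightarrow> ('n, 'q, 'p::finite) reduction \<Rightarrow>
    real \<Rightarrow> real^'n \<Rightarrow> ('n, 'm, 'p) vpoint \<Rightarrow> ('n, 'm, 'p) vpoint \<Rightarrow> bool" where
  "step21 P r \<mu> xb = (\<lambda>(x, y, V) (dx, dy, dV).
     dy \<in> vecs (idx r xb) \<and> symm dV \<and>
     newton_a P r xb (x, y, V) (dx, dy, dV) \<and> newton_b P \<mu> (x, y, V) (dx, dy, dV) \<and>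
     (\<forall>i\<in>idx r xb. 0 \<le> y $ i + dy $ i \<and> lin_ghat P r xb x dx i \<le> 0) \<and>
     (\<Sum>i\<in>idx r xb. (y $ i + dy $ i) * lin_ghat P r xb x dx i) = 0)"

definition Jact :: "('n::finite, 'm::finite, 'q::finite) sisdp \<Rightarrow> ('n, 'q, 'p::finite) reduction \<Rightarrow>
    real^'n \<Rightarrow> ('n, 'm, 'p) vpoint \<Rightarrow> 'p set" where
  "Jact P r xb d = {i\<in>idx r xb. lin_ghat P r xb xb (fst d) i = 0}"

definition step22 :: "('n::finite, 'm::finite, 'q::finite) sisdp \<Rightarrow> ('n, 'q, 'p::finite) reduction \<Rightarrow>
    real \<Rightarrow> real^'n \<Rightarrow> 'p set \<Rightarrow> ('n, 'm, 'p) vpoint \<Rightarrow> ('n, 'm, 'p) vpoint \<Rightarrow> bool" where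
  "step22 P r \<mu> xb J = (\<lambda>(x, y, V) (dx, dy, dV).
     dy \<in> vecs (idx r xb) \<and> symm dV \<and>
     newton_a P r xb (x, y, V) (dx, dy, dV) \<and> newton_b P \<mu> (x, y, V) (dx, dy, dV) \<and>
     (\<forall>i\<in>J. lin_ghat P r xb x dx i = 0) \<and>
     (\<forall>i\<in>idx r xb - J. y $ i + dy $ i = 0))"

definition steplen :: "real \<Rightarrow> real^'m^'m::finite \<Rightarrow> real^'m^'m \<Rightarrow> real" where
  "steplen \<delta> X D = (let l = lambda_min (matrix_inv X ** D) in if l \<le> -1 then - \<delta> / l else 1)"

definition take_step :: "('n::finite, 'm::finite, 'q::finite) sisdp \<Rightarrow> real \<Rightarrow>
    ('n, 'm, 'p::finite) vpoint \<Rightarrow> ('n, 'm, 'p) vpoint \<Rightarrow> ('n, 'm, 'p) vpoint" where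
  "take_step P \<delta> = (\<lambda>(x, y, V) (dx, dy, dV).
     (x, y, V) + min (steplen \<delta> (Fmap P x) (Flin P dx)) (steplen \<delta> V dV) *\<^sub>R (dx, dy, dV))"

text \<open>
  Below, \<open>w\<close> is the current iterate, \<open>dh\<close> and \<open>d1\<close> are the directions computed from it in the
  first and in the second half of the iteration.
\<close>

definition half_point :: "('n::finite, 'm::finite, 'q::finite) sisdp \<Rightarrow> ('n, 'q, 'p::finite) reduction \<Rightarrow>
    params \<Rightarrow> ('n, 'm, 'q) iterate \<Rightarrow> ('n, 'm, 'p) vpoint \<Rightarrow> ('n, 'm, 'p) vpoint" where
  "half_point P r a w dh = take_step P (delta a) (to_vec r (fst w) w) dh"

definition trial_point :: "('n::finite, 'm::finite, 'q::finite) sisdp \<Rightarrow> ('n, 'q, 'p::finite) reduction \<Rightarrow>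
    params \<Rightarrow> ('n, 'm, 'q) iterate \<Rightarrow> ('n, 'm, 'p) vpoint \<Rightarrow> ('n, 'm, 'p) vpoint \<Rightarrow>
    ('n, 'm, 'p) vpoint" where
  "trial_point P r a w dh d1 = take_step P (delta a) (half_point P r a w dh) d1"

definition step22_direction :: "('n::finite, 'm::finite, 'q::finite) sisdp \<Rightarrow>
    ('n, 'q, 'p::finite) reduction \<Rightarrow> params \<Rightarrow> nat \<Rightarrow> ('n, 'm, 'q) iterate \<Rightarrow>
    ('n, 'm, 'p) vpoint \<Rightarrow> ('n, 'm, 'p) vpoint \<Rightarrow> bool" where
  "step22_direction P r a k w dh d1 \<longleftrightarrow>
     fst (half_point P r a w dh) \<in> nbhd r (fst w) \<and>
     step22 P r (mu a k) (fst w) (Jact P r (fst w) dh) (half_point P r a w dh) d1"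

text \<open>
  A trial point lies in the neighbourhood of the central path only if its y-part is (the mass
  vector of) a nonnegative measure on the points \<open>tau r xb i x\<close>, which have to be defined at the
  trial point.
\<close>

definition step23_accepts :: "('n::finite, 'm::{finite,linorder}, 'q::finite) sisdp \<Rightarrow>
    ('n, 'q, 'p::finite) reduction \<Rightarrow> params \<Rightarrow> nat \<Rightarrow> ('n, 'm, 'q) iterate \<Rightarrow>
    ('n, 'm, 'p) vpoint \<Rightarrow> ('n, 'm, 'p) vpoint \<Rightarrow> bool" where
  "step23_accepts P r a k w dh d1 \<longleftrightarrow>
     step22_direction P r a k w dh d1 \<and>
     (case trial_point P r a w dh d1 of (x, v, V) \<Rightarrow>
        x \<in> nbhd r (fst w) \<and> (\<forall>i\<in>idx r (fst w). 0 \<le> v $ i) \<and>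
        of_vec P r (fst w) (x, v, V) \<in> Nset P (mu a k) (eps a k))"

definition algorithm2 :: "('n::finite, 'm::{finite,linorder}, 'q::finite) sisdp \<Rightarrow> real \<Rightarrow>
    ('n, 'q, 'p::finite) reduction \<Rightarrow> params \<Rightarrow> (nat \<Rightarrow> ('n, 'm, 'q) iterate) \<Rightarrow>
    (nat \<Rightarrow> ('n, 'm, 'p) vpoint) \<Rightarrow> (nat \<Rightarrow> ('n, 'm, 'p) vpoint) \<Rightarrow> bool" where
  "algorithm2 P \<sigma> r a w dh d1 \<longleftrightarrow>
     (case w 0 of (x, y, V) \<Rightarrow> y \<in> Mplus P \<and> posdef (Fmap P x) \<and> posdef V) \<and>
     (\<forall>k. \<not> KKT P (w k) \<and>
        reduction_at P \<sigma> r (fst (w k)) \<and>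
        step21 P r (mu a k) (fst (w k)) (to_vec r (fst (w k)) (w k)) (dh k) \<and>
        ((\<exists>d. step22_direction P r a k (w k) (dh k) d) \<longrightarrow>
           step22_direction P r a k (w k) (dh k) (d1 k)) \<and>
        (if step23_accepts P r a k (w k) (dh k) (d1 k)
         then w (Suc k) = of_vec P r (fst (w k)) (trial_point P r a (w k) (dh k) (d1 k))
         else w (Suc k) \<in> Nset P (mu a k) (eps a k)))"


section \<open>Assumptions on the limit\<close>

text \<open>
  Equality of the implicit functions at \<open>w k\<close> and at the limit is equality of indexed families of
  functions, domains included.
\<close>

definition assumption_B :: "('n::finite, 'm::{finite,linorder}, 'q::finite) sisdp \<Rightarrow> real \<Rightarrow>
    ('n, 'q, 'p::finite) reduction \<Rightarrow> (nat \<Rightarrow> ('n, 'm, 'q) iterate) \<Rightarrow> ('n, 'm, 'q) iterate \<Rightarrow> bool" where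
  "assumption_B P \<sigma> r w ws \<longleftrightarrow>
     (\<lambda>k. coords r (fst ws) (w k)) \<longlonglongrightarrow> coords r (fst ws) ws \<and> KKT P ws \<and>
     nondegenerate P \<sigma> (fst ws) \<and> reduction_at P \<sigma> r (fst ws) \<and>
     (\<forall>\<^sub>F k in sequentially.
        nbhd r (fst (w k)) = nbhd r (fst ws) \<and> idx r (fst (w k)) = idx r (fst ws) \<and>
        (\<forall>i\<in>idx r (fst ws). \<forall>x\<in>nbhd r (fst ws). tau r (fst (w k)) i x = tau r (fst ws) i x) \<and>
        discrete_measure P (fst (snd (w k))) \<and>
        msupp P (fst (snd (w k))) \<subseteq> (\<lambda>i. tau r (fst ws) i (fst (w k))) ` idx r (fst ws))"

definition Iact :: "('n::finite, 'm::finite, 'q::finite) sisdp \<Rightarrow> ('n, 'q, 'p::finite) reduction \<Rightarrow>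
    real^'n \<Rightarrow> 'p set" where
  "Iact P r xs = {i\<in>idx r xs. ghat P r xs i xs = 0}"

text \<open>
  Domain and codomain of \<open>Phi0\<close> are the subspace \<open>Phi0_space\<close>, a copy of the direct sum of
  R^n, R^|Iact| and R^(m(m+1)/2).
\<close>

definition Phi0 :: "('n::finite, 'm::{finite,linorder}, 'q::finite) sisdp \<Rightarrow>
    ('n, 'q, 'p::finite) reduction \<Rightarrow> real^'n \<Rightarrow>
    (real^'n) \<times> (real^'p) \<times> (real^('m \<times> 'm)) \<Rightarrow> (real^'n) \<times> (real^'p) \<times> (real^('m \<times> 'm))" where
  "Phi0 P r xs = (\<lambda>(x, y, v).
     (grad (obj P) x + (\<Sum>i\<in>Iact P r xs. y $ i *\<^sub>R grad (ghat P r xs i) x) - Fadj P (smat v),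
      (\<chi> i. if i \<in> Iact P r xs then ghat P r xs i x else 0),
      svec (sprod (Fmap P x) (smat v))))"

definition Phi0_space :: "('n::finite, 'm::{finite,linorder}, 'q::finite) sisdp \<Rightarrow>
    ('n, 'q, 'p::finite) reduction \<Rightarrow> real^'n \<Rightarrow>
    ((real^'n) \<times> (real^'p) \<times> (real^('m \<times> 'm))) set" where
  "Phi0_space P r xs = UNIV \<times> vecs (Iact P r xs) \<times> svec ` {X. symm X}"

text \<open>
  Smoothness of \<open>con P\<close> is required jointly in x and \<tau>: separate smoothness in x does not make the
  functions \<open>ghat P r xb i\<close> twice differentiable.
\<close>

definition assumption_C :: "('n::finite, 'm::{finite,linorder}, 'q::finite) sisdp \<Rightarrow>
    ('n, 'q, 'p::finite) reduction \<Rightarrow> (nat \<Rightarrow> ('n, 'm, 'q) iterate) \<Rightarrow> (nat \<Rightarrow> ('n, 'm, 'p) vpoint) \<Rightarrow>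
    ('n, 'm, 'q) iterate \<Rightarrow> bool" where
  "assumption_C P r w dh ws \<longleftrightarrow>
     Ck_on 3 UNIV (obj P) \<and>
     (\<exists>W. open W \<and> Tset P \<subseteq> W \<and> Ck_on 3 (UNIV \<times> W) (\<lambda>(x, \<tau>). con P x \<tau>)) \<and>
     (\<forall>\<^sub>F k in sequentially. Jact P r (fst (w k)) (dh k) = Iact P r (fst ws)) \<and>
     (case to_vec r (fst ws) ws of (xs, ys, Vs) \<Rightarrow>
        posdef (Fmap P xs + Vs) \<and>
        (\<forall>i\<in>idx r xs. - ghat P r xs i xs + ys $ i > 0) \<and>
        (\<exists>D. (Phi0 P r xs has_derivative D)
               (at (xs, (\<chi> i. if i \<in> Iact P r xs then ys $ i else 0), svec Vs)
                  within Phi0_space P r xs) \<and>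
             bij_betw D (Phi0_space P r xs) (Phi0_space P r xs)))"

end

theory Submission
  imports Defs
begin

text \<open>
  Points are triples \<open>w = (x, y, V)\<close>, where \<open>y\<close> is the vector of masses. Let \<open>Psi w\<close> consist of the
  gradient of the Lagrangian, of the values \<open>ghat i x\<close> for the active \<open>i\<close> and the masses \<open>y i\<close> for the
  inactive ones, and of \<open>F(x) \<circ> V\<close>. The limit is a zero of \<open>Psi\<close>, the derivative of \<open>Psi\<close> there is
  injective on the directions with symmetric matrix part (\<open>DPsi_nonsingular\<close>), and the central path is
  \<open>Psi w = (0, 0, \<mu> I)\<close>. Fix a late iteration and write \<open>m\<close> and \<open>e\<close> for the barrier parameter and the
  tolerance of the previous iteration, \<open>\<mu>\<close> for the current barrier parameter. The current iterate
  satisfies \<open>Psi w = (0, 0, m I) + O(e)\<close>: strict complementarity splits the bounds on the two scalar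
  residuals into a bound for each constraint (\<open>residual_of_iterate\<close>). As \<open>e = o(m)\<close>, its distance to the
  limit has exact order \<open>m\<close> (\<open>stage_dist\<close>). The same holds for the next iterate with \<open>\<mu>\<close>, which is
  of order \<open>m powr (1 + c \<alpha>)\<close>, and this is the asserted rate. It remains to see that the trial point is
  eventually accepted, that is, that its residual is at most the new tolerance, and that no step is
  shortened.

  Steps are not shortened because of \<open>posdef_of_sprod\<close>: if \<open>X + Y\<close> and \<open>X \<circ> Y\<close> are positive definite, so
  are \<open>X\<close> and \<open>Y\<close>. Near the limit \<open>F(x) + V\<close> is positive definite, and after a full step \<open>F(x) \<circ> V\<close> is
  \<open>\<mu> I + o(\<mu>)\<close>.

  Both directions solve the Newton equation for \<open>Psi w = (0, 0, \<mu> I)\<close> up to an error in the matrix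
  component. With \<open>F = F(x)\<close> this error is one eighth of \<open>[[F, V], Z]\<close>, where \<open>F \<circ> Z\<close> is the increment of
  \<open>F\<close> (\<open>step22_iff\<close>). The difficulty is that \<open>F\<close> becomes singular in the limit, with
  eigenvalues of order \<open>m\<close>. Let \<open>Q\<close> be the orthogonal projection onto the kernel of the limit of \<open>F\<close>. Solving \<open>F \<circ> Z = D\<close>
  amplifies only the block \<open>Q D Q\<close>, by a factor of order \<open>1/m\<close> (\<open>lyapunov_block_estimates\<close>). Since
  \<open>F \<circ> [F, V] = [F, F \<circ> V - m I]\<close>, where the kernel block of the right-hand side is small, \<open>[F, V]\<close> is
  \<open>O(e)\<close> (\<open>stage_commutator\<close>). The first direction then has size \<open>O(m)\<close> and error \<open>O(e)\<close>; it leads to a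
  point with residual \<open>O(e)\<close>, hence at distance \<open>O(\<mu>)\<close> from the limit (\<open>half_stage\<close>). The second direction has
  size \<open>O(e)\<close>, so that its error is \<open>O(e\<^sup>2 / \<mu>)\<close>.

  For \<open>c = 1 / (\<alpha> + 2)\<close> the new tolerance is itself of order \<open>e\<^sup>2 / \<mu>\<close>, and the error has to be improved to
  \<open>o(e\<^sup>2 / \<mu>)\<close>. This is done by following the kernel block. In the first half the matrix \<open>Z\<close> equals
  \<open>Z0 - I\<close>, where \<open>F \<circ> Z0\<close> is the new value of \<open>F\<close>, whose kernel part is only \<open>O(\<mu>)\<close>; thus \<open>Z0 Q\<close> tends
  to 0, the identity does not contribute to the commutator, and the kernel block of the new residual is
  \<open>o(e)\<close> (\<open>half_kernel_block\<close>). Hence the second increment of \<open>F\<close> has a kernel block \<open>o(e)\<close>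
  (\<open>second_direction_kernel_block\<close>), and only this block is amplified.
\<close>

section \<open>Matrices with the Frobenius inner product\<close>

lemma norm_matrix_sq: "(norm (A::real^'b^'a))\<^sup>2 = (\<Sum>i\<in>UNIV. \<Sum>j\<in>UNIV. (A$i$j)\<^sup>2)"
  unfolding power2_norm_eq_inner inner_vec_def by (simp add: power2_eq_square)

lemma inner_transpose: "transpose A \<bullet> transpose B = (A::real^'b^'a) \<bullet> B"
  unfolding inner_vec_def transpose_def by (simp add: sum.swap[of _ "UNIV::'b set"])

lemma norm_transpose [simp]: "norm (transpose (A::real^'b^'a)) = norm A"
  unfolding norm_eq_sqrt_inner inner_transpose ..

lemma inner_matrix_columns: "(A::real^'b^'a) \<bullet> B = (\<Sum>j\<in>UNIV. column j A \<bullet> column j B)"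
  unfolding inner_vec_def column_def by (simp add: sum.swap[of _ "UNIV::'b set"])

lemma column_matrix_mult: "column j ((A::real^'b^'a) ** (B::real^'c^'b)) = A *v column j B"
  by (simp add: column_def matrix_matrix_mult_def matrix_vector_mult_def vec_eq_iff)

text \<open>
  The norm of a matrix, as an element of a Euclidean space, is the Frobenius norm.
\<close>

lemma norm_matrix_vector_le: "norm ((A::real^'b^'a) *v v) \<le> norm A * norm v"
proof (rule power2_le_imp_le)
  have "(norm (A *v v))\<^sup>2 = (\<Sum>i\<in>UNIV. (A$i \<bullet> v)\<^sup>2)"
    unfolding power2_norm_eq_inner inner_vec_def[of "A *v v"]
    by (simp add: matrix_vector_mul_component power2_eq_square)
  also have "\<dots> \<le> (\<Sum>i\<in>UNIV. (norm (A$i) * norm v)\<^sup>2)"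
    by (intro sum_mono) (metis Cauchy_Schwarz_ineq2 abs_ge_zero power2_abs power_mono)
  also have "\<dots> = (norm A * norm v)\<^sup>2"
    unfolding power_mult_distrib sum_distrib_right[symmetric] power2_norm_eq_inner[of A] inner_vec_def[of A]
    by (simp add: power2_norm_eq_inner)
  finally show "(norm (A *v v))\<^sup>2 \<le> (norm A * norm v)\<^sup>2" .
qed simp

lemma norm_matrix_mult_le: "norm ((A::real^'b^'a) ** (B::real^'c^'b)) \<le> norm A * norm B"
proof (rule power2_le_imp_le)
  have "(norm (A ** B))\<^sup>2 = (\<Sum>j\<in>UNIV. (norm (A *v column j B))\<^sup>2)"
    unfolding power2_norm_eq_inner inner_matrix_columns column_matrix_mult ..
  also have "\<dots> \<le> (\<Sum>j\<in>UNIV. (norm A * norm (column j B))\<^sup>2)"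
    by (intro sum_mono power_mono norm_matrix_vector_le) simp
  also have "\<dots> = (norm A * norm B)\<^sup>2"
    unfolding power_mult_distrib sum_distrib_left[symmetric] power2_norm_eq_inner[of B]
      inner_matrix_columns[of B] by (simp add: power2_norm_eq_inner)
  finally show "(norm (A ** B))\<^sup>2 \<le> (norm A * norm B)\<^sup>2" .
qed simp

interpretation matmul: bounded_bilinear "(**) :: real^'b^'a \<Rightarrow> real^'c^'b \<Rightarrow> real^'c^'a"
proof
  show "\<exists>K. \<forall>(a::real^'b^'a) (b::real^'c^'b). norm (a ** b) \<le> norm a * norm b * K"
    by (rule exI[of _ 1]) (simp add: norm_matrix_mult_le)
qed (vector matrix_matrix_mult_def sum.distrib field_simps sum_distrib_left)+

lemmas mat_algebra = matmul.add_left matmul.add_right matmul.diff_left matmul.diff_right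
  matmul.scaleR_left matmul.scaleR_right matmul.minus_left matmul.minus_right
  matrix_mul_assoc

lemma transpose_add: "transpose ((A::real^'b^'a) + B) = transpose A + transpose B"
  and transpose_diff: "transpose ((A::real^'b^'a) - B) = transpose A - transpose B"
  by (vector transpose_def)+

lemma inner_matmul_left: "((A::real^'b^'a) ** (B::real^'c^'b)) \<bullet> C = B \<bullet> (transpose A ** C)"
  unfolding inner_matrix_columns column_matrix_mult
  by (simp add: dot_lmul_matrix inner_commute[of "A *v _"] inner_commute[of "column _ B"])

lemma inner_matmul_right: "((A::real^'b^'a) ** (B::real^'c^'b)) \<bullet> C = A \<bullet> (C ** transpose B)"
proof -
  have "(A ** B) \<bullet> C = (transpose B ** transpose A) \<bullet> transpose C"
    by (simp only: matrix_transpose_mul[symmetric] inner_transpose)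
  also have "\<dots> = transpose A \<bullet> transpose (C ** transpose B)"
    by (simp add: inner_matmul_left matrix_transpose_mul)
  finally show ?thesis by (simp only: inner_transpose)
qed

section \<open>Coercive symmetric matrices\<close>

definition coercive :: "real \<Rightarrow> real^'m^'m::finite \<Rightarrow> bool" where
  "coercive c X \<longleftrightarrow> (\<forall>v. c * (v \<bullet> v) \<le> v \<bullet> (X *v v))"

lemma symmD: "symm X \<Longrightarrow> transpose X = X" by (simp add: symm_def)

lemma symm_inner: "symm X \<Longrightarrow> u \<bullet> (X *v v) = (X *v u) \<bullet> v"
  by (metis dot_lmul_matrix symmD transpose_matrix_vector)

lemma symm_simps [intro]:
  "symm A \<Longrightarrow> symm B \<Longrightarrow> symm (A + B)" "symm A \<Longrightarrow> symm B \<Longrightarrow> symm (A - B)"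
  "symm A \<Longrightarrow> symm (a *\<^sub>R A)" "symm 0" "symm (mat 1)"
  "symm A \<Longrightarrow> symm B \<Longrightarrow> symm (sprod A B)"
  by (auto simp: symm_def transpose_add transpose_diff transpose_scalar sprod_def matrix_transpose_mul
      add.commute) (vector transpose_def)

lemma symm_sum: "(\<And>i. i \<in> I \<Longrightarrow> symm (A i)) \<Longrightarrow> symm (sum A I)"
  by (induction I rule: infinite_finite_induct) auto

lemma bilinear_sprod: "bounded_bilinear (sprod :: real^'m^'m \<Rightarrow> real^'m^'m \<Rightarrow> real^'m^'m::finite)"
proof
  have "norm (sprod a b) \<le> norm a * norm b" for a b :: "real^'m^'m"
    unfolding sprod_def using norm_triangle_ineq[of "a ** b" "b ** a"]
      norm_matrix_mult_le[of a b] norm_matrix_mult_le[of b a] by (simp add: mult.commute)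
  then show "\<exists>K. \<forall>(a::real^'m^'m) b. norm (sprod a b) \<le> norm a * norm b * K"
    by (intro exI[of _ 1]) simp
qed (simp_all add: sprod_def mat_algebra algebra_simps)

interpretation sprod: bounded_bilinear sprod by (rule bilinear_sprod)

lemma norm_sprod_le: "norm (sprod A B) \<le> norm A * norm (B::real^'m^'m::finite)"
    unfolding sprod_def using norm_triangle_ineq[of "A ** B" "B ** A"]
      norm_matrix_mult_le[of A B] norm_matrix_mult_le[of B A] by (simp add: mult.commute)

lemma sprod_commute: "sprod X Y = sprod Y X"
  by (simp add: sprod_def add.commute)

lemma sprod_mat1 [simp]: "sprod X (mat 1) = X"
  by (simp add: sprod_def flip: scaleR_add_left)

text \<open>
  This is how \<open>X \<circ> Y\<close> is tested on an eigenvector of \<open>X\<close>.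
\<close>

lemma sprod_quadratic:
  assumes "symm X" "symm Y"
  shows "v \<bullet> (sprod X Y *v v) = (X *v v) \<bullet> (Y *v v)"
proof -
  have "v \<bullet> (sprod X Y *v v) = (v \<bullet> (X *v (Y *v v)) + v \<bullet> (Y *v (X *v v))) / 2"
    by (simp add: sprod_def algebra_simps matrix_vector_mul_assoc scaleR_matrix_vector_assoc[symmetric]
        inner_add_right)
  also have "\<dots> = (X *v v) \<bullet> (Y *v v)"
    using symm_inner[OF assms(1), of v "Y *v v"] symm_inner[OF assms(2), of v "X *v v"]
    by (simp add: inner_commute)
  finally show ?thesis .
qed

lemma quadratic_form_bound: "\<bar>v \<bullet> ((A::real^'m^'m) *v v)\<bar> \<le> norm A * (v \<bullet> v)"
proof -
  have "\<bar>v \<bullet> (A *v v)\<bar> \<le> norm v * (norm A * norm v)"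
    by (rule order_trans[OF Cauchy_Schwarz_ineq2]) (intro mult_left_mono norm_matrix_vector_le, simp)
  then show ?thesis by (simp add: power2_norm_eq_inner[symmetric] power2_eq_square mult_ac)
qed

lemma coercive_perturb: "coercive c X \<Longrightarrow> norm (X - Y) \<le> d \<Longrightarrow> coercive (c - d) Y"
  unfolding coercive_def
proof
  fix v assume *: "\<forall>v. c * (v \<bullet> v) \<le> v \<bullet> (X *v v)" "norm (X - Y) \<le> d"
  have "v \<bullet> (X *v v) - v \<bullet> (Y *v v) = v \<bullet> ((X - Y) *v v)" by (simp add: algebra_simps inner_diff_right)
  also have "\<dots> \<le> norm (X - Y) * (v \<bullet> v)" using quadratic_form_bound[of v "X - Y"] by simp
  also have "\<dots> \<le> d * (v \<bullet> v)" using * by (intro mult_right_mono) auto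
  finally show "(c - d) * (v \<bullet> v) \<le> v \<bullet> (Y *v v)" using *(1)[rule_format, of v] by (simp add: algebra_simps)
qed

lemma coercive_mat1: "coercive c (c *\<^sub>R mat 1)"
  by (simp add: coercive_def scaleR_matrix_vector_assoc[symmetric])

lemma coercive_posdef: "coercive c X \<Longrightarrow> 0 < c \<Longrightarrow> symm X \<Longrightarrow> posdef X"
  unfolding coercive_def posdef_def by (metis inner_gt_zero_iff mult_pos_pos order_less_le_trans)

lemma posdef_psd: "posdef X \<Longrightarrow> psd X"
  unfolding posdef_def psd_def by (metis inner_zero_left less_eq_real_def)

lemma coercive_inner_left: "coercive c X \<Longrightarrow> c * (W \<bullet> W) \<le> W \<bullet> (X ** W)"
  unfolding coercive_def inner_matrix_columns column_matrix_mult sum_distrib_left by (intro sum_mono) auto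

lemma coercive_inner_right:
  assumes "coercive c X" "symm X" shows "c * (W \<bullet> W) \<le> W \<bullet> (W ** X)"
proof -
  have "W \<bullet> (W ** X) = transpose W \<bullet> (X ** transpose W)"
    by (metis assms(2) inner_transpose matrix_transpose_mul symmD)
  then show ?thesis using coercive_inner_left[OF assms(1), of "transpose W"] by (simp add: inner_transpose)
qed

text \<open>
  If \<open>M *v v\<close> were nonzero, moving from \<open>v\<close> a little in the direction \<open>- M *v v\<close> would make the form negative.
\<close>

lemma psd_kernel:
  assumes "psd M" "v \<bullet> (M *v v) = 0" shows "M *v v = 0"
proof (rule ccontr)
  assume ne: "M *v v \<noteq> 0"
  define u where "u = M *v v"
  define q where "q = u \<bullet> u"
  define p where "p = u \<bullet> (M *v u)"
  have q: "q > 0" using ne by (simp add: q_def u_def)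
  have p: "p \<ge> 0" using assms(1) by (simp add: psd_def p_def)
  have vu: "v \<bullet> (M *v u) = q"
    using assms(1) symm_inner[of M v u] by (simp add: psd_def q_def u_def)
  have *: "0 \<le> 2 * t * q + t\<^sup>2 * p" for t
  proof -
    have "0 \<le> (v + t *\<^sub>R u) \<bullet> (M *v (v + t *\<^sub>R u))" using assms(1) by (simp add: psd_def)
    also have "\<dots> = 2 * t * q + t\<^sup>2 * p"
      using assms(2) vu by (simp add: algebra_simps inner_add_left inner_add_right p_def q_def
          matrix_vector_mult_scaleR power2_eq_square flip: u_def)
    finally show ?thesis .
  qed
  \<comment> \<open>any step small enough against \<open>q / p\<close> works; the 1 covers \<open>p = 0\<close>\<close>
  define t where "t = - q / (p + 1)"
  have t: "t < 0" "t * p = - q - t" using p q by (simp_all add: t_def divide_neg_pos field_simps)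
  have "2 * t * q + t\<^sup>2 * p = t * (2 * q + t * p)" by (simp add: power2_eq_square algebra_simps)
  also have "\<dots> = t * (q - t)" by (simp add: t(2))
  also have "\<dots> < 0" using t q by (intro mult_neg_pos) auto
  finally show False using *[of t] by simp
qed

text \<open>
  At a minimizer \<open>v\<close> of the quotient of the two forms on the unit sphere, with minimum \<open>l\<close>, the matrix
  \<open>D - l X\<close> is positive semidefinite and its form vanishes at \<open>v\<close>; so \<open>psd_kernel\<close> yields the eigenvalue equation.
\<close>

lemma rayleigh_minimizer:
  assumes X: "posdef X" and D: "symm D"
  obtains l v where "v \<noteq> 0" "D *v v = l *\<^sub>R (X *v v)" "\<And>u. l * (u \<bullet> (X *v u)) \<le> u \<bullet> (D *v u)"
proof -
  define q where "q = (\<lambda>v. (v \<bullet> (D *v v)) / (v \<bullet> (X *v v)))"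
  have pos: "0 < v \<bullet> (X *v v)" if "v \<noteq> 0" for v using X that by (simp add: posdef_def)
  have nz: "v \<bullet> (X *v v) \<noteq> 0" if "v \<in> sphere 0 1" for v using pos[of v] that by (cases "v = 0") auto
  have cont: "continuous_on (sphere 0 1) q"
    unfolding q_def
    by (intro continuous_intros linear_continuous_on matrix_vector_mul_bounded_linear
        ballI nz)
  have ne: "sphere (0::real^'a) 1 \<noteq> {}" by (metis empty_iff in_mono norm_axis_1 subset_refl dist_0_norm mem_sphere)
  obtain v where v: "v \<in> sphere 0 1" and mn: "\<And>u. u \<in> sphere 0 1 \<Longrightarrow> q v \<le> q u"
    using continuous_attains_inf[OF compact_sphere ne cont] by blast
  have v0: "v \<noteq> 0" using v by auto
  have le: "q v * (u \<bullet> (X *v u)) \<le> u \<bullet> (D *v u)" for u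
  proof (cases "u = 0")
    case False
    have "q v \<le> q ((1 / norm u) *\<^sub>R u)" by (rule mn) (use False in simp)
    also have "\<dots> = q u" using False by (simp add: q_def matrix_vector_mult_scaleR field_simps)
    finally show ?thesis using pos[OF False] by (simp add: q_def field_simps)
  qed simp
  have "psd (D - q v *\<^sub>R X)"
    unfolding psd_def using D X le
    by (auto simp: posdef_def algebra_simps inner_diff_right scaleR_matrix_vector_assoc[symmetric])
  moreover have "v \<bullet> ((D - q v *\<^sub>R X) *v v) = 0"
    using pos[OF v0] by (simp add: algebra_simps inner_diff_right scaleR_matrix_vector_assoc[symmetric] q_def)
  ultimately have "(D - q v *\<^sub>R X) *v v = 0" by (rule psd_kernel)
  then have "D *v v = q v *\<^sub>R (X *v v)" by (simp add: algebra_simps scaleR_matrix_vector_assoc[symmetric])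
  with v0 le that show ?thesis by blast
qed

lemma posdef_mat1: "posdef (mat 1)"
  by (simp add: posdef_def symm_simps)

lemma min_eigenvector:
  assumes "symm D"
  obtains l v where "v \<noteq> 0" "D *v v = l *\<^sub>R v" "\<And>u. l * (u \<bullet> u) \<le> u \<bullet> (D *v u)"
  using rayleigh_minimizer[OF posdef_mat1 assms] by (metis matrix_vector_mul_lid)

lemma posdef_coercive: assumes "posdef X" obtains c where "0 < c" "coercive c X"
proof -
  obtain l v where v: "v \<noteq> 0" "X *v v = l *\<^sub>R v" "\<And>u. l * (u \<bullet> u) \<le> u \<bullet> (X *v u)"
    using min_eigenvector[of X] assms unfolding posdef_def by metis
  have "0 < v \<bullet> (X *v v)" using assms v(1) by (simp add: posdef_def)
  then have "0 < l" using inner_ge_zero[of v] by (simp add: v(2) zero_less_mult_iff)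
  with v(3) that show ?thesis by (auto simp: coercive_def)
qed

text \<open>
  For an eigenvector \<open>v\<close> of the smallest eigenvalue \<open>l\<close> of \<open>X\<close>, both \<open>l * (v \<bullet> Y v)\<close> and \<open>l * (v \<bullet> v) + v \<bullet> Y v\<close>
  are positive, which excludes \<open>l \<le> 0\<close>.
\<close>

lemma posdef_of_sprod:
  assumes X: "symm X" and Y: "symm Y" and S: "posdef (X + Y)" and P: "posdef (sprod X Y)"
  shows "posdef X"
proof -
  obtain l v where v: "v \<noteq> 0" "X *v v = l *\<^sub>R v" "\<And>u. l * (u \<bullet> u) \<le> u \<bullet> (X *v u)"
    using min_eigenvector[OF X] by metis
  have "0 < l * (v \<bullet> (Y *v v))"
    using P v(1) sprod_quadratic[OF X Y, of v] v(2) unfolding posdef_def by (metis inner_scaleR_left)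
  moreover have "0 < l * (v \<bullet> v) + v \<bullet> (Y *v v)"
    using conjunct2[OF S[unfolded posdef_def], rule_format, OF v(1)]
    by (simp add: algebra_simps inner_add_right v(2))
  moreover have "0 < v \<bullet> v" using v(1) by simp
  ultimately have "0 < l" by (smt (verit, best) mult_neg_pos mult_nonpos_nonneg zero_less_mult_iff)
  then show ?thesis using v(3) X coercive_posdef[of l X] by (simp add: coercive_def)
qed

text \<open>
  Near the central path, where \<open>X \<circ> Y\<close> is close to \<open>m I\<close> with \<open>Y\<close> bounded, \<open>X\<close> degenerates at most like \<open>m\<close>.
\<close>

lemma coercive_of_sprod:
  assumes X: "psd X" and Y: "psd Y" and P: "coercive c (sprod X Y)" and c: "0 \<le> c" and B: "norm Y \<le> B" "0 < B"
  shows "coercive (c / B) X"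
proof -
  obtain l v where v: "v \<noteq> 0" "X *v v = l *\<^sub>R v" "\<And>u. l * (u \<bullet> u) \<le> u \<bullet> (X *v u)"
    using min_eigenvector[of X] X unfolding psd_def by metis
  have vv: "0 < v \<bullet> v" using v(1) by simp
  have "0 \<le> v \<bullet> (X *v v)" using X by (simp add: psd_def)
  then have l: "0 \<le> l" using vv by (simp add: v(2) zero_le_mult_iff)
  have "c * (v \<bullet> v) \<le> l * (v \<bullet> (Y *v v))"
    using P[unfolded coercive_def, rule_format, of v] sprod_quadratic[of X Y v] v(2) X Y
    by (simp add: psd_def)
  also have "\<dots> \<le> l * (B * (v \<bullet> v))"
    using quadratic_form_bound[of v Y] mult_right_mono[OF B(1), of "v \<bullet> v"] l
    by (intro mult_left_mono) auto
  finally have "c * (v \<bullet> v) \<le> (l * B) * (v \<bullet> v)" by simp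
  then have "c \<le> l * B" using vv by (rule mult_right_le_imp_le)
  then have "c / B \<le> l" using B(2) by (simp add: field_simps)
  show ?thesis unfolding coercive_def
  proof
    fix u :: "real^'a"
    have "c / B * (u \<bullet> u) \<le> l * (u \<bullet> u)" using \<open>c / B \<le> l\<close> by (intro mult_right_mono) auto
    then show "c / B * (u \<bullet> u) \<le> u \<bullet> (X *v u)" using v(3)[of u] by linarith
  qed
qed

lemma matrix_zero_if_axis: "(\<And>i. (A::real^'m^'m) *v axis i 1 = 0) \<Longrightarrow> A = 0"
  by (auto simp: matrix_vector_mult_basis column_def vec_eq_iff)

text \<open>
  The two factors anticommute, so \<open>F V F = - V F\<^sup>2\<close> has a trace equal to its own negative. As \<open>F V F\<close> is
  positive semidefinite, all its diagonal entries vanish.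
\<close>

lemma complementary_product_zero:
  assumes F: "psd F" and V: "psd V" and 0: "sprod F V = 0"
  shows "F ** V = 0" "V ** F = 0"
proof -
  have sF: "symm F" and sV: "symm V" using F V by (auto simp: psd_def)
  have anti: "F ** V = - (V ** F)"
    using 0 by (simp add: sprod_def eq_neg_iff_add_eq_0)
  define M where "M = F ** V ** F"
  have M1: "M = - (V ** F ** F)" by (simp add: M_def anti mat_algebra)
  have form: "v \<bullet> (M *v v) = (F *v v) \<bullet> (V *v (F *v v))" for v
    using symm_inner[OF sF, of v "V *v (F *v v)"] by (simp add: M_def matrix_vector_mul_assoc mat_algebra)
  have M2: "psd M"
    unfolding psd_def
  proof (intro conjI allI)
    show "symm M" using sF sV by (simp add: symm_def M_def matrix_transpose_mul mat_algebra)
    show "0 \<le> v \<bullet> (M *v v)" for v using V by (simp add: form psd_def)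
  qed
  have "mat 1 \<bullet> M = - (mat 1 \<bullet> (V ** F ** F))" by (simp add: M1)
  also have "mat 1 \<bullet> (V ** F ** F) = mat 1 \<bullet> M"
  proof -
    have "mat 1 \<bullet> (V ** F ** F) = F \<bullet> (V ** F)"
      using inner_matmul_right[of "V ** F" F "mat 1"] sF by (simp add: inner_commute symm_def)
    also have "\<dots> = mat 1 \<bullet> M"
      using inner_matmul_left[of F "V ** F" "mat 1"] sF by (simp add: inner_commute symm_def M_def mat_algebra)
    finally show ?thesis .
  qed
  finally have "mat 1 \<bullet> M = 0" by simp
  then have tr: "(\<Sum>i\<in>UNIV. axis i 1 \<bullet> (M *v axis i 1)) = 0"
    unfolding inner_matrix_columns
    by (simp add: matrix_vector_mult_basis) (simp add: column_def mat_def axis_def inner_vec_def if_distrib if_distribR cong: if_cong)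
  have "V *v (F *v axis i 1) = 0" for i
  proof (rule psd_kernel[OF V])
    have "axis i 1 \<bullet> (M *v axis i 1) = 0"
      using tr M2 by (subst (asm) sum_nonneg_eq_0_iff) (auto simp: psd_def)
    then show "(F *v axis i 1) \<bullet> (V *v (F *v axis i 1)) = 0" by (simp add: form)
  qed
  then show "V ** F = 0" by (intro matrix_zero_if_axis) (simp add: matrix_vector_mul_assoc)
  then show "F ** V = 0" by (simp add: anti)
qed

section \<open>Step lengths and Lyapunov operators\<close>

text \<open>
  Eigenvectors of different eigenvalues are orthogonal with respect to the form of \<open>X\<close>, hence independent.
\<close>

lemma generalized_eigenvalues_finite:
  assumes X: "posdef X" and D: "symm D"
  shows "finite {l. \<exists>v. v \<noteq> 0 \<and> D *v v = l *\<^sub>R (X *v v)}"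
proof -
  define E where "E = {l. \<exists>v. v \<noteq> 0 \<and> D *v v = l *\<^sub>R (X *v v)}"
  have sX: "symm X" using X by (simp add: posdef_def)
  define v where "v l = (SOME v. v \<noteq> 0 \<and> D *v v = l *\<^sub>R (X *v v))" for l
  have v: "v l \<noteq> 0" "D *v v l = l *\<^sub>R (X *v v l)" if "l \<in> E" for l
  proof -
    have "\<exists>v. v \<noteq> 0 \<and> D *v v = l *\<^sub>R (X *v v)" using that by (simp add: E_def)
    then have "v l \<noteq> 0 \<and> D *v v l = l *\<^sub>R (X *v v l)" unfolding v_def by (rule someI_ex)
    then show "v l \<noteq> 0" "D *v v l = l *\<^sub>R (X *v v l)" by auto
  qed
  have orth: "v l \<bullet> (X *v v k) = 0" if "l \<in> E" "k \<in> E" "l \<noteq> k" for l k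
  proof -
    have "k * (v l \<bullet> (X *v v k)) = v l \<bullet> (D *v v k)" using v(2)[OF that(2)] by simp
    also have "\<dots> = l * ((X *v v l) \<bullet> v k)" unfolding symm_inner[OF D] v(2)[OF that(1)] by simp
    also have "\<dots> = l * (v l \<bullet> (X *v v k))" unfolding symm_inner[OF sX] ..
    finally have "k * (v l \<bullet> (X *v v k)) = l * (v l \<bullet> (X *v v k))" .
    with that(3) show ?thesis by simp
  qed
  have pos: "0 < v l \<bullet> (X *v v l)" if "l \<in> E" for l using X v(1)[OF that] by (simp add: posdef_def)
  have inj: "inj_on v E"
  proof (rule inj_onI)
    fix l k assume lk: "l \<in> E" "k \<in> E" "v l = v k"
    show "l = k"
    proof (rule ccontr)
      assume "l \<noteq> k"
      from orth[OF lk(1,2) this] pos[OF lk(2)] show False by (simp add: lk(3))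
    qed
  qed
  have "independent (v ` E)"
    unfolding independent_explicit_finite_subsets
  proof (intro allI impI ballI)
    fix S u x assume S: "S \<subseteq> v ` E" "finite S" "(\<Sum>y\<in>S. u y *\<^sub>R y) = 0" "x \<in> S"
    obtain l where l: "l \<in> E" "x = v l" using S(1,4) by blast
    have z: "x \<bullet> (X *v y) = 0" if y: "y \<in> S" "y \<noteq> x" for y
    proof -
      obtain k where k: "k \<in> E" "y = v k" using y(1) S(1) by blast
      have "l \<noteq> k" using y(2) l(2) k(2) by blast
      then show ?thesis unfolding l(2) k(2) by (rule orth[OF l(1) k(1)])
    qed
    have "0 = x \<bullet> (X *v (\<Sum>y\<in>S. u y *\<^sub>R y))" by (simp add: S(3))
    also have "\<dots> = (\<Sum>y\<in>S. u y * (x \<bullet> (X *v y)))"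
      by (simp add: linear_sum[OF matrix_vector_mul_linear] matrix_vector_mult_scaleR inner_sum_right)
    also have "\<dots> = u x * (x \<bullet> (X *v x))"
      unfolding sum.remove[OF S(2,4)] by (simp add: z)
    finally have "u x * (x \<bullet> (X *v x)) = 0" by simp
    with pos[OF l(1)] show "u x = 0" by (simp add: l(2))
  qed
  then have "finite (v ` E)" using independent_bound by blast
  then show ?thesis using finite_imageD inj unfolding E_def by blast
qed

lemma posdef_invertible:
  assumes "posdef X"
  shows "X ** matrix_inv X = mat 1" "matrix_inv X ** X = mat 1"
proof -
  have "v = 0" if "X *v v = 0" for v
    using conjunct2[OF assms[unfolded posdef_def], rule_format, of v] that by (cases "v = 0") auto
  then have "inj ((*v) X)" by (simp add: linear_injective_0[OF matrix_vector_mul_linear])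
  then have "invertible X"
    by (simp add: invertible_left_inverse matrix_left_invertible_injective)
  then have "X ** matrix_inv X = mat 1 \<and> matrix_inv X ** X = mat 1"
    unfolding matrix_inv_def invertible_def by (rule someI_ex)
  then show "X ** matrix_inv X = mat 1" "matrix_inv X ** X = mat 1" by auto
qed

text \<open>
  The generalized eigenvalues of \<open>D\<close> with respect to \<open>X\<close> form a finite nonempty set, so their minimum is
  attained; it exceeds -1 because \<open>X + D\<close> is positive on the eigenvectors.
\<close>

lemma steplen_full:
  assumes X: "posdef X" and D: "symm D" and XD: "posdef (X + D)"
  shows "steplen \<delta> X D = 1"
proof -
  define E where "E = {l. \<exists>v. v \<noteq> 0 \<and> (matrix_inv X ** D) *v v = l *\<^sub>R v}"
  have "(matrix_inv X ** D) *v v = l *\<^sub>R v \<longleftrightarrow> D *v v = l *\<^sub>R (X *v v)" for l v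
  proof
    assume "(matrix_inv X ** D) *v v = l *\<^sub>R v"
    then have "X *v ((matrix_inv X ** D) *v v) = l *\<^sub>R (X *v v)" by (simp add: matrix_vector_mult_scaleR)
    then show "D *v v = l *\<^sub>R (X *v v)"
      by (simp add: matrix_vector_mul_assoc matrix_mul_assoc posdef_invertible[OF X])
  next
    assume "D *v v = l *\<^sub>R (X *v v)"
    then have "matrix_inv X *v (D *v v) = l *\<^sub>R (matrix_inv X *v (X *v v))" by (simp add: matrix_vector_mult_scaleR)
    then show "(matrix_inv X ** D) *v v = l *\<^sub>R v"
      by (simp add: matrix_vector_mul_assoc posdef_invertible[OF X])
  qed
  then have E: "E = {l. \<exists>v. v \<noteq> 0 \<and> D *v v = l *\<^sub>R (X *v v)}" by (simp add: E_def)
  have fin: "finite E" unfolding E by (rule generalized_eigenvalues_finite[OF X D])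
  have ne: "E \<noteq> {}" unfolding E by (rule rayleigh_minimizer[OF X D]) auto
  have "-1 < l" if "l \<in> E" for l
  proof -
    have "\<exists>v. v \<noteq> 0 \<and> D *v v = l *\<^sub>R (X *v v)" using that by (simp only: E mem_Collect_eq)
    then obtain v where v: "v \<noteq> 0" "D *v v = l *\<^sub>R (X *v v)" by (elim exE conjE)
    have "0 < v \<bullet> ((X + D) *v v)" using conjunct2[OF XD[unfolded posdef_def], rule_format, OF v(1)] .
    also have "\<dots> = (1 + l) * (v \<bullet> (X *v v))" by (simp add: algebra_simps inner_add_right v(2))
    finally show ?thesis
      using conjunct2[OF X[unfolded posdef_def], rule_format, OF v(1)] by (simp add: zero_less_mult_iff)
  qed
  then have "-1 < Min E" using fin ne by simp
  then show ?thesis by (simp add: steplen_def lambda_min_def E_def)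
qed

lemma injective_endomorphism_surjective:
  fixes f :: "'a::euclidean_space \<Rightarrow> 'a"
  assumes S: "subspace S" and f: "linear f" and sub: "f ` S \<subseteq> S" and inj: "\<And>x. x \<in> S \<Longrightarrow> f x = 0 \<Longrightarrow> x = 0"
  shows "f ` S = S"
proof (rule subspace_dim_equal[OF linear_subspace_image[OF f S] S sub])
  have "span S = S" using S span_eq_iff by blast
  then have "inj_on f (span S)"
    using inj unfolding linear_inj_on_iff_eq_0[OF f subspace_span] by metis
  then show "dim S \<le> dim (f ` S)" by (simp add: dim_image_eq[OF f])
qed

lemma subspace_symm: "subspace {Z. symm Z}"
  by (auto simp: subspace_def)

lemma sprod_injective:
  assumes "posdef X" "sprod X Z = 0" shows "Z = 0"
proof -
  obtain c where c: "0 < c" "coercive c X" using posdef_coercive[OF assms(1)] .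
  have sX: "symm X" using assms(1) by (simp add: posdef_def)
  have "Z \<bullet> (X ** Z + Z ** X) = 0" using assms(2) by (simp add: sprod_def)
  then have "c * (Z \<bullet> Z) \<le> 0"
    using coercive_inner_left[OF c(2), of Z] coercive_inner_right[OF c(2) sX, of Z]
    by (simp add: inner_add_right)
  then show "Z = 0" using c(1) by (metis inner_eq_zero_iff inner_ge_zero mult_le_0_iff order.antisym not_le)
qed

text \<open>
  On the symmetric matrices \<open>sprod X\<close> is injective by coercivity, hence bijective.
\<close>

lemma lyap_inv:
  assumes X: "posdef X" and D: "symm D"
  shows "symm (lyap_inv X D)" "sprod X (lyap_inv X D) = D"
proof -
  have sX: "symm X" using X by (simp add: posdef_def)
  have "sprod X ` {Z. symm Z} = {Z. symm Z}"
    using sX sprod_injective[OF X]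
    by (intro injective_endomorphism_surjective subspace_symm bounded_linear.linear sprod.bounded_linear_right) auto
  then have "D \<in> sprod X ` {Z. symm Z}" using D by blast
  then show "symm (lyap_inv X D)" "sprod X (lyap_inv X D) = D"
    unfolding lyap_inv_def using inv_into_into f_inv_into_f by (metis mem_Collect_eq)+
qed

lemma lyap_inv_unique: "posdef X \<Longrightarrow> symm Z \<Longrightarrow> sprod X Z = D \<Longrightarrow> lyap_inv X D = Z"
proof -
  assume X: "posdef X" and Z: "symm Z" and D: "sprod X Z = D"
  have "symm D" using X Z D by (auto simp: posdef_def)
  then have "sprod X (lyap_inv X D - Z) = 0" using lyap_inv[OF X] D by (simp add: sprod.diff_right)
  then show ?thesis using sprod_injective[OF X] by force
qed

section \<open>Commutators\<close>

definition commutator :: "real^'m^'m::finite \<Rightarrow> real^'m^'m \<Rightarrow> real^'m^'m" where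
  "commutator A B = A ** B - B ** A"

lemma norm_commutator_le: "norm (commutator A B) \<le> 2 * (norm A * norm B)"
  unfolding commutator_def using norm_triangle_ineq4[of "A ** B" "B ** A"]
      norm_matrix_mult_le[of A B] norm_matrix_mult_le[of B A] by (simp add: mult.commute)

text \<open>
  Two Lyapunov operators commute up to the adjoint action of the commutator; this is the error of the directions.
\<close>

lemma sprod_commutator:
  "sprod F (sprod V Z) - sprod V (sprod F Z) = (1/4) *\<^sub>R commutator (commutator F V) Z"
  by (simp add: sprod_def commutator_def mat_algebra algebra_simps)

text \<open>
  A multiple of the identity may be subtracted because it commutes with \<open>F\<close>; so \<open>[F, V]\<close> is controlled by the distance of \<open>F \<circ> V\<close> from the central path.
\<close>

lemma sprod_commutator_self:
  "sprod F (commutator F V) = commutator F (sprod F V - a *\<^sub>R mat 1)"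
  by (simp add: sprod_def commutator_def mat_algebra algebra_simps)

lemma transpose_commutator:
  "symm F \<Longrightarrow> symm V \<Longrightarrow> transpose (commutator F V) = - commutator F V"
  by (simp add: commutator_def transpose_diff matrix_transpose_mul symm_def)

section \<open>Strictly complementary pairs\<close>

text \<open>
  The pair is the limit of \<open>F(x)\<close> and \<open>V\<close>; \<open>Q\<close> is the orthogonal projection onto the kernel of \<open>X\<close>, which is the range of \<open>Y\<close>.
\<close>

locale complementary_pair =
  fixes X Y Q :: "real^'m^'m::finite" and c :: real
  assumes symX: "symm X" and symY: "symm Y" and symQ: "symm Q"
    and QQ: "Q ** Q = Q" and XQ: "X ** Q = 0" and YQ: "Y ** Q = Y"
    and c: "0 < c" and coerc: "coercive c (X + Y)"

text \<open>
  Since \<open>X ** Y = 0 = Y ** X\<close>, the inverse of \<open>X + Y\<close> commutes with \<open>Y\<close>, and \<open>Q = Y ** matrix_inv (X + Y)\<close> is the projection; no spectral decomposition enters.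
\<close>

lemma complementary_pair_exists:
  assumes X: "psd X" and Y: "psd Y" and 0: "sprod X Y = 0" and S: "posdef (X + Y)"
  shows "\<exists>Q c. complementary_pair X Y Q c"
proof -
  have sX: "symm X" and sY: "symm Y" using X Y by (auto simp: psd_def)
  note z = complementary_product_zero[OF X Y 0]
  define S where "S = X + Y"
  define S' where "S' = matrix_inv S"
  note inv = posdef_invertible[OF S, folded S_def, folded S'_def]
  have SX: "S ** X = X ** S" and SY: "S ** Y = Y ** S" by (simp_all add: S_def mat_algebra z)
  have comm: "S' ** Y = Y ** S'"
  proof -
    have "S' ** Y = S' ** Y ** (S ** S')" by (simp add: inv)
    also have "\<dots> = S' ** (Y ** S) ** S'" by (simp add: mat_algebra)
    also have "\<dots> = (S' ** S) ** (Y ** S')" by (simp add: mat_algebra flip: SY)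
    finally show ?thesis by (simp add: inv)
  qed
  have S't: "transpose S' = S'"
  proof -
    have sS: "transpose S = S" using sX sY by (simp add: S_def symm_def transpose_add)
    have "transpose S' = transpose S' ** (S ** S')" by (simp add: inv)
    also have "\<dots> = transpose (S ** S') ** S'" by (simp add: matrix_transpose_mul sS mat_algebra)
    finally show ?thesis by (simp add: inv)
  qed
  obtain c where c: "0 < c" "coercive c (X + Y)" using posdef_coercive[OF S] .
  define Q where "Q = Y ** S'"
  have YQ: "Y ** Q = Y"
  proof -
    have "Y ** Q = (Y ** S) ** S'" by (simp add: Q_def S_def mat_algebra z)
    also have "\<dots> = Y ** (S ** S')" by (simp add: mat_algebra)
    finally show ?thesis by (simp add: inv)
  qed
  have "complementary_pair X Y Q c"
  proof
    show "symm Q" using sY by (simp add: symm_def Q_def matrix_transpose_mul S't comm)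
    show "Q ** Q = Q"
    proof -
      have "Q ** Q = (S' ** Y) ** Q" by (simp add: Q_def comm)
      also have "\<dots> = S' ** (Y ** Q)" by (simp add: matrix_mul_assoc)
      also have "\<dots> = Q" unfolding YQ by (simp add: Q_def comm)
      finally show ?thesis .
    qed
    show "X ** Q = 0" by (simp add: Q_def mat_algebra z)
  qed (use sX sY c YQ in auto)
  then show ?thesis by blast
qed

context complementary_pair
begin

definition "R = mat 1 - Q"

lemma QX: "Q ** X = 0"
  using arg_cong[OF XQ, of transpose] symX symQ
  by (simp add: matrix_transpose_mul symm_def) (simp add: transpose_def vec_eq_iff)

lemma QY: "Q ** Y = Y"
  using arg_cong[OF YQ, of transpose] symY symQ by (simp add: matrix_transpose_mul symm_def)

lemma symR: "symm R" unfolding R_def using symQ by auto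

lemma proj_simps: "Q ** R = 0" "R ** Q = 0" "R ** R = R" "Y ** R = 0" "R ** Y = 0" "X ** R = X" "R ** X = X"
  "Q + R = mat 1"
  by (simp_all add: R_def mat_algebra QQ XQ YQ QX QY)

lemma proj_pythagoras: "A \<bullet> A = (Q ** A) \<bullet> (Q ** A) + (R ** A) \<bullet> (R ** A)"
proof -
  have A: "A = Q ** A + R ** A" by (simp add: proj_simps flip: matmul.add_left)
  have "(Q ** A) \<bullet> (R ** A) = 0"
    using symQ by (simp add: inner_matmul_left symm_def) (simp add: matrix_mul_assoc proj_simps)
  then show ?thesis by (subst A, subst (2) A) (simp add: inner_add_left inner_add_right inner_commute)
qed

lemma norm_Q_left: "norm (Q ** A) \<le> norm A" and norm_R_left: "norm (R ** A) \<le> norm A"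
  using proj_pythagoras[of A] inner_ge_zero[of "Q ** A"] inner_ge_zero[of "R ** A"]
  unfolding norm_le by linarith+

lemma norm_Q_right: "norm (A ** Q) \<le> norm A" and norm_R_right: "norm (A ** R) \<le> norm A"
proof -
  have "norm (A ** Q) = norm (Q ** transpose A)"
    by (subst norm_transpose[symmetric]) (simp only: matrix_transpose_mul symmD[OF symQ])
  also have "\<dots> \<le> norm (transpose A)" by (rule norm_Q_left)
  finally show "norm (A ** Q) \<le> norm A" by simp
  have "norm (A ** R) = norm (R ** transpose A)"
    by (subst norm_transpose[symmetric]) (simp only: matrix_transpose_mul symmD[OF symR])
  also have "\<dots> \<le> norm (transpose A)" by (rule norm_R_left)
  finally show "norm (A ** R) \<le> norm A" by simp
qed

lemma inner_Q_left: "(Q ** A) \<bullet> B = (Q ** A) \<bullet> (Q ** B)"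
  and inner_R_left: "(R ** A) \<bullet> B = (R ** A) \<bullet> (R ** B)"
  unfolding inner_matmul_left symmD[OF symQ] symmD[OF symR] by (simp_all add: QQ proj_simps matrix_mul_assoc)

lemma inner_Q_right: "(A ** Q) \<bullet> B = (A ** Q) \<bullet> (B ** Q)"
  and inner_R_right: "(A ** R) \<bullet> B = (A ** R) \<bullet> (B ** R)"
  unfolding inner_matmul_right symmD[OF symQ] symmD[OF symR]
  by (simp_all add: QQ proj_simps flip: matrix_mul_assoc)

lemma proj_assoc_simps:
  "A ** Q ** Y = A ** Y" "A ** Y ** Q = A ** Y" "A ** X ** Q = 0" "A ** Q ** X = 0" "A ** Q ** Q = A ** Q"
  "A ** R ** Y = 0" "A ** Y ** R = 0" "A ** R ** X = A ** X" "A ** X ** R = A ** X" "A ** R ** R = A ** R"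
  by (simp_all add: QY YQ XQ QX QQ proj_simps flip: matrix_mul_assoc)

text \<open>
  On the range of \<open>R\<close> the matrix \<open>X\<close> coincides with the coercive matrix \<open>X + Y\<close>.
\<close>

lemma norm_complement_le: "norm (R ** A) \<le> norm (X ** A) / c"
proof -
  let ?W = "R ** A"
  have "c * (?W \<bullet> ?W) \<le> ?W \<bullet> ((X + Y) ** ?W)" by (rule coercive_inner_left[OF coerc])
  also have "(X + Y) ** ?W = X ** A" by (simp add: mat_algebra proj_simps)
  also have "?W \<bullet> (X ** A) \<le> norm ?W * norm (X ** A)" by (rule norm_cauchy_schwarz)
  finally have "norm ?W * (c * norm ?W) \<le> norm ?W * norm (X ** A)"
    by (simp add: power2_norm_eq_inner[symmetric] power2_eq_square mult_ac)
  then have "c * norm ?W \<le> norm (X ** A)"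
    by (cases "norm ?W = 0") (simp_all add: mult_le_cancel_left)
  then show ?thesis using c by (simp add: field_simps)
qed

text \<open>
  Compressed to the kernel of \<open>X\<close>, the operator \<open>sprod Y\<close> acts like \<open>sprod (X + Y)\<close>.
\<close>

lemma norm_kernel_block_le:
  assumes D: "symm D"
  shows "norm (Q ** D ** Q) \<le> norm (Q ** sprod Y D ** Q) / c"
proof -
  let ?W = "Q ** D ** Q"
  have 1: "2 *\<^sub>R (Q ** sprod Y D ** Q) = (X + Y) ** ?W + ?W ** (X + Y)"
    by (simp add: sprod_def mat_algebra XQ QX YQ QY proj_assoc_simps)
  have sXY: "symm (X + Y)" using symX symY by auto
  have "2 * c * (?W \<bullet> ?W) \<le> ?W \<bullet> ((X + Y) ** ?W) + ?W \<bullet> (?W ** (X + Y))"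
    using coercive_inner_left[OF coerc, of ?W] coercive_inner_right[OF coerc sXY, of ?W] by simp
  also have "\<dots> = 2 * (?W \<bullet> (Q ** sprod Y D ** Q))"
    unfolding inner_add_right[symmetric] 1[symmetric] by simp
  also have "\<dots> \<le> 2 * (norm ?W * norm (Q ** sprod Y D ** Q))" using norm_cauchy_schwarz by simp
  finally have "norm ?W * (c * norm ?W) \<le> norm ?W * norm (Q ** sprod Y D ** Q)"
    by (simp add: power2_norm_eq_inner[symmetric] power2_eq_square mult_ac)
  then have "c * norm ?W \<le> norm (Q ** sprod Y D ** Q)"
    by (cases "norm ?W = 0") (simp_all add: mult_le_cancel_left)
  then show ?thesis using c by (simp add: field_simps)
qed

text \<open>
  Let \<open>F\<close> be at distance \<open>O(m)\<close> from \<open>X\<close> with smallest eigenvalue at least of order \<open>m\<close>, and let \<open>Z\<close> be symmetric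
  (\<open>s = 1\<close>) or skew (\<open>s = -1\<close>). The blocks of \<open>Z\<close> are estimated one after the other by those of
  \<open>sprod F Z\<close>. Only on the kernel block does \<open>F\<close> act with strength \<open>m\<close>; the other blocks see \<open>X\<close>.
\<close>

context
  fixes F Z :: "real^'m^'m" and b K m s :: real
  assumes m: "0 < m" and b: "0 < b" and K: "0 \<le> K"
    and symF: "symm F" and near: "norm (F - X) \<le> K * m" and coercF: "coercive (b * m) F"
    and sZ: "transpose Z = s *\<^sub>R Z" and s: "\<bar>s\<bar> = 1"
begin

lemma off_diagonal_block_le:
  "norm (R ** Z ** Q) \<le> (2 * norm (sprod F Z ** Q) + 2 * K * m * norm Z) / c"
proof -
  have 1: "X ** (Z ** Q) = 2 *\<^sub>R (sprod F Z ** Q) - (F - X) ** (Z ** Q) - Z ** ((F - X) ** Q)"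
    by (simp add: sprod_def mat_algebra proj_assoc_simps)
  have 2: "norm ((F - X) ** (Z ** Q)) \<le> K * m * norm Z"
    by (rule order_trans[OF norm_matrix_mult_le]) (use near K m norm_Q_right in \<open>auto intro!: mult_mono\<close>)
  have "norm (Z ** ((F - X) ** Q)) \<le> norm Z * (K * m)"
    by (rule order_trans[OF norm_matrix_mult_le])
      (use near order_trans[OF norm_Q_right] in \<open>auto intro!: mult_left_mono\<close>)
  then have "norm (X ** (Z ** Q)) \<le> 2 * norm (sprod F Z ** Q) + 2 * K * m * norm Z"
    unfolding 1 using 2
      norm_triangle_ineq4[of "2 *\<^sub>R (sprod F Z ** Q) - (F - X) ** (Z ** Q)" "Z ** ((F - X) ** Q)"]
      norm_triangle_ineq4[of "2 *\<^sub>R (sprod F Z ** Q)" "(F - X) ** (Z ** Q)"] by (simp add: mult_ac)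
  then show ?thesis
    using norm_complement_le[of "Z ** Q"] c by (simp add: matrix_mul_assoc field_simps)
qed

lemma norm_off_diagonal_blocks: "norm (Q ** Z ** R) = norm (R ** Z ** Q)"
proof -
  have "transpose (R ** Z ** Q) = s *\<^sub>R (Q ** Z ** R)"
    by (simp add: matrix_transpose_mul symmD[OF symQ] symmD[OF symR] sZ mat_algebra)
  then have "norm (transpose (R ** Z ** Q)) = norm (Q ** Z ** R)" by (simp add: s)
  then show ?thesis by simp
qed

lemma split_right: "A = A ** Q + A ** R" and split_left: "A = Q ** A + R ** A"
  by (simp_all add: R_def mat_algebra)

lemma kernel_block_le:
  "norm (Q ** Z ** Q) \<le> norm (Q ** sprod F Z ** Q) / (b * m) + K / b * norm (R ** Z ** Q)"
proof -
  let ?W = "Q ** Z ** Q" and ?U = "R ** Z ** Q" and ?U' = "Q ** Z ** R"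
  have WQ: "?W ** Q = ?W" "Q ** ?W = ?W" by (simp_all add: proj_assoc_simps) (simp add: matrix_mul_assoc QQ)
  have small: "norm (Q ** F ** A) \<le> K * m * norm A" for A
  proof -
    have "Q ** F ** A = Q ** ((F - X) ** A)" by (simp add: mat_algebra QX)
    then have "norm (Q ** F ** A) \<le> norm (F - X) * norm A"
      using norm_Q_left[of "(F - X) ** A"] norm_matrix_mult_le[of "F - X" A] by simp
    also have "\<dots> \<le> K * m * norm A" using near by (intro mult_right_mono) auto
    finally show ?thesis .
  qed
  have small': "norm (A ** F ** Q) \<le> K * m * norm A" for A
  proof -
    have "norm (A ** F ** Q) = norm (Q ** F ** transpose A)"
      by (subst norm_transpose[symmetric])
        (simp only: matrix_transpose_mul symmD[OF symQ] symmD[OF symF] matrix_mul_assoc)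
    then show ?thesis using small[of "transpose A"] by simp
  qed
  have left: "b * m * (?W \<bullet> ?W) - norm ?W * (K * m * norm ?U) \<le> ?W \<bullet> (F ** Z)"
  proof -
    have "?W \<bullet> (F ** Z) = ?W \<bullet> (F ** (Z ** Q))" by (subst inner_Q_right) (simp add: matrix_mul_assoc)
    also have "Z ** Q = ?W + ?U" using split_left[of "Z ** Q"] by (simp add: matrix_mul_assoc)
    also have "?W \<bullet> (F ** (?W + ?U)) = ?W \<bullet> (F ** ?W) + ?W \<bullet> (F ** ?U)"
      by (simp add: matmul.add_right inner_add_right)
    also have "?W \<bullet> (F ** ?U) = ?W \<bullet> (Q ** F ** ?U)"
      using inner_Q_left[of ?W "F ** ?U"] unfolding WQ by (simp add: matrix_mul_assoc)
    finally show ?thesis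
      using coercive_inner_left[OF coercF, of ?W] Cauchy_Schwarz_ineq2[of ?W "Q ** F ** ?U"]
        mult_left_mono[OF small[of ?U] norm_ge_zero[of ?W]] by linarith
  qed
  have right: "b * m * (?W \<bullet> ?W) - norm ?W * (K * m * norm ?U') \<le> ?W \<bullet> (Z ** F)"
  proof -
    have "?W \<bullet> (Z ** F) = ?W \<bullet> ((Q ** Z) ** F)"
      using inner_Q_left[of "Z ** Q" "Z ** F"] by (simp add: matrix_mul_assoc)
    also have "\<dots> = ?W \<bullet> ((?W + ?U') ** F)"
      using arg_cong[OF split_right[of "Q ** Z"], of "\<lambda>A. ?W \<bullet> (A ** F)"] .
    also have "\<dots> = ?W \<bullet> (?W ** F) + ?W \<bullet> (?U' ** F)"
      by (simp add: matmul.add_left inner_add_right)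
    also have "?W \<bullet> (?U' ** F) = ?W \<bullet> (?U' ** F ** Q)"
      using inner_Q_right[of ?W "?U' ** F"] unfolding WQ .
    finally show ?thesis
      using coercive_inner_right[OF coercF symF, of ?W] Cauchy_Schwarz_ineq2[of ?W "?U' ** F ** Q"]
        mult_left_mono[OF small'[of ?U'] norm_ge_zero[of ?W]] by linarith
  qed
  have "?W \<bullet> (F ** Z) + ?W \<bullet> (Z ** F) = 2 * (?W \<bullet> sprod F Z)"
    by (simp add: sprod_def inner_add_right)
  also have "?W \<bullet> sprod F Z = ?W \<bullet> (Q ** sprod F Z ** Q)"
    using inner_Q_left[of ?W "sprod F Z"] inner_Q_right[of ?W "Q ** sprod F Z"] unfolding WQ by simp
  also have "2 * (?W \<bullet> (Q ** sprod F Z ** Q)) \<le> 2 * (norm ?W * norm (Q ** sprod F Z ** Q))"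
    using norm_cauchy_schwarz by simp
  finally have "b * m * (?W \<bullet> ?W) \<le> norm ?W * norm (Q ** sprod F Z ** Q) + norm ?W * (K * m * norm ?U)"
    using left right unfolding norm_off_diagonal_blocks by linarith
  then have "norm ?W * (b * m * norm ?W) \<le> norm ?W * (norm (Q ** sprod F Z ** Q) + K * m * norm ?U)"
    by (simp add: power2_norm_eq_inner[symmetric] power2_eq_square algebra_simps)
  then have "b * m * norm ?W \<le> norm (Q ** sprod F Z ** Q) + K * m * norm ?U"
    using K m by (cases "norm ?W = 0") (simp_all add: mult_le_cancel_left)
  then have "norm ?W \<le> (norm (Q ** sprod F Z ** Q) + K * m * norm ?U) / (b * m)"
    using b m by (simp add: pos_le_divide_eq mult_ac)
  also have "\<dots> = norm (Q ** sprod F Z ** Q) / (b * m) + K / b * norm ?U"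
    using b m by (simp add: add_divide_distrib)
  finally show ?thesis .
qed

lemma range_block_le: "norm (R ** Z ** R) \<le> (norm (sprod F Z) + K * m * norm Z) / c"
proof -
  let ?W = "R ** Z ** R"
  have WR: "?W ** R = ?W" "R ** ?W = ?W" by (simp_all add: proj_assoc_simps) (simp add: matrix_mul_assoc proj_simps)
  have left: "c * (?W \<bullet> ?W) \<le> ?W \<bullet> (X ** Z)"
  proof -
    have "?W \<bullet> (X ** Z) = ?W \<bullet> (X ** Z ** R)" by (subst inner_R_right) simp
    also have "X ** Z ** R = (X + Y) ** ?W" by (simp add: mat_algebra proj_simps proj_assoc_simps)
    finally show ?thesis using coercive_inner_left[OF coerc, of ?W] by simp
  qed
  have right: "c * (?W \<bullet> ?W) \<le> ?W \<bullet> (Z ** X)"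
  proof -
    have "?W \<bullet> (Z ** X) = ?W \<bullet> (R ** Z ** X)"
      using inner_R_left[of "Z ** R" "Z ** X"] by (simp add: matrix_mul_assoc)
    also have "R ** Z ** X = ?W ** (X + Y)" by (simp add: mat_algebra proj_simps proj_assoc_simps)
    finally show ?thesis using coercive_inner_right[OF coerc, of ?W] symX symY by auto
  qed
  have "X ** Z + Z ** X = 2 *\<^sub>R sprod F Z - 2 *\<^sub>R sprod (F - X) Z"
    by (simp add: sprod_def mat_algebra algebra_simps)
  also have "\<dots> = 2 *\<^sub>R (sprod F Z - sprod (F - X) Z)" by (simp only: scaleR_diff_right)
  finally have XZ: "X ** Z + Z ** X = 2 *\<^sub>R (sprod F Z - sprod (F - X) Z)" .
  have "2 * c * (?W \<bullet> ?W) \<le> ?W \<bullet> (X ** Z + Z ** X)"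
    using left right by (simp add: inner_add_right)
  also have "\<dots> \<le> 2 * (norm ?W * norm (sprod F Z - sprod (F - X) Z))"
    unfolding XZ using norm_cauchy_schwarz[of ?W "sprod F Z - sprod (F - X) Z"] by simp
  also have "norm (sprod F Z - sprod (F - X) Z) \<le> norm (sprod F Z) + K * m * norm Z"
    using norm_triangle_ineq4[of "sprod F Z" "sprod (F - X) Z"] norm_sprod_le[of "F - X" Z]
      mult_right_mono[OF near, of "norm Z"] by simp
  finally have "norm ?W * (c * norm ?W) \<le> norm ?W * (norm (sprod F Z) + K * m * norm Z)"
    by (simp add: power2_norm_eq_inner[symmetric] power2_eq_square mult_ac mult_right_mono)
  then have "c * norm ?W \<le> norm (sprod F Z) + K * m * norm Z"
    using K m by (cases "norm ?W = 0") (simp_all add: mult_le_cancel_left)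
  then show ?thesis using c by (simp add: field_simps)
qed

end

text \<open>
  The terms with \<open>m * norm Z\<close> come from replacing \<open>F\<close> by \<open>X\<close>. For small \<open>m\<close> they are absorbed on the left
  in the second estimate.
\<close>

lemma lyapunov_block_estimates:
  assumes b: "0 < b" and K: "0 \<le> K"
  obtains L where "0 < L"
    "\<And>F Z m s. \<lbrakk>0 < m; symm F; norm (F - X) \<le> K * m; coercive (b * m) F; transpose Z = s *\<^sub>R Z; \<bar>s\<bar> = 1\<rbrakk>
       \<Longrightarrow> norm (Z ** Q) \<le> L * (norm (sprod F Z ** Q) + norm (Q ** sprod F Z ** Q) / m + m * norm Z)"
    "\<And>F Z m s. \<lbrakk>0 < m; m \<le> 1 / L; symm F; norm (F - X) \<le> K * m; coercive (b * m) F; transpose Z = s *\<^sub>R Z; \<bar>s\<bar> = 1\<rbrakk>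
       \<Longrightarrow> norm Z \<le> L * (norm (sprod F Z) + norm (Q ** sprod F Z ** Q) / m)"
proof -
  define L1 where "L1 = 1 / b + (1 + K / b) * ((2 + 2 * K) / c)"
  define M where "M = 2 * L1 + (1 + K) / c"
  have L1: "0 < L1" using b K c by (auto simp: L1_def intro!: add_pos_nonneg)
  then have M: "0 < M" "L1 \<le> M" using K c by (auto simp: M_def intro!: add_pos_nonneg)
  have one: "norm (Z ** Q) \<le> L1 * (norm (sprod F Z ** Q) + norm (Q ** sprod F Z ** Q) / m + m * norm Z)"
    and two: "norm Z \<le> M * (norm (sprod F Z) + norm (Q ** sprod F Z ** Q) / m + m * norm Z)"
    if A: "0 < m" "symm F" "norm (F - X) \<le> K * m" "coercive (b * m) F" "transpose Z = s *\<^sub>R Z" "\<bar>s\<bar> = 1"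
    for F Z m s
  proof -
    note hyps = A(1) b K A(2-6)
    let ?d = "norm (sprod F Z ** Q)" and ?q = "norm (Q ** sprod F Z ** Q)" and ?r = "norm (R ** Z ** Q)"
    have mz: "0 \<le> m * norm Z" using A(1) by simp
    have r: "?r \<le> (2 + 2 * K) / c * (?d + m * norm Z)"
    proof -
      have "2 * ?d + 2 * K * m * norm Z \<le> (2 + 2 * K) * (?d + m * norm Z)"
        using K mz by (simp add: algebra_simps)
      then show ?thesis using off_diagonal_block_le[OF hyps] c
        by (simp add: divide_right_mono order_trans)
    qed
    have "norm (Z ** Q) \<le> norm (Q ** Z ** Q) + ?r"
      using split_left[OF hyps, of "Z ** Q"] norm_triangle_ineq[of "Q ** Z ** Q" "R ** Z ** Q"]
      by (simp add: matrix_mul_assoc)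
    also have "\<dots> \<le> 1 / b * (?q / m) + (1 + K / b) * ?r"
      using kernel_block_le[OF hyps] by (simp add: algebra_simps)
    also have "\<dots> \<le> 1 / b * (?q / m) + (1 + K / b) * ((2 + 2 * K) / c * (?d + m * norm Z))"
      using r b K by (intro add_left_mono mult_left_mono) auto
    also have "\<dots> \<le> L1 * (?q / m) + L1 * (?d + m * norm Z)"
      unfolding mult.assoc[symmetric] using b K c mz A(1)
      by (intro add_mono mult_right_mono) (auto simp: L1_def)
    finally show one: "norm (Z ** Q) \<le> L1 * (?d + ?q / m + m * norm Z)" by (simp add: algebra_simps)
    have "norm Z \<le> norm (Z ** Q) + norm (Z ** R)"
      using split_right[OF hyps, of Z] norm_triangle_ineq[of "Z ** Q" "Z ** R"] by simp
    also have "norm (Z ** R) \<le> norm (Q ** Z ** R) + norm (R ** Z ** R)"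
      using split_left[OF hyps, of "Z ** R"] norm_triangle_ineq[of "Q ** Z ** R" "R ** Z ** R"]
      by (simp add: matrix_mul_assoc)
    also have "norm (Q ** Z ** R) \<le> norm (Z ** Q)"
      using norm_off_diagonal_blocks[OF hyps] norm_R_left[of "Z ** Q"] by (simp add: matrix_mul_assoc)
    also have "norm (R ** Z ** R) \<le> (1 + K) / c * (norm (sprod F Z) + m * norm Z)"
    proof -
      have "norm (sprod F Z) + K * m * norm Z \<le> (1 + K) * (norm (sprod F Z) + m * norm Z)"
        using K mz by (simp add: algebra_simps)
      then show ?thesis using range_block_le[OF hyps] c
        by (simp add: divide_right_mono order_trans)
    qed
    also have "\<dots> \<le> (1 + K) / c * (norm (sprod F Z) + ?q / m + m * norm Z)"
      using K c A(1) by (intro mult_left_mono) auto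
    finally have Z: "norm Z \<le> 2 * norm (Z ** Q) + (1 + K) / c * (norm (sprod F Z) + ?q / m + m * norm Z)"
      by simp
    define T where "T = norm (sprod F Z) + ?q / m + m * norm Z"
    have "norm (Z ** Q) \<le> L1 * T"
      unfolding T_def
      using L1 norm_Q_right[of "sprod F Z"] by (intro order_trans[OF one] mult_left_mono) auto
    then have "norm Z \<le> M * T"
      using Z unfolding T_def[symmetric] M_def by (simp add: distrib_right)
    then show "norm Z \<le> M * (norm (sprod F Z) + ?q / m + m * norm Z)" unfolding T_def .
  qed
  show ?thesis
  proof (rule that[of "2 * M"])
    show "0 < 2 * M" using M by simp
    fix F Z :: "real^'m^'m" and m s :: real
    assume A: "0 < m" "symm F" "norm (F - X) \<le> K * m" "coercive (b * m) F" "transpose Z = s *\<^sub>R Z" "\<bar>s\<bar> = 1"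
    have "0 \<le> norm (sprod F Z ** Q) + norm (Q ** sprod F Z ** Q) / m + m * norm Z" using A(1) by simp
    then show "norm (Z ** Q) \<le> 2 * M * (norm (sprod F Z ** Q) + norm (Q ** sprod F Z ** Q) / m + m * norm Z)"
      by (rule order_trans[OF one[OF A] mult_right_mono[rotated]]) (use M in simp)
    assume "m \<le> 1 / (2 * M)"
    then have "M * m \<le> 1 / 2" using M(1) by (simp add: field_simps)
    then have "M * m * norm Z \<le> 1 / 2 * norm Z" by (rule mult_right_mono) simp
    then show "norm Z \<le> 2 * M * (norm (sprod F Z) + norm (Q ** sprod F Z ** Q) / m)"
      using two[OF A] distrib_left[of M "norm (sprod F Z) + norm (Q ** sprod F Z ** Q) / m" "m * norm Z"]
      by (simp add: mult.assoc)
  qed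
qed

end

section \<open>Calculus of k times continuously differentiable maps\<close>

lemma Ck_on_Suc_imp: "Ck_on (Suc k) S f \<Longrightarrow> Ck_on k S f"
proof (induction k arbitrary: f)
  case 0
  then obtain f' where "\<And>x. x \<in> S \<Longrightarrow> (f has_derivative f' x) (at x)" unfolding Ck_on.simps by blast
  then have "\<And>x. x \<in> S \<Longrightarrow> isCont f x" by (rule has_derivative_continuous)
  then show ?case by (simp add: continuous_at_imp_continuous_on)
next
  case (Suc k)
  then obtain f' where f': "\<forall>x\<in>S. (f has_derivative f' x) (at x)" "\<And>v. Ck_on (Suc k) S (\<lambda>x. f' x v)"
    unfolding Ck_on.simps(2)[of "Suc k"] by blast
  have "\<forall>v. Ck_on k S (\<lambda>x. f' x v)" using Suc.IH[OF f'(2)] by blast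
  with f'(1) show ?case unfolding Ck_on.simps(2)[of k] by blast
qed

lemma Ck_on_le: "Ck_on k S f \<Longrightarrow> j \<le> k \<Longrightarrow> Ck_on j S f"
proof (induction k)
  case (Suc k)
  then show ?case by (cases "j = Suc k") (auto simp del: Ck_on.simps intro: Ck_on_Suc_imp)
qed (simp add: le_zero_eq)

lemma Ck_on_subset: "Ck_on k T f \<Longrightarrow> S \<subseteq> T \<Longrightarrow> Ck_on k S f"
proof (induction k arbitrary: f)
  case 0 then show ?case by (auto intro: continuous_on_subset)
next
  case (Suc k) then show ?case by (simp, blast)
qed

lemma Ck_on_cong:
  assumes "open S" "\<And>x. x \<in> S \<Longrightarrow> f x = g x" "Ck_on k S f"
  shows "Ck_on k S g"
proof (cases k)
  case 0 then show ?thesis using assms by (auto cong: continuous_on_cong)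
next
  case (Suc j)
  then obtain f' where f': "\<forall>x\<in>S. (f has_derivative f' x) (at x)" "\<forall>v. Ck_on j S (\<lambda>x. f' x v)"
    using assms(3) by auto
  have "(g has_derivative f' x) (at x)" if "x \<in> S" for x
    by (rule has_derivative_transform_within_open[OF f'(1)[rule_format, OF that] assms(1) that]) (rule assms(2))
  with f'(2) Suc show ?thesis by auto
qed

lemma Ck_on_const: "Ck_on k S (\<lambda>x. a)"
proof (induction k arbitrary: a)
  case (Suc k)
  have "\<forall>x\<in>S. ((\<lambda>x. a) has_derivative (\<lambda>_. 0)) (at x)" by simp
  with Suc[of 0] show ?case by (auto intro!: exI[of _ "\<lambda>x v. 0"])
qed simp

lemma Ck_on_bounded_linear:
  assumes "bounded_linear h" shows "Ck_on k S h"
proof (cases k)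
  case 0 then show ?thesis using assms by (simp add: linear_continuous_on)
next
  case (Suc j)
  have "\<forall>x\<in>S. (h has_derivative h) (at x)" using bounded_linear_imp_has_derivative[OF assms] by blast
  then show ?thesis using Suc Ck_on_const by (auto intro!: exI[of _ "\<lambda>x. h"])
qed

lemma Ck_on_add: "Ck_on k S f \<Longrightarrow> Ck_on k S g \<Longrightarrow> Ck_on k S (\<lambda>x. f x + g x)"
proof (induction k arbitrary: f g)
  case 0 then show ?case by (auto intro: continuous_intros)
next
  case (Suc k)
  from Suc.prems(1) obtain f' where f': "\<forall>x\<in>S. (f has_derivative f' x) (at x)" "\<forall>v. Ck_on k S (\<lambda>x. f' x v)" by auto
  from Suc.prems(2) obtain g' where g': "\<forall>x\<in>S. (g has_derivative g' x) (at x)" "\<forall>v. Ck_on k S (\<lambda>x. g' x v)" by auto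
  have "\<forall>x\<in>S. ((\<lambda>x. f x + g x) has_derivative (\<lambda>v. f' x v + g' x v)) (at x)"
    using f'(1) g'(1) by (auto intro: has_derivative_add)
  with Suc.IH f'(2) g'(2) show ?case by (auto intro!: exI[of _ "\<lambda>x v. f' x v + g' x v"])
qed

lemma Ck_on_sum: "(\<And>i. i \<in> I \<Longrightarrow> Ck_on k S (f i)) \<Longrightarrow> Ck_on k S (\<lambda>x. \<Sum>i\<in>I. f i x)"
  by (induction I rule: infinite_finite_induct) (auto intro: Ck_on_const Ck_on_add)

lemma Ck_on_linear_comp:
  assumes h: "bounded_linear h" shows "Ck_on k S f \<Longrightarrow> Ck_on k S (\<lambda>x. h (f x))"
proof (induction k arbitrary: f)
  case 0 then show ?case by (simp add: bounded_linear.continuous_on[OF h])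
next
  case (Suc k)
  from Suc.prems(1) obtain f' where f': "\<forall>x\<in>S. (f has_derivative f' x) (at x)" "\<forall>v. Ck_on k S (\<lambda>x. f' x v)" by auto
  have "\<forall>x\<in>S. ((\<lambda>x. h (f x)) has_derivative (\<lambda>v. h (f' x v))) (at x)"
    using f'(1) by (auto intro: bounded_linear.has_derivative[OF h])
  with Suc.IH f'(2) show ?case by (auto intro!: exI[of _ "\<lambda>x v. h (f' x v)"])
qed

lemma Ck_on_bilinear:
  assumes b: "bounded_bilinear b"
  shows "Ck_on k S f \<Longrightarrow> Ck_on k S g \<Longrightarrow> Ck_on k S (\<lambda>x. b (f x) (g x))"
proof (induction k arbitrary: f g)
  case 0 then show ?case by (auto intro: bounded_bilinear.continuous_on[OF b])
next
  case (Suc k)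
  from Suc.prems(1) obtain f' where f': "\<forall>x\<in>S. (f has_derivative f' x) (at x)" "\<forall>v. Ck_on k S (\<lambda>x. f' x v)" by auto
  from Suc.prems(2) obtain g' where g': "\<forall>x\<in>S. (g has_derivative g' x) (at x)" "\<forall>v. Ck_on k S (\<lambda>x. g' x v)" by auto
  have "\<forall>x\<in>S. ((\<lambda>x. b (f x) (g x)) has_derivative (\<lambda>v. b (f x) (g' x v) + b (f' x v) (g x))) (at x)"
    using f'(1) g'(1) by (auto intro: bounded_bilinear.FDERIV[OF b])
  moreover have "Ck_on k S (\<lambda>x. b (f x) (g' x v) + b (f' x v) (g x))" for v
    using Suc.IH Ck_on_Suc_imp[OF Suc.prems(1)] Ck_on_Suc_imp[OF Suc.prems(2)] f'(2) g'(2)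
    by (intro Ck_on_add) auto
  ultimately show ?case by (auto intro!: exI[of _ "\<lambda>x v. b (f x) (g' x v) + b (f' x v) (g x)"])
qed

text \<open>
  As \<open>Ck_on\<close> speaks about derivatives in fixed directions, a derivative in a variable direction is expanded over the basis.
\<close>

lemma linear_Basis_expansion:
  assumes "linear f" shows "f w = (\<Sum>b\<in>Basis. (w \<bullet> b) *\<^sub>R f b)"
proof -
  have "f w = f (\<Sum>b\<in>Basis. (w \<bullet> b) *\<^sub>R b)" by (simp only: euclidean_representation)
  also have "\<dots> = (\<Sum>b\<in>Basis. (w \<bullet> b) *\<^sub>R f b)"
    by (simp only: linear_sum[OF assms] linear_cmul[OF assms])
  finally show ?thesis .
qed

lemma Ck_on_compose:
  fixes f :: "'b::euclidean_space \<Rightarrow> 'c::real_normed_vector" and g :: "'a::euclidean_space \<Rightarrow> 'b"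
  shows "Ck_on k T f \<Longrightarrow> Ck_on k S g \<Longrightarrow> g ` S \<subseteq> T \<Longrightarrow> Ck_on k S (\<lambda>x. f (g x))"
proof (induction k arbitrary: f)
  case 0 then show ?case unfolding Ck_on.simps by (rule continuous_on_compose2)
next
  case (Suc k)
  obtain f' where f': "\<And>x. x \<in> T \<Longrightarrow> (f has_derivative f' x) (at x)" "\<And>v. Ck_on k T (\<lambda>x. f' x v)"
    using Suc.prems(1) unfolding Ck_on.simps by blast
  obtain g' where g': "\<And>x. x \<in> S \<Longrightarrow> (g has_derivative g' x) (at x)" "\<And>v. Ck_on k S (\<lambda>x. g' x v)"
    using Suc.prems(2) unfolding Ck_on.simps by blast
  define h where "h x v = (\<Sum>b\<in>Basis. (g' x v \<bullet> b) *\<^sub>R f' (g x) b)" for x v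
  have 1: "((\<lambda>x. f (g x)) has_derivative h x) (at x)" if "x \<in> S" for x
  proof -
    have "g x \<in> T" using Suc.prems(3) that by blast
    note d = f'(1)[OF this]
    have "((\<lambda>x. f (g x)) has_derivative (\<lambda>v. f' (g x) (g' x v))) (at x)"
      by (rule has_derivative_compose[OF g'(1)[OF that] d])
    moreover have "(\<lambda>v. f' (g x) (g' x v)) = h x"
      unfolding h_def by (rule ext) (rule linear_Basis_expansion[OF has_derivative_linear[OF d]])
    ultimately show ?thesis by (simp only:)
  qed
  have 2: "Ck_on k S (\<lambda>x. h x v)" for v
    unfolding h_def
    by (rule Ck_on_sum, rule Ck_on_bilinear[OF bounded_bilinear_scaleR],
        rule Ck_on_linear_comp[OF bounded_linear_inner_left], rule g'(2),
        rule Suc.IH[OF f'(2) Ck_on_Suc_imp[OF Suc.prems(2)] Suc.prems(3)])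
  show ?case unfolding Ck_on.simps using 1 2 by blast
qed

lemma Ck_on_Pair: "Ck_on k S f \<Longrightarrow> Ck_on k S g \<Longrightarrow> Ck_on k S (\<lambda>x. (f x, g x))"
  using Ck_on_add[OF Ck_on_linear_comp[of "\<lambda>a. (a, 0)" k S f] Ck_on_linear_comp[of "\<lambda>b. (0, b)" k S g]]
  by (simp add: bounded_linear_Pair bounded_linear_ident bounded_linear_zero)

lemma vec_lambda_sum_axis: "(\<chi> i. a i) = (\<Sum>i\<in>UNIV. a i *\<^sub>R axis i (1::real))"
  by (simp add: vec_eq_iff axis_def if_distrib cong: if_cong)

lemma Ck_on_vec_lambda:
  fixes f :: "'i::finite \<Rightarrow> 'a::euclidean_space \<Rightarrow> real"
  assumes "\<And>i. Ck_on k S (f i)" shows "Ck_on k S (\<lambda>x. \<chi> i. f i x)"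
  unfolding vec_lambda_sum_axis
  by (intro Ck_on_sum Ck_on_linear_comp[OF bounded_linear_scaleR_left] assms)

lemma Ck_on_grad:
  assumes "open S" "Ck_on (Suc k) S f" shows "Ck_on k S (grad f)"
proof -
  from assms(2) obtain f' where f': "\<forall>x\<in>S. (f has_derivative f' x) (at x)" "\<forall>v. Ck_on k S (\<lambda>x. f' x v)" by auto
  have "f' x = frechet_derivative f (at x)" if "x \<in> S" for x
    using f'(1) that frechet_derivative_at by blast
  then show ?thesis
    using f'(2) by (intro Ck_on_cong[OF assms(1) _ Ck_on_vec_lambda[of k S "\<lambda>i x. f' x (axis i 1)"]])
      (auto simp: grad_def)
qed

lemma Ck_on_has_derivative:
  assumes "Ck_on (Suc k) S f" "x \<in> S"
  shows "(f has_derivative frechet_derivative f (at x)) (at x)"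
  using assms unfolding Ck_on.simps by (metis differentiable_def frechet_derivative_works)

lemma grad_eq:
  assumes "(f has_derivative f') (at x)"
  shows "f' v = grad f x \<bullet> v"
proof -
  have f': "f' = frechet_derivative f (at x)" using frechet_derivative_at[OF assms] .
  have l: "linear f'" using has_derivative_linear[OF assms] .
  have "f' v = f' (\<Sum>i\<in>UNIV. v $ i *\<^sub>R axis i 1)" by (simp flip: vec_lambda_sum_axis)
  also have "\<dots> = (\<Sum>i\<in>UNIV. v $ i * f' (axis i 1))" by (simp add: linear_sum[OF l] linear_cmul[OF l])
  also have "\<dots> = grad f x \<bullet> v" by (simp add: grad_def inner_vec_def mult.commute flip: f')
  finally show ?thesis .
qed

lemma hess_eq:
  assumes "(grad f has_derivative G) (at x)" shows "hess f x *v v = G v"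
  using assms frechet_derivative_at[OF assms] has_derivative_linear[OF assms]
  by (simp add: hess_def matrix_works)

text \<open>
  The second derivatives are bounded on a compact ball, so the first derivative is Lipschitz there and the
  Taylor remainder is quadratic.
\<close>

lemma Ck_on_2_quadratic:
  fixes f :: "'a::euclidean_space \<Rightarrow> 'b::real_normed_vector"
  assumes f: "Ck_on 2 S f" and S: "open S" "x0 \<in> S"
  obtains \<rho> K where "0 < \<rho>" "0 \<le> K" "cball x0 \<rho> \<subseteq> S"
    "\<And>x y h. x \<in> cball x0 \<rho> \<Longrightarrow> y \<in> cball x0 \<rho> \<Longrightarrow>
       norm (frechet_derivative f (at x) h - frechet_derivative f (at y) h) \<le> K * norm (x - y) * norm h"
    "\<And>x y. x \<in> cball x0 \<rho> \<Longrightarrow> y \<in> cball x0 \<rho> \<Longrightarrow>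
       norm (f y - f x - frechet_derivative f (at x) (y - x)) \<le> K * (norm (y - x))\<^sup>2"
proof -
  define f' where "f' x = frechet_derivative f (at x)" for x
  obtain \<rho> where \<rho>: "0 < \<rho>" "cball x0 \<rho> \<subseteq> S" using open_contains_cball S by blast
  have f2: "Ck_on (Suc (Suc 0)) S f" using f by (simp add: numeral_2_eq_2)
  then obtain g where g: "\<forall>x\<in>S. (f has_derivative g x) (at x)" "\<forall>v. Ck_on (Suc 0) S (\<lambda>x. g x v)"
    unfolding Ck_on.simps(2)[of "Suc 0"] by blast
  have gf: "g x = f' x" if "x \<in> S" for x
    using g(1) that frechet_derivative_at unfolding f'_def by blast
  have d: "(f has_derivative f' x) (at x)" if "x \<in> S" for x using g(1) gf[OF that] that by auto
  have "\<exists>B\<ge>0. \<forall>x\<in>cball x0 \<rho>. \<forall>y\<in>cball x0 \<rho>. norm (f' x b - f' y b) \<le> B * norm (x - y)" for b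
  proof -
    obtain h where h: "\<forall>x\<in>S. ((\<lambda>x. g x b) has_derivative h x) (at x)" "\<forall>v. continuous_on S (\<lambda>x. h x v)"
      using g(2)[rule_format, of b] unfolding Ck_on.simps by blast
    have "\<exists>B. \<forall>x\<in>cball x0 \<rho>. norm (h x c) \<le> B" for c
    proof -
      have "compact ((\<lambda>x. h x c) ` cball x0 \<rho>)"
        using h(2) \<rho>(2) by (intro compact_continuous_image compact_cball) (blast intro: continuous_on_subset)
      then show ?thesis by (auto dest!: compact_imp_bounded simp: bounded_iff)
    qed
    then obtain C where C: "\<And>c x. x \<in> cball x0 \<rho> \<Longrightarrow> norm (h x c) \<le> C c" by metis
    have C0: "0 \<le> C c" for c using C[of x0 c] \<rho>(1) norm_ge_zero[of "h x0 c"] by (simp del: norm_ge_zero)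
    define B where "B = (\<Sum>c\<in>Basis. C c)"
    have B: "norm (h x v) \<le> B * norm v" if "x \<in> cball x0 \<rho>" for x v
    proof -
      have l: "linear (h x)" using h(1) that \<rho>(2) has_derivative_linear by blast
      have "h x v = h x (\<Sum>c\<in>Basis. (v \<bullet> c) *\<^sub>R c)" by (simp add: euclidean_representation)
      also have "\<dots> = (\<Sum>c\<in>Basis. (v \<bullet> c) *\<^sub>R h x c)" by (simp only: linear_sum[OF l] linear_cmul[OF l])
      also have "norm \<dots> \<le> (\<Sum>c\<in>Basis. norm v * C c)"
        using C[OF that] Basis_le_norm[of _ v]
        by (intro order_trans[OF norm_sum] sum_mono) (simp add: mult_mono)
      finally show ?thesis by (simp add: B_def sum_distrib_left mult.commute)
    qed
    have "norm (f' x b - f' y b) \<le> B * norm (x - y)" if "x \<in> cball x0 \<rho>" "y \<in> cball x0 \<rho>" for x y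
    proof -
      have "norm (g x b - g y b) \<le> B * norm (x - y)"
      proof (rule differentiable_bound[OF convex_cball _ _ that])
        show "((\<lambda>x. g x b) has_derivative h x) (at x within cball x0 \<rho>)" if "x \<in> cball x0 \<rho>" for x
          using h(1) that \<rho>(2) by (blast intro: has_derivative_at_withinI)
        show "onorm (h x) \<le> B" if "x \<in> cball x0 \<rho>" for x
          by (rule onorm_le) (rule B[OF that])
      qed
      then show ?thesis using gf[of x] gf[of y] that \<rho>(2) by (auto simp: subset_eq)
    qed
    moreover have "0 \<le> B" unfolding B_def by (intro sum_nonneg C0)
    ultimately show ?thesis by blast
  qed
  then obtain B where B: "\<And>b. 0 \<le> B b"
    "\<And>b x y. x \<in> cball x0 \<rho> \<Longrightarrow> y \<in> cball x0 \<rho> \<Longrightarrow> norm (f' x b - f' y b) \<le> B b * norm (x - y)" by metis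
  define K where "K = (\<Sum>b\<in>Basis. B b)"
  have K: "0 \<le> K" unfolding K_def by (intro sum_nonneg B(1))
  have Lip: "norm (f' x h - f' y h) \<le> K * norm (x - y) * norm h" if "x \<in> cball x0 \<rho>" "y \<in> cball x0 \<rho>" for x y h
  proof -
    have l: "linear (\<lambda>h. f' x h - f' y h)"
      using d that \<rho>(2) by (intro linear_compose_sub has_derivative_linear) blast+
    have "f' x h - f' y h = (\<lambda>h. f' x h - f' y h) (\<Sum>c\<in>Basis. (h \<bullet> c) *\<^sub>R c)" by (simp add: euclidean_representation)
    also have "\<dots> = (\<Sum>c\<in>Basis. (h \<bullet> c) *\<^sub>R (f' x c - f' y c))" by (simp only: linear_sum[OF l] linear_cmul[OF l])
    also have "norm \<dots> \<le> (\<Sum>c\<in>Basis. norm h * (B c * norm (x - y)))"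
      using B(2)[OF that] Basis_le_norm[of _ h]
      by (intro order_trans[OF norm_sum] sum_mono) (simp add: mult_mono)
    also have "\<dots> = norm h * (K * norm (x - y))"
      unfolding K_def sum_distrib_left sum_distrib_right ..
    finally show ?thesis by (simp add: mult.commute)
  qed
  have Tay: "norm (f y - f x - f' x (y - x)) \<le> K * (norm (y - x))\<^sup>2" if "x \<in> cball x0 \<rho>" "y \<in> cball x0 \<rho>" for x y
  proof -
    have seg: "closed_segment x y \<subseteq> cball x0 \<rho>" using that by (simp add: closed_segment_subset)
    have "norm (f y - f x - f' x (y - x)) \<le> norm (y - x) * (K * norm (y - x))"
    proof (rule differentiable_bound_linearization[where S = "closed_segment x y"])
      show "x + t *\<^sub>R (y - x) \<in> closed_segment x y" if "t \<in> {0..1}" for t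
        using that by (auto simp: closed_segment_def algebra_simps intro!: exI[of _ t])
      show "(f has_derivative f' z) (at z within closed_segment x y)" if "z \<in> closed_segment x y" for z
        using d that seg \<rho>(2) by (blast intro: has_derivative_at_withinI)
      show "onorm (f' z - f' x) \<le> K * norm (y - x)" if "z \<in> closed_segment x y" for z
      proof (rule onorm_le)
        fix h
        have "norm (f' z h - f' x h) \<le> K * norm (z - x) * norm h" using Lip seg that \<open>x \<in> cball x0 \<rho>\<close> by blast
        also have "\<dots> \<le> K * norm (y - x) * norm h"
          using K segment_bound1[OF that] by (intro mult_right_mono mult_left_mono) (auto simp: norm_minus_commute)
        finally show "norm ((f' z - f' x) h) \<le> K * norm (y - x) * norm h" by simp
      qed
    qed simp
    then show ?thesis by (simp add: power2_eq_square mult_ac)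
  qed
  show ?thesis using that[OF \<rho>(1) K \<rho>(2)] Lip Tay unfolding f'_def by blast
qed

section \<open>The reduced constraint functions\<close>

lemma frechet_derivative_cong_open:
  assumes "open S" "x \<in> S" "\<And>z. z \<in> S \<Longrightarrow> f z = g z"
  shows "frechet_derivative f (at x) = frechet_derivative g (at x)"
proof -
  have "(f has_derivative D) (at x) \<longleftrightarrow> (g has_derivative D) (at x)" for D
    using has_derivative_transform_within_open[OF _ assms(1,2), of f D UNIV g]
      has_derivative_transform_within_open[OF _ assms(1,2), of g D UNIV f] assms(3) by auto
  then show ?thesis unfolding frechet_derivative_def by simp
qed

lemma grad_cong_open:
  assumes "open S" "x \<in> S" "\<And>z. z \<in> S \<Longrightarrow> f z = g z" shows "grad f x = grad g x"
proof -
  have "frechet_derivative f (at x) = frechet_derivative g (at x)"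
    by (rule frechet_derivative_cong_open[OF assms(1,2)]) (rule assms(3))
  then show ?thesis by (simp add: grad_def)
qed

lemma hess_cong_open:
  assumes "open S" "x \<in> S" "\<And>z. z \<in> S \<Longrightarrow> f z = g z" shows "hess f x = hess g x"
proof -
  have "grad f z = grad g z" if "z \<in> S" for z by (rule grad_cong_open[OF assms(1) that assms(3)])
  then show ?thesis unfolding hess_def using frechet_derivative_cong_open[OF assms(1,2), of "grad f" "grad g"] by simp
qed

lemma grad_unique: assumes "(f has_derivative (\<lambda>h. a \<bullet> h)) (at x)" shows "grad f x = a"
proof -
  have "grad f x \<bullet> v = a \<bullet> v" for v using grad_eq[OF assms] by simp
  then show ?thesis by (metis vector_eq_rdot)
qed

locale reduced_sisdp =
  fixes P :: "('n::finite, 'm::{finite,linorder}, 'q::finite) sisdp"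
    and \<sigma> :: real and r :: "('n, 'q, 'p::finite) reduction" and xs :: "real^'n"
  assumes wf: "wf_sisdp P" and \<sigma>: "0 < \<sigma>" and red: "reduction_at P \<sigma> r xs"
    and objC: "Ck_on 3 UNIV (obj P)"
    and conC: "\<exists>W. open W \<and> Tset P \<subseteq> W \<and> Ck_on 3 (UNIV \<times> W) (\<lambda>(x, \<tau>). con P x \<tau>)"
begin

abbreviation "U \<equiv> nbhd r xs"
abbreviation "J \<equiv> idx r xs"
abbreviation "gh \<equiv> ghat P r xs"
abbreviation "tt \<equiv> tau r xs"
abbreviation "T \<equiv> Tset P"

lemma openU: "open U" and xsU: "xs \<in> U" using red by (auto simp: reduction_at_def)

lemma tau_C2: "i \<in> J \<Longrightarrow> Ck_on 2 U (tt i)"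
  and tau_T: "i \<in> J \<Longrightarrow> x \<in> U \<Longrightarrow> tt i x \<in> T"
  and tau_max: "i \<in> J \<Longrightarrow> x \<in> U \<Longrightarrow> strict_local_max P x (tt i x)"
  and Ssig_U: "x \<in> U \<Longrightarrow> Ssig P \<sigma> x = (\<lambda>i. tt i x) ` J"
  using red unfolding reduction_at_def by blast+

lemma tau_continuous: "i \<in> J \<Longrightarrow> continuous_on U (tt i)"
  using Ck_on_le[OF tau_C2, of i 0] by simp

lemma compact_T: "compact T" and T_ne: "T \<noteq> {}"
  using wf by (auto simp: wf_sisdp_def compact_eq_bounded_closed)

lemma con_continuous: "continuous_on T (con P x)"
proof -
  have "continuous_on (UNIV \<times> T) (\<lambda>(x, \<tau>). con P x \<tau>)" using wf by (simp add: wf_sisdp_def)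
  then have "continuous_on T (\<lambda>\<tau>. (\<lambda>(x, \<tau>). con P x \<tau>) (x, \<tau>))"
    by (rule continuous_on_compose2) (auto intro!: continuous_intros)
  then show ?thesis by simp
qed

text \<open>
  The partial derivative and the gradient in \<open>x\<close> are read off the joint derivative \<open>D\<close>, which gives their joint smoothness.
\<close>

definition con_differential :: "(real^'q) set \<Rightarrow> ((real^'n) \<times> (real^'q) \<Rightarrow> (real^'n) \<times> (real^'q) \<Rightarrow> real) \<Rightarrow> bool" where
  "con_differential W D \<longleftrightarrow> T \<subseteq> W \<and> Ck_on 3 (UNIV \<times> W) (\<lambda>(x, \<tau>). con P x \<tau>) \<and> (\<forall>v. Ck_on 2 (UNIV \<times> W) (\<lambda>z. D z v)) \<and>
     (\<forall>x. \<forall>\<tau>\<in>W. ((\<lambda>(x, \<tau>). con P x \<tau>) has_derivative D (x, \<tau>)) (at (x, \<tau>)) \<and>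
       ((\<lambda>z. con P z \<tau>) has_derivative (\<lambda>h. D (x, \<tau>) (h, 0))) (at x) \<and>
       grad (\<lambda>z. con P z \<tau>) x = (\<chi> j. D (x, \<tau>) (axis j 1, 0)))"

lemma con_derivative: obtains W D where "con_differential W D"
proof -
  obtain W where W: "open W" "T \<subseteq> W" and C: "Ck_on 3 (UNIV \<times> W) (\<lambda>(x, \<tau>). con P x \<tau>)" using conC by blast
  have "Ck_on (Suc 2) (UNIV \<times> W) (\<lambda>(x, \<tau>). con P x \<tau>)" using C by (simp add: eval_nat_numeral)
  then obtain D where D: "\<And>z. z \<in> UNIV \<times> W \<Longrightarrow> ((\<lambda>(x, \<tau>). con P x \<tau>) has_derivative D z) (at z)"
    and D2: "\<And>v. Ck_on 2 (UNIV \<times> W) (\<lambda>z. D z v)" unfolding Ck_on.simps(2)[of 2] by blast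
  have part: "((\<lambda>z. con P z \<tau>) has_derivative (\<lambda>h. D (x, \<tau>) (h, 0))) (at x)" if "\<tau> \<in> W" for x \<tau>
  proof -
    have "((\<lambda>z. (z, \<tau>)) has_derivative (\<lambda>h. (h, 0))) (at x)" by (auto intro!: derivative_eq_intros)
    from has_derivative_compose[OF this, of "\<lambda>(x, \<tau>). con P x \<tau>" "D (x, \<tau>)"] D[of "(x, \<tau>)"] that
    show ?thesis by simp
  qed
  have "grad (\<lambda>z. con P z \<tau>) x = (\<chi> j. D (x, \<tau>) (axis j 1, 0))" if "\<tau> \<in> W" for x \<tau>
    unfolding grad_def frechet_derivative_at[OF part[OF that], symmetric] ..
  with W(2) C D D2 part have "con_differential W D" unfolding con_differential_def by blast
  then show ?thesis by (rule that)
qed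

lemma con_differentialD:
  assumes "con_differential W D"
  shows "T \<subseteq> W" "Ck_on 3 (UNIV \<times> W) (\<lambda>(x, \<tau>). con P x \<tau>)" "Ck_on 2 (UNIV \<times> W) (\<lambda>z. D z v)"
    "\<tau> \<in> W \<Longrightarrow> ((\<lambda>(x, \<tau>). con P x \<tau>) has_derivative D (x, \<tau>)) (at (x, \<tau>))"
    "\<tau> \<in> W \<Longrightarrow> ((\<lambda>z. con P z \<tau>) has_derivative (\<lambda>h. D (x, \<tau>) (h, 0))) (at x)"
    "\<tau> \<in> W \<Longrightarrow> grad (\<lambda>z. con P z \<tau>) x = (\<chi> j. D (x, \<tau>) (axis j 1, 0))"
  using assms unfolding con_differential_def by blast+

text \<open>
  As \<open>x'\<close> varies near \<open>x\<close>, the point \<open>tt i x'\<close> stays near the local maximizer \<open>tt i x\<close> of \<open>con P x\<close>; so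
  \<open>con P x (tt i x')\<close> has a local maximum at \<open>x' = x\<close>, and the motion of the maximizer does not contribute to the
  derivative of \<open>gh i\<close>.
\<close>

lemma envelope:
  assumes i: "i \<in> J" and x: "x \<in> U"
  shows "grad (gh i) x = grad (\<lambda>z. con P z (tt i x)) x"
    and "(gh i has_derivative (\<lambda>h. grad (gh i) x \<bullet> h)) (at x)"
proof -
  obtain W D where "con_differential W D" by (rule con_derivative)
  note D = con_differentialD[OF this]
  define \<tau> where "\<tau> = tt i x"
  have \<tau>W: "\<tau> \<in> W" using tau_T[OF i x] D(1) by (auto simp: \<tau>_def)
  note Dx = D(4)[OF \<tau>W, of x]
  have "Ck_on (Suc 1) U (tt i)" using tau_C2[OF i] by (simp add: numeral_2_eq_2)
  note t = Ck_on_has_derivative[OF this x]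
  define t' where "t' = frechet_derivative (tt i) (at x)"
  note t = t[folded t'_def]
  have lin: "linear (D (x, \<tau>))" by (rule has_derivative_linear[OF Dx])
  have 1: "(gh i has_derivative (\<lambda>h. D (x, \<tau>) (h, t' h))) (at x)"
  proof -
    have "((\<lambda>z. (z, tt i z)) has_derivative (\<lambda>h. (h, t' h))) (at x)"
      by (intro has_derivative_Pair has_derivative_ident t)
    from has_derivative_compose[OF this, of "\<lambda>(x, \<tau>). con P x \<tau>" "D (x, \<tau>)"] Dx
    show ?thesis by (simp add: \<tau>_def ghat_def[abs_def])
  qed
  have 2: "((\<lambda>z. con P x (tt i z)) has_derivative (\<lambda>h. D (x, \<tau>) (0, t' h))) (at x)"
  proof -
    have "((\<lambda>z. (x, tt i z)) has_derivative (\<lambda>h. (0, t' h))) (at x)"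
      by (intro has_derivative_Pair has_derivative_const t)
    from has_derivative_compose[OF this, of "\<lambda>(x, \<tau>). con P x \<tau>" "D (x, \<tau>)"] Dx
    show ?thesis by (simp add: \<tau>_def)
  qed
  obtain e where e: "e > 0" "\<And>\<tau>'. \<tau>' \<in> T \<inter> ball \<tau> e \<Longrightarrow> \<tau>' \<noteq> \<tau> \<Longrightarrow> con P x \<tau>' < con P x \<tau>"
    using tau_max[OF i x] unfolding strict_local_max_def \<tau>_def by blast
  \<comment> \<open>on \<open>S\<close> the moving maximizer stays in the ball on which \<open>tt i x\<close> is maximal for \<open>con P x\<close>\<close>
  define S where "S = U \<inter> tt i -` ball \<tau> e"
  have S: "open S" "x \<in> S"
    using continuous_open_preimage[OF tau_continuous[OF i] openU open_ball] x e(1)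
    by (auto simp: S_def \<tau>_def)
  have "con P x (tt i z) \<le> con P x (tt i x)" if "z \<in> S" for z
    using e(2)[of "tt i z"] that tau_T[OF i] by (cases "tt i z = \<tau>") (auto simp: S_def \<tau>_def less_imp_le)
  then have "(\<lambda>h. D (x, \<tau>) (0, t' h)) = (\<lambda>h. 0)"
    by (intro differential_zero_maxmin[OF S(2,1) 2]) auto
  then have 0: "D (x, \<tau>) (0, t' h) = 0" for h by (rule fun_cong)
  have eq: "D (x, \<tau>) (h, t' h) = grad (\<lambda>z. con P z \<tau>) x \<bullet> h" for h
    using linear_add[OF lin, of "(h, 0)" "(0, t' h)"] 0[of h] grad_eq[OF D(5)[OF \<tau>W], of x h] by simp
  have "(gh i has_derivative (\<lambda>h. grad (\<lambda>z. con P z \<tau>) x \<bullet> h)) (at x)" using 1 unfolding eq .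
  with grad_unique[OF this] show "grad (gh i) x = grad (\<lambda>z. con P z (tt i x)) x"
    "(gh i has_derivative (\<lambda>h. grad (gh i) x \<bullet> h)) (at x)"
    by (simp_all add: \<tau>_def)
qed

text \<open>
  By the envelope formula no derivative of \<open>tt i\<close> occurs in the gradient, which is therefore as smooth as \<open>tt i\<close> itself.
\<close>

lemma ghat_C2: assumes i: "i \<in> J" shows "Ck_on 2 U (gh i)" and "Ck_on 2 U (grad (gh i))"
proof -
  obtain W D where "con_differential W D" by (rule con_derivative)
  note D = con_differentialD[OF this]
  have pair: "Ck_on 2 U (\<lambda>x. (x, tt i x))"
    by (intro Ck_on_Pair Ck_on_bounded_linear bounded_linear_ident tau_C2[OF i])
  have sub: "(\<lambda>x. (x, tt i x)) ` U \<subseteq> UNIV \<times> W" using tau_T[OF i] D(1) by auto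
  have "Ck_on 2 (UNIV \<times> W) (\<lambda>(x, \<tau>). con P x \<tau>)" by (rule Ck_on_le[OF D(2)]) simp
  from Ck_on_compose[OF this pair sub] show "Ck_on 2 U (gh i)" by (simp add: ghat_def[abs_def])
  have "Ck_on 2 U (\<lambda>x. \<chi> j. D (x, tt i x) (axis j 1, 0))"
    by (rule Ck_on_vec_lambda) (rule Ck_on_compose[OF D(3) pair sub])
  moreover have "(\<chi> j. D (x, tt i x) (axis j 1, 0)) = grad (gh i) x" if "x \<in> U" for x
    using envelope(1)[OF i that] D(6)[of "tt i x" x] tau_T[OF i that] D(1) by auto
  ultimately show "Ck_on 2 U (grad (gh i))" by (rule Ck_on_cong[OF openU, rotated])
qed

lemma grad_con_continuous: "continuous_on T (\<lambda>\<tau>. grad (\<lambda>z. con P z \<tau>) x)"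
proof -
  obtain W D where "con_differential W D" by (rule con_derivative)
  note D = con_differentialD[OF this]
  have "continuous_on (UNIV \<times> W) (\<lambda>z. D z v)" for v using Ck_on_le[OF D(3), of 0 v] by simp
  then have "continuous_on T (\<lambda>\<tau>. D (x, \<tau>) v)" for v
    by (rule continuous_on_compose2) (use D(1) in \<open>auto intro!: continuous_intros\<close>)
  then have "continuous_on T (\<lambda>\<tau>. \<chi> j. D (x, \<tau>) (axis j 1, 0))"
    by (intro continuous_on_vec_lambda)
  then show ?thesis using D(6) D(1) by (auto cong: continuous_on_cong simp: subset_eq)
qed

end

section \<open>Discrete measures and residuals\<close>

context reduced_sisdp
begin

abbreviation "RT \<equiv> restrict_space borel T"

lemma space_R: "space RT = T" and sets_R: "sets RT = (\<inter>) T ` sets borel"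
  by (simp_all add: space_restrict_space sets_restrict_space)

lemma finite_sets_R: "finite A \<Longrightarrow> A \<subseteq> T \<Longrightarrow> A \<in> sets RT"
  unfolding sets_R by (intro image_eqI[of _ _ A]) (auto intro: borel_closed finite_imp_closed)

lemma discrete_AE:
  assumes y: "sets y = sets RT" and null: "emeasure y (T - A) = 0" and A: "finite A" "A \<subseteq> T"
  shows "AE \<tau> in y. \<tau> \<in> A"
proof (rule AE_I)
  have sp: "space y = T" using sets_eq_imp_space_eq[OF y] space_R by simp
  show "{\<tau> \<in> space y. \<tau> \<notin> A} \<subseteq> T - A" by (auto simp: sp)
  show "T - A \<in> sets y" using finite_sets_R[OF A] sets.compl_sets[of A y] by (simp add: y sp)
qed (rule null)

lemma integral_discrete:
  fixes h :: "real^'q \<Rightarrow> 'b::{banach,second_countable_topology}"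
  assumes y: "sets y = sets RT" "finite_measure y" and null: "emeasure y (T - (\<lambda>i. tt i x) ` J) = 0"
    and x: "x \<in> U" and inj: "inj_on (\<lambda>i. tt i x) J" and h: "continuous_on T h"
  shows "integral\<^sup>L y h = (\<Sum>i\<in>J. measure y {tt i x} *\<^sub>R h (tt i x))"
proof -
  let ?A = "(\<lambda>i. tt i x) ` J"
  interpret finite_measure y by (rule y(2))
  have A: "finite ?A" "?A \<subseteq> T" using tau_T x by auto
  have h_meas: "h \<in> borel_measurable y"
    using borel_measurable_continuous_on_restrict[OF h] measurable_cong_sets[OF y(1) refl] by blast
  have s: "{a} \<in> sets y" if "a \<in> ?A" for a using finite_sets_R[of "{a}"] that A(2) y(1) by auto
  have "has_bochner_integral y (\<lambda>\<tau>. indicator {a} \<tau> *\<^sub>R h a) (measure y {a} *\<^sub>R h a)" if "a \<in> ?A" for a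
    using s[OF that] by (intro has_bochner_integral_indicator) (auto simp: less_top[symmetric])
  then have I: "has_bochner_integral y (\<lambda>\<tau>. \<Sum>a\<in>?A. indicator {a} \<tau> *\<^sub>R h a) (\<Sum>a\<in>?A. measure y {a} *\<^sub>R h a)"
    by (intro has_bochner_integral_sum)
  have "integral\<^sup>L y h = integral\<^sup>L y (\<lambda>\<tau>. \<Sum>a\<in>?A. indicator {a} \<tau> *\<^sub>R h a)"
  proof (rule integral_cong_AE[OF h_meas])
    show "(\<lambda>\<tau>. \<Sum>a\<in>?A. indicator {a} \<tau> *\<^sub>R h a) \<in> borel_measurable y"
      using I by (rule borel_measurable_has_bochner_integral)
    have "(\<Sum>a\<in>?A. indicator {a} \<tau> *\<^sub>R h a) = h \<tau>" if "\<tau> \<in> ?A" for \<tau>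
    proof -
      have "(\<Sum>a\<in>?A. indicator {a} \<tau> *\<^sub>R h a) = (\<Sum>a\<in>?A. if a = \<tau> then h a else 0)"
        by (intro sum.cong) auto
      then show ?thesis using A(1) that by simp
    qed
    with discrete_AE[OF y(1) null A]
    show "AE \<tau> in y. h \<tau> = (\<Sum>a\<in>?A. indicator {a} \<tau> *\<^sub>R h a)"
      by (auto elim!: eventually_mono)
  qed
  also have "\<dots> = (\<Sum>a\<in>?A. measure y {a} *\<^sub>R h a)" by (rule has_bochner_integral_integral_eq[OF I])
  also have "\<dots> = (\<Sum>i\<in>J. measure y {tt i x} *\<^sub>R h (tt i x))" by (rule sum.reindex_cong[OF inj refl refl])
  finally show ?thesis .
qed

text \<open>
  A maximizer of \<open>con P x\<close> over \<open>T\<close> belongs to \<open>Ssig P \<sigma> x\<close>, hence is one of the points \<open>tt i x\<close>.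
\<close>

lemma theta_bounds:
  shows "\<tau> \<in> T \<Longrightarrow> max (con P x \<tau>) 0 \<le> theta P x"
    and "x \<in> U \<Longrightarrow> theta P x \<le> (\<Sum>i\<in>J. max (gh i x) 0)" and "0 \<le> theta P x"
proof -
  have cont: "continuous_on T (\<lambda>\<tau>. max (con P x \<tau>) 0)" by (intro continuous_intros con_continuous)
  have bdd: "bdd_above ((\<lambda>\<tau>. max (con P x \<tau>) 0) ` T)"
    using compact_imp_bounded[OF compact_continuous_image[OF cont compact_T]] by (rule bounded_imp_bdd_above)
  show 1: "\<tau> \<in> T \<Longrightarrow> max (con P x \<tau>) 0 \<le> theta P x" for \<tau>
    unfolding theta_def by (rule cSUP_upper[OF _ bdd])
  then show "0 \<le> theta P x" using T_ne by (metis equals0I max.cobounded2 order_trans)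
  obtain \<tau> where \<tau>: "\<tau> \<in> T" "\<And>\<tau>'. \<tau>' \<in> T \<Longrightarrow> con P x \<tau>' \<le> con P x \<tau>"
    using continuous_attains_sup[OF compact_T T_ne con_continuous] by blast
  show "theta P x \<le> (\<Sum>i\<in>J. max (gh i x) 0)" if x: "x \<in> U"
    unfolding theta_def
  proof (rule cSUP_least[OF T_ne])
    have "local_max P x \<tau>" unfolding local_max_def using \<tau> by (auto intro!: exI[of _ 1])
    moreover have "(SUP \<tau>'\<in>T. con P x \<tau>') \<le> con P x \<tau>" by (rule cSUP_least[OF T_ne \<tau>(2)])
    ultimately have "\<tau> \<in> Ssig P \<sigma> x" using \<sigma> by (auto simp: Ssig_def)
    then obtain i where i: "i \<in> J" "\<tau> = tt i x" using Ssig_U[OF x] by auto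
    fix \<tau>' assume "\<tau>' \<in> T"
    then have "max (con P x \<tau>') 0 \<le> max (gh i x) 0" using \<tau>(2)[of \<tau>'] i(2) by (auto simp: ghat_def)
    also have "\<dots> \<le> (\<Sum>i\<in>J. max (gh i x) 0)" using i(1) by (intro member_le_sum) auto
    finally show "max (con P x \<tau>') 0 \<le> (\<Sum>i\<in>J. max (gh i x) 0)" .
  qed
qed

text \<open>
  The integral of a nonpositive function vanishes, so the measure lives on the zeros of \<open>con P xs\<close>. These are global
  maximizers, and there are only finitely many.
\<close>

lemma KKT_discrete:
  assumes K: "KKT P (xs, y, V)"
  shows "emeasure y (T - (\<lambda>i. tt i xs) ` J) = 0"
proof -
  have y: "sets y = sets RT" "finite_measure y" and int: "integral\<^sup>L y (con P xs) = 0"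
    and le: "\<And>\<tau>. \<tau> \<in> T \<Longrightarrow> con P xs \<tau> \<le> 0"
    using K by (auto simp: KKT_def Mplus_def phi2_def)
  interpret finite_measure y by (rule y(2))
  have sp: "space y = T" using sets_eq_imp_space_eq[OF y(1)] space_R by simp
  have meas: "con P xs \<in> borel_measurable y"
    using borel_measurable_continuous_on_restrict[OF con_continuous] measurable_cong_sets[OF y(1) refl] by blast
  obtain B where B: "\<And>\<tau>. \<tau> \<in> T \<Longrightarrow> norm (con P xs \<tau>) \<le> B"
    using compact_imp_bounded[OF compact_continuous_image[OF con_continuous[of xs] compact_T]] by (auto simp: bounded_iff)
  have integ: "integrable y (con P xs)"
    by (intro integrable_const_bound[where B=B] meas AE_I2 B) (simp add: sp)
  have "AE \<tau> in y. - con P xs \<tau> = 0"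
  proof (rule integral_nonneg_eq_0_iff_AE[THEN iffD1])
    show "AE \<tau> in y. 0 \<le> - con P xs \<tau>" by (rule AE_I2) (use le sp in auto)
  qed (use integ int in auto)
  then have "AE \<tau> in y. \<tau> \<in> (\<lambda>i. tt i xs) ` J"
  proof (rule AE_mp, intro AE_I2 impI)
    fix \<tau> assume \<tau>: "\<tau> \<in> space y" "- con P xs \<tau> = 0"
    have "local_max P xs \<tau>" unfolding local_max_def using \<tau> le by (auto simp: sp intro!: exI[of _ 1])
    moreover have "(SUP \<tau>'\<in>T. con P xs \<tau>') \<le> 0" by (rule cSUP_least[OF T_ne le])
    ultimately have "\<tau> \<in> Ssig P \<sigma> xs" using \<sigma> \<tau> by (auto simp: Ssig_def)
    then show "\<tau> \<in> (\<lambda>i. tt i xs) ` J" using Ssig_U[OF xsU] by auto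
  qed
  moreover have "T - (\<lambda>i. tt i xs) ` J \<in> sets y"
    using finite_sets_R[of "(\<lambda>i. tt i xs) ` J"] tau_T xsU sets.compl_sets[of "(\<lambda>i. tt i xs) ` J" y] y(1) sp by auto
  moreover have "AE \<tau> in y. \<tau> \<notin> T - (\<lambda>i. tt i xs) ` J"
    using calculation(1) by (rule eventually_mono) simp
  ultimately show ?thesis using AE_iff_null_sets[of "T - (\<lambda>i. tt i xs) ` J" y] by (simp add: null_setsD1)
qed

text \<open>
  The measure that \<open>of_vec\<close> attaches to a vector of masses.
\<close>

definition mass :: "real^'n \<Rightarrow> real^'p \<Rightarrow> (real^'q) measure" where
  "mass x v = measure_of T (sets RT) (\<lambda>A. \<Sum>i\<in>J. ennreal (v $ i) * indicator A (tt i x))"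

text \<open>
  The set function in \<open>mass\<close> is the image of a point measure under \<open>i \<mapsto> tt i x\<close>, hence a measure.
\<close>

lemma mass_distr:
  assumes x: "x \<in> U"
  shows "mass x v = distr (point_measure J (\<lambda>i. ennreal (v $ i))) RT (\<lambda>i. tt i x)"
    and "A \<in> sets RT \<Longrightarrow> emeasure (mass x v) A = (\<Sum>i\<in>J. ennreal (v $ i) * indicator A (tt i x))"
    and "sets (mass x v) = sets RT"
proof -
  let ?p = "point_measure J (\<lambda>i. ennreal (v $ i))"
  let ?N = "distr ?p RT (\<lambda>i. tt i x)"
  have m: "(\<lambda>i. tt i x) \<in> measurable ?p RT"
    using tau_T x by (simp add: space_R)
  have e: "emeasure ?N A = (\<Sum>i\<in>J. ennreal (v $ i) * indicator A (tt i x))" if "A \<in> sets RT" for A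
  proof -
    have "emeasure ?N A = emeasure ?p ((\<lambda>i. tt i x) -` A \<inter> J)"
      using emeasure_distr[OF m that] by (simp add: space_point_measure)
    also have "\<dots> = (\<Sum>i\<in>(\<lambda>i. tt i x) -` A \<inter> J. ennreal (v $ i))"
      by (rule emeasure_point_measure_finite) auto
    also have "\<dots> = (\<Sum>i\<in>J. ennreal (v $ i) * indicator A (tt i x))"
      by (simp add: indicator_def if_distrib sum.If_cases Int_def vimage_def conj_commute cong: if_cong)
    finally show ?thesis .
  qed
  have "mass x v = measure_of (space ?N) (sets ?N) (emeasure ?N)"
    unfolding mass_def space_distr sets_distr space_R
  proof (rule measure_of_eq)
    show "sets RT \<subseteq> Pow T" using sets.sets_into_space[of _ RT] by (auto simp: space_R)
    fix A assume "A \<in> sigma_sets T (sets RT)"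
    then have "A \<in> sets RT" using sets.sigma_sets_eq[of RT] by (simp add: space_R)
    then show "(\<Sum>i\<in>J. ennreal (v $ i) * indicator A (tt i x)) = emeasure ?N A" by (simp add: e)
  qed
  then show 1: "mass x v = ?N" by (simp only: measure_of_of_measure)
  show "A \<in> sets RT \<Longrightarrow> emeasure (mass x v) A = (\<Sum>i\<in>J. ennreal (v $ i) * indicator A (tt i x))"
    "sets (mass x v) = sets RT" unfolding 1 by (simp_all add: e)
qed

text \<open>
  For a measure with finite support regularity is witnessed by the support inside a set and by the complement of the support outside of it.
\<close>

lemma mass_facts:
  assumes x: "x \<in> U" and v: "\<And>i. i \<in> J \<Longrightarrow> 0 \<le> v $ i" and inj: "inj_on (\<lambda>i. tt i x) J"
  shows "mass x v \<in> Mplus P" and "emeasure (mass x v) (T - (\<lambda>i. tt i x) ` J) = 0"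
    and "i \<in> J \<Longrightarrow> measure (mass x v) {tt i x} = v $ i"
proof -
  let ?A = "(\<lambda>i. tt i x) ` J"
  let ?e = "\<lambda>B. \<Sum>i\<in>J. ennreal (v $ i) * indicator B (tt i x)"
  have A: "finite ?A" "?A \<subseteq> T" using tau_T x by auto
  have sT: "T \<in> sets RT" using sets.top[of RT] by (simp add: space_R)
  note e = mass_distr(2)[OF x]
  have TA: "T - ?A \<in> sets RT" using finite_sets_R[OF A] sT by blast
  show "emeasure (mass x v) (T - ?A) = 0" by (simp add: e[OF TA] indicator_def)
  show "measure (mass x v) {tt i x} = v $ i" if "i \<in> J"
  proof -
    have "{tt i x} \<in> sets RT" using finite_sets_R[of "{tt i x}"] tau_T[OF that x] by simp
    then have "emeasure (mass x v) {tt i x} = (\<Sum>j\<in>J. if j = i then ennreal (v $ j) else 0)"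
      unfolding e[OF \<open>{tt i x} \<in> sets RT\<close>] by (intro sum.cong) (use inj that in \<open>auto simp: indicator_def inj_on_def\<close>)
    then show ?thesis using that v[OF that] by (simp add: measure_def)
  qed
  have fin: "finite_measure (mass x v)"
  proof
    have "?e T < top" by (auto simp: indicator_def ennreal_mult_less_top less_top[symmetric])
    then show "emeasure (mass x v) (space (mass x v)) \<noteq> \<infinity>"
      using sets_eq_imp_space_eq[OF mass_distr(3)[OF x]] by (simp add: space_R e[OF sT])
  qed
  have inner: "emeasure (mass x v) B = (SUP K\<in>{K. compact K \<and> K \<subseteq> B}. emeasure (mass x v) K)"
    and outer: "emeasure (mass x v) B = (INF G\<in>{G. open G \<and> B \<subseteq> G}. emeasure (mass x v) (G \<inter> T))"
    if B: "B \<in> sets RT" for B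
  proof -
    have BT: "B \<subseteq> T" using sets.sets_into_space[OF B] by (simp add: space_R)
    have K0: "B \<inter> ?A \<in> {K. compact K \<and> K \<subseteq> B}" "B \<inter> ?A \<in> sets RT"
      using A B finite_sets_R[OF A] by (auto intro: finite_imp_compact)
    have eq: "emeasure (mass x v) (B \<inter> ?A) = emeasure (mass x v) B"
      unfolding e[OF B] e[OF K0(2)] by (intro sum.cong) (auto simp: indicator_def)
    show "emeasure (mass x v) B = (SUP K\<in>{K. compact K \<and> K \<subseteq> B}. emeasure (mass x v) K)"
    proof (rule antisym)
      show "emeasure (mass x v) B \<le> (SUP K\<in>{K. compact K \<and> K \<subseteq> B}. emeasure (mass x v) K)"
        unfolding eq[symmetric] by (rule SUP_upper[OF K0(1)])
      show "(SUP K\<in>{K. compact K \<and> K \<subseteq> B}. emeasure (mass x v) K) \<le> emeasure (mass x v) B"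
        by (rule SUP_least) (use B in \<open>auto intro!: emeasure_mono simp: mass_distr(3)[OF x]\<close>)
    qed
    \<comment> \<open>removing the finitely many support points outside of \<open>B\<close> leaves an open set of the same mass\<close>
    have G0: "- (?A - B) \<in> {G. open G \<and> B \<subseteq> G}"
    proof -
      have "closed (?A - B)" using A(1) by (intro finite_imp_closed) simp
      then have "open (- (?A - B))" by (rule open_Compl)
      then show ?thesis by blast
    qed
    have GT: "G \<inter> T \<in> sets RT" if "open G" for G using that sets_restrict_space[of borel T] by auto
    have eq2: "emeasure (mass x v) (- (?A - B) \<inter> T) = emeasure (mass x v) B"
      using G0 GT[of "- (?A - B)"] A(2)
      by (simp add: e[OF B] e) (auto intro!: sum.cong simp: indicator_def)
    show "emeasure (mass x v) B = (INF G\<in>{G. open G \<and> B \<subseteq> G}. emeasure (mass x v) (G \<inter> T))"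
    proof (rule antisym)
      show "(INF G\<in>{G. open G \<and> B \<subseteq> G}. emeasure (mass x v) (G \<inter> T)) \<le> emeasure (mass x v) B"
        unfolding eq2[symmetric] by (rule INF_lower[OF G0])
      show "emeasure (mass x v) B \<le> (INF G\<in>{G. open G \<and> B \<subseteq> G}. emeasure (mass x v) (G \<inter> T))"
        by (rule INF_greatest) (use BT GT in \<open>auto intro!: emeasure_mono simp: mass_distr(3)[OF x]\<close>)
    qed
  qed
  show "mass x v \<in> Mplus P"
    unfolding Mplus_def using fin inner outer mass_distr(3)[OF x] by auto
qed

lemma eventually_inj: "\<forall>\<^sub>F x in nhds xs. inj_on (\<lambda>i. tt i x) J"
proof -
  have inj0: "inj_on (\<lambda>i. tt i xs) J"
    using red Ssig_U[OF xsU] by (intro eq_card_imp_inj_on) (auto simp: reduction_at_def)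
  have "\<forall>\<^sub>F x in nhds xs. tt i x \<noteq> tt j x" if "i \<in> J" "j \<in> J" "i \<noteq> j" for i j
  proof -
    have "open (U \<inter> (\<lambda>x. tt i x - tt j x) -` (- {0}))"
      by (intro continuous_open_preimage continuous_intros tau_continuous that openU)
    moreover have "xs \<in> U \<inter> (\<lambda>x. tt i x - tt j x) -` (- {0})" using inj0 that xsU by (auto simp: inj_on_def)
    ultimately show ?thesis by (auto simp: eventually_nhds)
  qed
  then have "\<forall>\<^sub>F x in nhds xs. i \<noteq> j \<longrightarrow> tt i x \<noteq> tt j x" if "i \<in> J" "j \<in> J" for i j
    using that by (cases "i = j") auto
  then have "\<forall>\<^sub>F x in nhds xs. \<forall>i\<in>J. \<forall>j\<in>J. i \<noteq> j \<longrightarrow> tt i x \<noteq> tt j x"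
    by (simp add: eventually_ball_finite_distrib)
  then show ?thesis by (rule eventually_mono) (auto simp: inj_on_def)
qed

end

section \<open>The optimality map and the Newton equations\<close>

lemma has_derivative_hess:
  assumes "(grad f has_derivative G) (at x)" shows "(grad f has_derivative (\<lambda>h. hess f x *v h)) (at x)"
proof -
  have "(\<lambda>h. hess f x *v h) = G" by (rule ext) (rule hess_eq[OF assms])
  then show ?thesis using assms by simp
qed

lemma bounded_linear_Flin: "bounded_linear (Flin P)"
  by (rule linear_conv_bounded_linear[THEN iffD1])
    (auto intro!: linearI simp: Flin_def algebra_simps sum.distrib scaleR_sum_right)

lemma mdot_bilinear: "bounded_bilinear (mdot :: real^'m^'m::finite \<Rightarrow> real^'m^'m \<Rightarrow> real)"
proof -
  have "mdot X Y = X \<bullet> transpose Y" for X Y :: "real^'m^'m"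
    by (simp add: mdot_def trace_def matrix_matrix_mult_def inner_vec_def transpose_def)
  then have *: "mdot = (\<lambda>X Y :: real^'m^'m. X \<bullet> transpose Y)" by (intro ext)
  have t: "bounded_linear (transpose :: real^'m^'m \<Rightarrow> real^'m^'m)"
    by (rule linear_conv_bounded_linear[THEN iffD1]) (auto intro!: linearI simp: transpose_add transpose_scalar)
  show ?thesis unfolding * by (rule bounded_bilinear.comp[OF bounded_bilinear_inner bounded_linear_ident t])
qed

interpretation mdot: bounded_bilinear mdot by (rule mdot_bilinear)

lemma bounded_linear_Fadj: "bounded_linear (Fadj P)"
  by (rule linear_conv_bounded_linear[THEN iffD1])
    (auto intro!: linearI simp: Fadj_def vec_eq_iff mdot.add_right mdot.scaleR_right)

lemma mdot_Flin: "mdot (Flin P h) V = Fadj P V \<bullet> h"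
  by (simp add: Flin_def Fadj_def mdot.sum_left mdot.scaleR_left inner_vec_def mult.commute)

lemma Fmap_diff: "Fmap P x' - Fmap P x = Flin P (x' - x)"
  using linear_diff[OF bounded_linear.linear[OF bounded_linear_Flin], of P x' x] by (simp add: Fmap_def)

lemma Fmap_add: "Fmap P (x + d) = Fmap P x + Flin P d"
  using Fmap_diff[of P "x + d" x] by (simp add: algebra_simps)

lemma Fmap_derivative: "(Fmap P has_derivative Flin P) (at x)"
  unfolding Fmap_def[abs_def] using bounded_linear_imp_has_derivative[OF bounded_linear_Flin]
  by (auto intro!: derivative_eq_intros)

lemma Fmap_Ck: "Ck_on k S (Fmap P)"
  unfolding Fmap_def[abs_def] by (intro Ck_on_add Ck_on_const Ck_on_bounded_linear bounded_linear_Flin)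

lemma symm_Fmap: assumes "wf_sisdp P" shows "symm (Fmap P x)" "symm (Flin P d)"
proof -
  show *: "symm (Flin P d)" for d using assms unfolding Flin_def wf_sisdp_def by (intro symm_sum) auto
  show "symm (Fmap P x)" using assms * unfolding Fmap_def wf_sisdp_def by auto
qed

text \<open>
  The amount by which the matrix part of the direction deviates from the Newton equation for \<open>F \<circ> V = \<mu> I\<close>,
  see \<open>pert_alt\<close>.
\<close>

definition pert :: "real^'m^'m::finite \<Rightarrow> real^'m^'m \<Rightarrow> real^'m^'m \<Rightarrow> real^'m^'m" where
  "pert F V D = (1/8) *\<^sub>R commutator (commutator F V) (lyap_inv F D)"

lemma pert_alt:
  assumes "posdef F" "symm D"
  shows "(1/2) *\<^sub>R (sprod V D + sprod F (sprod V (lyap_inv F D))) = sprod V D + pert F V D"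
proof -
  have "pert F V D = (1/2) *\<^sub>R (sprod F (sprod V (lyap_inv F D)) - sprod V D)"
    using sprod_commutator[of F V "lyap_inv F D"] lyap_inv(2)[OF assms] by (simp add: pert_def)
  moreover have "A + (1/2) *\<^sub>R (B - A) = (1/2) *\<^sub>R (A + B)" for A B :: "real^'a^'a"
  proof -
    have "(1/2) *\<^sub>R A + (1/2) *\<^sub>R A = A" using scaleR_add_left[of "1/2" "1/2" A] by simp
    then have "A + (1/2) *\<^sub>R (B - A) = ((1/2) *\<^sub>R A + (1/2) *\<^sub>R A) + ((1/2) *\<^sub>R B - (1/2) *\<^sub>R A)"
      by (simp add: scaleR_diff_right)
    then show ?thesis by (simp add: scaleR_add_right)
  qed
  ultimately show ?thesis by simp
qed

context reduced_sisdp
begin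

abbreviation "I \<equiv> Iact P r xs"

text \<open>
  For inactive \<open>i\<close> the mass \<open>y $ i\<close> takes the place of \<open>gh i x\<close>. In this way all mass vectors are covered, and the
  zeros of \<open>Psi\<close> near the limit have the right support.
\<close>

definition Psi :: "('n, 'm, 'p) vpoint \<Rightarrow> ('n, 'm, 'p) vpoint" where
  "Psi = (\<lambda>(x, y, V).
     (grad (obj P) x + (\<Sum>i\<in>J. y $ i *\<^sub>R grad (gh i) x) - Fadj P V,
      \<chi> i. if i \<in> I then gh i x else y $ i,
      sprod (Fmap P x) V))"

text \<open>
  The derivative of \<open>Psi\<close> at the first argument, applied to the second.
\<close>

definition DPsi :: "('n, 'm, 'p) vpoint \<Rightarrow> ('n, 'm, 'p) vpoint \<Rightarrow> ('n, 'm, 'p) vpoint" where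
  "DPsi = (\<lambda>(x, y, V) (dx, dy, dV).
     (hess (obj P) x *v dx + (\<Sum>i\<in>J. y $ i *\<^sub>R (hess (gh i) x *v dx) + dy $ i *\<^sub>R grad (gh i) x) - Fadj P dV,
      \<chi> i. if i \<in> I then grad (gh i) x \<bullet> dx else dy $ i,
      sprod (Fmap P x) dV + sprod (Flin P dx) V))"

lemma I_J: "i \<in> I \<Longrightarrow> i \<in> J" by (simp add: Iact_def)

lemma grad_obj_C2: "Ck_on 2 UNIV (grad (obj P))"
  using objC by (intro Ck_on_grad) (simp_all add: eval_nat_numeral)

lemma hess_derivative:
  assumes x: "x \<in> U"
  shows "(grad (obj P) has_derivative (\<lambda>h. hess (obj P) x *v h)) (at x)"
    and "i \<in> J \<Longrightarrow> (grad (gh i) has_derivative (\<lambda>h. hess (gh i) x *v h)) (at x)"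
proof -
  have "Ck_on (Suc 1) UNIV (grad (obj P))" using grad_obj_C2 by (simp add: numeral_2_eq_2)
  from Ck_on_has_derivative[OF this] show "(grad (obj P) has_derivative (\<lambda>h. hess (obj P) x *v h)) (at x)"
    by (rule has_derivative_hess) simp
  assume "i \<in> J"
  then have "Ck_on (Suc 1) U (grad (gh i))" using ghat_C2(2) by (simp add: numeral_2_eq_2)
  from Ck_on_has_derivative[OF this x] show "(grad (gh i) has_derivative (\<lambda>h. hess (gh i) x *v h)) (at x)"
    by (rule has_derivative_hess)
qed

lemma vec_lambda_derivative:
  fixes f :: "'i::finite \<Rightarrow> 'z::real_normed_vector \<Rightarrow> real"
  assumes "\<And>i. ((\<lambda>x. f i x) has_derivative f' i) (at x)"
  shows "((\<lambda>x. \<chi> i. f i x) has_derivative (\<lambda>h. \<chi> i. f' i h)) (at x)"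
  unfolding vec_lambda_sum_axis by (auto intro!: derivative_eq_intros assms)

lemma Psi_derivative:
  assumes x: "x \<in> U"
  shows "(Psi has_derivative DPsi (x, y, V)) (at (x, y, V))"
proof -
  let ?w = "(x, y, V)"
  have fst: "(fst has_derivative fst) (at ?w)" and sn: "(snd has_derivative snd) (at ?w)"
    by (rule has_derivative_fst has_derivative_snd, rule has_derivative_ident)+
  have ysel: "((\<lambda>w. fst (snd w)) has_derivative (\<lambda>h. fst (snd h))) (at ?w)"
    and Vsel: "((\<lambda>w. snd (snd w)) has_derivative (\<lambda>h. snd (snd h))) (at ?w)"
    by (rule has_derivative_fst has_derivative_snd, rule sn)+
  have yi: "((\<lambda>w. fst (snd w) $ i) has_derivative (\<lambda>h. fst (snd h) $ i)) (at ?w)" for i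
    by (rule bounded_linear.has_derivative[OF bounded_linear_vec_nth ysel])
  have go: "((\<lambda>w. grad (obj P) (fst w)) has_derivative (\<lambda>h. hess (obj P) x *v fst h)) (at ?w)"
    using has_derivative_compose[OF fst] hess_derivative(1)[OF x] by simp
  have gg: "((\<lambda>w. grad (gh i) (fst w)) has_derivative (\<lambda>h. hess (gh i) x *v fst h)) (at ?w)" if "i \<in> J" for i
    using has_derivative_compose[OF fst] hess_derivative(2)[OF x that] by simp
  have g: "((\<lambda>w. gh i (fst w)) has_derivative (\<lambda>h. grad (gh i) x \<bullet> fst h)) (at ?w)" if "i \<in> J" for i
    using has_derivative_compose[OF fst] envelope(2)[OF that x] by simp
  have FF: "((\<lambda>w. Fmap P (fst w)) has_derivative (\<lambda>h. Flin P (fst h))) (at ?w)"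
    using has_derivative_compose[OF fst] Fmap_derivative by auto
  have S: "((\<lambda>w. \<Sum>i\<in>J. fst (snd w) $ i *\<^sub>R grad (gh i) (fst w)) has_derivative
      (\<lambda>h. \<Sum>i\<in>J. y $ i *\<^sub>R (hess (gh i) x *v fst h) + fst (snd h) $ i *\<^sub>R grad (gh i) x)) (at ?w)"
    using bounded_bilinear.FDERIV[OF bounded_bilinear_scaleR yi gg] by (intro has_derivative_sum) simp
  have Fa: "((\<lambda>w. Fadj P (snd (snd w))) has_derivative (\<lambda>h. Fadj P (snd (snd h)))) (at ?w)"
    by (rule bounded_linear.has_derivative[OF bounded_linear_Fadj Vsel])
  have 1: "((\<lambda>w. grad (obj P) (fst w) + (\<Sum>i\<in>J. fst (snd w) $ i *\<^sub>R grad (gh i) (fst w)) - Fadj P (snd (snd w)))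
     has_derivative (\<lambda>h. hess (obj P) x *v fst h + (\<Sum>i\<in>J. y $ i *\<^sub>R (hess (gh i) x *v fst h) + fst (snd h) $ i *\<^sub>R grad (gh i) x)
        - Fadj P (snd (snd h)))) (at ?w)"
    by (intro has_derivative_diff has_derivative_add go S Fa)
  have 2: "((\<lambda>w. \<chi> i. if i \<in> I then gh i (fst w) else fst (snd w) $ i) has_derivative
      (\<lambda>h. \<chi> i. if i \<in> I then grad (gh i) x \<bullet> fst h else fst (snd h) $ i)) (at ?w)"
  proof (rule vec_lambda_derivative)
    show "((\<lambda>w. if i \<in> I then gh i (fst w) else fst (snd w) $ i) has_derivative
        (\<lambda>h. if i \<in> I then grad (gh i) x \<bullet> fst h else fst (snd h) $ i)) (at ?w)" for i
      using g[OF I_J] yi by (cases "i \<in> I") simp_all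
  qed
  have 3: "((\<lambda>w. sprod (Fmap P (fst w)) (snd (snd w))) has_derivative
      (\<lambda>h. sprod (Fmap P x) (snd (snd h)) + sprod (Flin P (fst h)) V)) (at ?w)"
    using bounded_bilinear.FDERIV[OF bilinear_sprod FF Vsel] by simp
  show ?thesis
    using has_derivative_Pair[OF 1 has_derivative_Pair[OF 2 3]]
    by (simp add: Psi_def DPsi_def split_def cong: if_cong)
qed

lemma Psi_C2: "Ck_on 2 (U \<times> UNIV) Psi"
proof -
  let ?S = "U \<times> (UNIV :: ((real^'p) \<times> (real^('m::{finite,linorder})^('m::{finite,linorder}))) set)"
  have cf: "Ck_on 2 ?S (\<lambda>w. f (fst w))" if "Ck_on 2 U f" for f :: "real^'n \<Rightarrow> 'z::real_normed_vector"
    by (rule Ck_on_compose[OF that Ck_on_bounded_linear[OF bounded_linear_fst]]) auto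
  have y: "Ck_on 2 ?S (\<lambda>w. fst (snd w) $ i)" for i
    by (intro Ck_on_bounded_linear bounded_linear_compose[OF bounded_linear_vec_nth]
        bounded_linear_compose[OF bounded_linear_fst bounded_linear_snd])
  have V: "bounded_linear (\<lambda>w :: ('n, 'm, 'p) vpoint. snd (snd w))"
    by (intro bounded_linear_compose[OF bounded_linear_snd bounded_linear_snd])
  have "Ck_on 2 ?S (\<lambda>w. (grad (obj P) (fst w) + (\<Sum>i\<in>J. fst (snd w) $ i *\<^sub>R grad (gh i) (fst w)) + - Fadj P (snd (snd w)),
      \<chi> i. if i \<in> I then gh i (fst w) else fst (snd w) $ i,
      sprod (Fmap P (fst w)) (snd (snd w))))"
  proof (intro Ck_on_Pair Ck_on_add Ck_on_sum)
    show "Ck_on 2 ?S (\<lambda>w. grad (obj P) (fst w))" by (intro cf Ck_on_subset[OF grad_obj_C2]) simp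
    show "Ck_on 2 ?S (\<lambda>w. fst (snd w) $ i *\<^sub>R grad (gh i) (fst w))" if "i \<in> J" for i
      by (intro Ck_on_bilinear[OF bounded_bilinear_scaleR] y cf ghat_C2(2) that)
    show "Ck_on 2 ?S (\<lambda>w. - Fadj P (snd (snd w)))"
      by (intro Ck_on_bounded_linear bounded_linear_minus bounded_linear_compose[OF bounded_linear_Fadj] V)
    show "Ck_on 2 ?S (\<lambda>w. \<chi> i. if i \<in> I then gh i (fst w) else fst (snd w) $ i)"
    proof (rule Ck_on_vec_lambda)
      show "Ck_on 2 ?S (\<lambda>w. if i \<in> I then gh i (fst w) else fst (snd w) $ i)" for i
        using cf[OF ghat_C2(1)[OF I_J]] y by (cases "i \<in> I") simp_all
    qed
    show "Ck_on 2 ?S (\<lambda>w. sprod (Fmap P (fst w)) (snd (snd w)))"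
      by (intro Ck_on_bilinear[OF bilinear_sprod] cf Fmap_Ck Ck_on_bounded_linear V)
  qed
  then show ?thesis by (simp add: Psi_def split_def)
qed

text \<open>
  The Hessian of the Lagrangian is the derivative of its gradient, in which \<open>V\<close> enters as a constant.
\<close>

lemma newton_a_iff:
  assumes x: "x \<in> U"
  shows "newton_a P r xs (x, y, V) (dx, dy, dV) \<longleftrightarrow> fst (Psi (x, y, V) + DPsi (x, y, V) (dx, dy, dV)) = 0"
proof -
  let ?G = "\<lambda>z. grad (obj P) z + (\<Sum>i\<in>J. y $ i *\<^sub>R grad (gh i) z) - Fadj P V"
  have gL: "grad (lagr P r xs y V) z = ?G z" if z: "z \<in> U" for z
  proof (rule grad_unique)
    have "Ck_on (Suc 2) UNIV (obj P)" using objC by (simp add: eval_nat_numeral)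
    from Ck_on_has_derivative[OF this, of z] have o: "(obj P has_derivative (\<lambda>h. grad (obj P) z \<bullet> h)) (at z)"
      using grad_eq[of "obj P"] by auto
    have "((\<lambda>x. obj P x + (\<Sum>i\<in>J. y $ i * gh i x) - mdot (Fmap P x) V) has_derivative
        (\<lambda>h. grad (obj P) z \<bullet> h + (\<Sum>i\<in>J. y $ i * (grad (gh i) z \<bullet> h)) - mdot (Flin P h) V)) (at z)"
      by (intro has_derivative_diff has_derivative_add o has_derivative_sum has_derivative_mult_right
          envelope(2)[OF _ z] bounded_linear.has_derivative[OF mdot.bounded_linear_left Fmap_derivative])
    then show "(lagr P r xs y V has_derivative (\<lambda>h. ?G z \<bullet> h)) (at z)"
      by (simp add: lagr_def[abs_def] mdot_Flin inner_add_left inner_diff_left inner_sum_left)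
  qed
  have "(?G has_derivative (\<lambda>h. hess (obj P) x *v h + (\<Sum>i\<in>J. y $ i *\<^sub>R (hess (gh i) x *v h)) - 0)) (at x)"
    by (intro has_derivative_diff has_derivative_add has_derivative_sum has_derivative_scaleR_right
        hess_derivative x has_derivative_const)
  then have "(grad (lagr P r xs y V) has_derivative (\<lambda>h. hess (obj P) x *v h + (\<Sum>i\<in>J. y $ i *\<^sub>R (hess (gh i) x *v h)) - 0)) (at x)"
    by (rule has_derivative_transform_within_open[OF _ openU x]) (simp add: gL)
  from hess_eq[OF this]
  have h: "hess (lagr P r xs y V) x *v dx = hess (obj P) x *v dx + (\<Sum>i\<in>J. y $ i *\<^sub>R (hess (gh i) x *v dx))" by simp
  show ?thesis
    unfolding newton_a_def Psi_def DPsi_def split h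
    by (simp add: linear_add[OF bounded_linear.linear[OF bounded_linear_Fadj]] algebra_simps sum.distrib)
qed

text \<open>
  Gradients and Hessians at a point depend only on the values nearby, where the implicit functions at \<open>xb\<close> and at \<open>xs\<close> agree.
\<close>

lemma base_change:
  assumes xb: "nbhd r xb = U" "idx r xb = J" "\<And>i x. i \<in> J \<Longrightarrow> x \<in> U \<Longrightarrow> tau r xb i x = tt i x"
    and x: "x \<in> U"
  shows "newton_a P r xb (x, y, V) d \<longleftrightarrow> newton_a P r xs (x, y, V) d"
    and "i \<in> J \<Longrightarrow> lin_ghat P r xb x dx i = lin_ghat P r xs x dx i"
proof -
  have g: "ghat P r xb i z = gh i z" if "i \<in> J" "z \<in> U" for i z using xb(3)[OF that] by (simp add: ghat_def)
  have gg: "grad (ghat P r xb i) x = grad (gh i) x" if "i \<in> J" for i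
    by (rule grad_cong_open[OF openU x]) (rule g[OF that])
  show "i \<in> J \<Longrightarrow> lin_ghat P r xb x dx i = lin_ghat P r xs x dx i" by (simp add: lin_ghat_def g gg x)
  have "hess (lagr P r xb y V) x = hess (lagr P r xs y V) x"
    by (rule hess_cong_open[OF openU x]) (simp add: lagr_def xb(2) g)
  then show "newton_a P r xb (x, y, V) d \<longleftrightarrow> newton_a P r xs (x, y, V) d"
    by (simp add: newton_a_def split_def xb(2) gg)
qed

text \<open>
  The scaled equation is a Newton equation for \<open>Psi w = (0, 0, \<mu> I)\<close>, perturbed in the matrix component only.
\<close>

lemma step22_iff:
  assumes x: "x \<in> U" and y: "y \<in> vecs J" and F: "posdef (Fmap P x)"
  shows "step22 P r \<mu> xs I (x, y, V) (dx, dy, dV) \<longleftrightarrow> symm dV \<and>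
    Psi (x, y, V) + DPsi (x, y, V) (dx, dy, dV) = (0, 0, \<mu> *\<^sub>R mat 1 - pert (Fmap P x) V (Flin P dx))"
proof -
  have c: "fst (snd (Psi (x, y, V) + DPsi (x, y, V) (dx, dy, dV))) $ i =
      (if i \<in> I then lin_ghat P r xs x dx i else y $ i + dy $ i)" for i
    by (simp add: Psi_def DPsi_def lin_ghat_def)
  have sec: "dy \<in> vecs J \<and> (\<forall>i\<in>I. lin_ghat P r xs x dx i = 0) \<and> (\<forall>i\<in>J - I. y $ i + dy $ i = 0) \<longleftrightarrow>
    fst (snd (Psi (x, y, V) + DPsi (x, y, V) (dx, dy, dV))) = 0" (is "?l \<longleftrightarrow> ?r")
  proof
    assume l: ?l
    have "(if i \<in> I then lin_ghat P r xs x dx i else y $ i + dy $ i) = 0" for i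
      using l y by (cases "i \<in> J") (auto simp: vecs_def)
    then show ?r unfolding vec_eq_iff c by simp
  next
    assume ?r
    then have e: "(if i \<in> I then lin_ghat P r xs x dx i else y $ i + dy $ i) = 0" for i
      unfolding vec_eq_iff c by simp
    have "dy $ i = 0" if "i \<notin> J" for i using e[of i] I_J[of i] that y by (auto simp: vecs_def split: if_splits)
    moreover have "lin_ghat P r xs x dx i = 0" if "i \<in> I" for i using e[of i] that by simp
    moreover have "y $ i + dy $ i = 0" if "i \<notin> I" for i using e[of i] that by simp
    ultimately show ?l by (simp add: vecs_def)
  qed
  have "newton_b P \<mu> (x, y, V) (dx, dy, dV) \<longleftrightarrow>
      snd (snd (Psi (x, y, V) + DPsi (x, y, V) (dx, dy, dV))) = \<mu> *\<^sub>R mat 1 - pert (Fmap P x) V (Flin P dx)"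
    unfolding newton_b_def split pert_alt[OF F symm_Fmap(2)[OF wf]] eq_diff_eq
    by (simp add: Psi_def DPsi_def sprod.add_right sprod_commute[of V "Flin P dx"] add.assoc)
  then show ?thesis
    unfolding step22_def split newton_a_iff[OF x] using sec
    by (simp add: prod_eq_iff) blast
qed

end

section \<open>Points approaching the limit along the central path\<close>

text \<open>
  The properties of the limit \<open>(xs, ys, Vs)\<close> on which the local analysis rests: a
  nondegenerate zero of \<open>Psi\<close> with strict complementarity for the constraints and for the pair of matrices.
\<close>

locale limit_point =
  reduced_sisdp P \<sigma> r xs + complementary_pair "Fmap P xs" Vs Q c
  for P :: "('n::finite, 'm::{finite,linorder}, 'q::finite) sisdp" and \<sigma> :: real
    and r :: "('n, 'q, 'p::finite) reduction" and xs :: "real^'n" and Vs Q :: "((real, 'm) vec, 'm) vec" and c :: real +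
  fixes ys :: "real^'p"
  assumes Psi0: "Psi (xs, ys, Vs) = 0"
    and ysI: "i \<in> I \<Longrightarrow> 0 < ys $ i" and ys0: "i \<notin> I \<Longrightarrow> ys $ i = 0"
    and ghn: "i \<in> J \<Longrightarrow> i \<notin> I \<Longrightarrow> gh i xs < 0"
    and nonsing: "DPsi (xs, ys, Vs) h = 0 \<Longrightarrow> symm (snd (snd h)) \<Longrightarrow> h = 0"
begin

abbreviation ws :: "('n, 'm, 'p) vpoint" where "ws \<equiv> (xs, ys, Vs)"
abbreviation FF :: "('n, 'm, 'p) vpoint \<Rightarrow> ((real, 'm) vec, 'm) vec" where "FF w \<equiv> Fmap P (fst w)"
abbreviation VV :: "('n, 'm, 'p) vpoint \<Rightarrow> ((real, 'm) vec, 'm) vec" where "VV w \<equiv> snd (snd w)"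

definition central_value :: "real \<Rightarrow> ('n, 'm, 'p) vpoint" where "central_value \<mu> = (0, 0, \<mu> *\<^sub>R mat 1)"
definition res :: "real \<Rightarrow> ('n, 'm, 'p) vpoint \<Rightarrow> ('n, 'm, 'p) vpoint" where "res \<mu> w = Psi w - central_value \<mu>"

lemma norm_proj_le: "norm (fst w) \<le> norm w" "norm (VV w) \<le> norm (w :: ('n, 'm, 'p) vpoint)"
proof -
  show "norm (fst w) \<le> norm w" using norm_fst_le[of "fst w" "snd w"] by simp
  have "norm (VV w) \<le> norm (snd w)" using norm_snd_le[of "VV w" "fst (snd w)"] by simp
  also have "\<dots> \<le> norm w" using norm_snd_le[of "snd w" "fst w"] by simp
  finally show "norm (VV w) \<le> norm w" .
qed

lemma symm_FF: "symm (FF w)" "symm (Flin P d)" by (rule symm_Fmap[OF wf])+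

lemma res_third: "VV (res \<mu> w) = sprod (FF w) (VV w) - \<mu> *\<^sub>R mat 1"
  by (simp add: res_def central_value_def Psi_def split_def)

lemma third_le: "norm (sprod (FF w) (VV w) - \<mu> *\<^sub>R mat 1) \<le> norm (res \<mu> w)"
  unfolding res_third[symmetric] by (rule norm_proj_le)

lemma norm_central_value: "norm (central_value \<mu>) = \<bar>\<mu>\<bar> * norm (mat 1 :: ((real, 'm) vec, 'm) vec)" by (simp add: central_value_def)

lemma norm_mat1_pos: "0 < norm (mat 1 :: ((real, 'm) vec, 'm) vec)"
proof -
  have "(mat 1 :: ((real, 'm) vec, 'm) vec) $ i $ i \<noteq> 0 $ i $ i" for i by (simp add: mat_def)
  then have "(mat 1 :: ((real, 'm) vec, 'm) vec) \<noteq> 0" by metis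
  then show ?thesis by simp
qed

text \<open>
  Injectivity at the limit becomes a lower bound by compactness of the unit sphere. It persists nearby since the
  derivative is Lipschitz, and it makes \<open>norm (Psi w)\<close> comparable to the distance from the limit.
\<close>

lemma local_bounds:
  obtains \<rho> \<kappa> K where "0 < \<rho>" "0 < \<kappa>" "0 \<le> K"
    "\<And>w. w \<in> cball ws \<rho> \<Longrightarrow> fst w \<in> U"
    "\<And>w h. w \<in> cball ws \<rho> \<Longrightarrow> symm (VV h) \<Longrightarrow> \<kappa> * norm h \<le> norm (DPsi w h)"
    "\<And>w d. w \<in> cball ws \<rho> \<Longrightarrow> w + d \<in> cball ws \<rho> \<Longrightarrow> norm (Psi (w + d) - Psi w - DPsi w d) \<le> K * (norm d)\<^sup>2"
    "\<And>w. w \<in> cball ws \<rho> \<Longrightarrow> norm (Psi w) \<le> K * norm (w - ws)"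
    "\<And>w. w \<in> cball ws \<rho> \<Longrightarrow> symm (VV w) \<Longrightarrow> \<kappa> * norm (w - ws) \<le> norm (Psi w)"
proof -
  obtain \<rho>0 K0 where \<rho>0: "0 < \<rho>0" "0 \<le> K0" "cball ws \<rho>0 \<subseteq> U \<times> UNIV"
    and lip: "\<And>x y h. x \<in> cball ws \<rho>0 \<Longrightarrow> y \<in> cball ws \<rho>0 \<Longrightarrow>
       norm (frechet_derivative Psi (at x) h - frechet_derivative Psi (at y) h) \<le> K0 * norm (x - y) * norm h"
    and tay: "\<And>x y. x \<in> cball ws \<rho>0 \<Longrightarrow> y \<in> cball ws \<rho>0 \<Longrightarrow>
       norm (Psi y - Psi x - frechet_derivative Psi (at x) (y - x)) \<le> K0 * (norm (y - x))\<^sup>2"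
    by (rule Ck_on_2_quadratic[OF Psi_C2, of ws]) (use openU xsU in \<open>auto intro: open_Times\<close>)
  have fd: "frechet_derivative Psi (at w) = DPsi w" if "fst w \<in> U" for w
    using frechet_derivative_at[OF Psi_derivative[OF that, of "fst (snd w)" "snd (snd w)"]] by simp
  have U: "fst w \<in> U" if "w \<in> cball ws \<rho>0" for w using \<rho>0(3) that by (auto simp: mem_Times_iff)
  have bl: "bounded_linear (DPsi ws)" by (rule has_derivative_bounded_linear[OF Psi_derivative[OF xsU]])
  have sub: "subspace {h. symm (VV h)}" by (auto simp: subspace_def)
  obtain e where e: "0 < e" "\<And>h. symm (VV h) \<Longrightarrow> e * norm h \<le> norm (DPsi ws h)"
    using injective_imp_isometric[OF closed_subspace[OF sub] sub bl] nonsing by blast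
  obtain B where B: "0 < B" "\<And>h. norm (DPsi ws h) \<le> norm h * B"
    using bounded_linear.pos_bounded[OF bl] by blast
  \<comment> \<open>small enough for the derivative to change by at most half of its lower bound \<open>e\<close>\<close>
  define \<rho> where "\<rho> = min \<rho>0 (e / (2 * (K0 + 1)))"
  have \<rho>: "0 < \<rho>" "\<rho> \<le> \<rho>0" "K0 * \<rho> \<le> e / 2"
  proof -
    show "0 < \<rho>" "\<rho> \<le> \<rho>0" using \<rho>0 e by (auto simp: \<rho>_def)
    have "K0 * \<rho> \<le> K0 * (e / (2 * (K0 + 1)))" using \<rho>0(2) by (intro mult_left_mono) (auto simp: \<rho>_def)
    also have "\<dots> \<le> e / 2" using \<rho>0(2) e(1) by (simp add: field_simps)
    finally show "K0 * \<rho> \<le> e / 2" .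
  qed
  have sub\<rho>: "w \<in> cball ws \<rho>0" if "w \<in> cball ws \<rho>" for w using that \<rho>(2) by auto
  have wsc: "ws \<in> cball ws \<rho>0" using \<rho>0 by simp
  have small: "K0 * norm (w - ws) \<le> e / 2" if "w \<in> cball ws \<rho>" for w
  proof -
    have "norm (w - ws) \<le> \<rho>" using that by (simp add: dist_norm norm_minus_commute)
    then have "K0 * norm (w - ws) \<le> K0 * \<rho>" using \<rho>0(2) by (rule mult_left_mono)
    then show ?thesis using \<rho>(3) by simp
  qed
  have t0: "norm (Psi w - DPsi ws (w - ws)) \<le> e / 2 * norm (w - ws)" if w: "w \<in> cball ws \<rho>" for w
  proof -
    have "norm (Psi w - DPsi ws (w - ws)) \<le> K0 * (norm (w - ws))\<^sup>2"
      using tay[OF wsc sub\<rho>[OF w]] by (simp add: fd xsU Psi0)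
    also have "\<dots> \<le> e / 2 * norm (w - ws)"
      using mult_right_mono[OF small[OF w] norm_ge_zero[of "w - ws"]] by (simp add: power2_eq_square mult_ac)
    finally show ?thesis .
  qed
  show ?thesis
  proof (rule that[of \<rho> "e / 2" "K0 + B + e"])
    show "0 < \<rho>" "0 < e / 2" "0 \<le> K0 + B + e" using \<rho> e B \<rho>0 by auto
    show "fst w \<in> U" if "w \<in> cball ws \<rho>" for w using U sub\<rho> that by blast
    show "e / 2 * norm h \<le> norm (DPsi w h)" if w: "w \<in> cball ws \<rho>" and h: "symm (VV h)" for w h
    proof -
      have "norm (DPsi w h - DPsi ws h) \<le> e / 2 * norm h"
        using lip[OF sub\<rho>[OF w] wsc, of h] mult_right_mono[OF small[OF w] norm_ge_zero[of h]]
        by (simp add: fd U[OF sub\<rho>[OF w]] xsU)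
      then show ?thesis using e(2)[OF h] norm_triangle_ineq2[of "DPsi ws h" "DPsi w h"]
        by (simp add: norm_minus_commute)
    qed
    show "norm (Psi (w + d) - Psi w - DPsi w d) \<le> (K0 + B + e) * (norm d)\<^sup>2"
      if "w \<in> cball ws \<rho>" "w + d \<in> cball ws \<rho>" for w d
    proof -
      have "norm (Psi (w + d) - Psi w - DPsi w d) \<le> K0 * (norm d)\<^sup>2"
        using tay[OF sub\<rho>[OF that(1)] sub\<rho>[OF that(2)]] by (simp add: fd U[OF sub\<rho>[OF that(1)]])
      also have "\<dots> \<le> (K0 + B + e) * (norm d)\<^sup>2" using B e by (intro mult_right_mono) auto
      finally show ?thesis .
    qed
    show "norm (Psi w) \<le> (K0 + B + e) * norm (w - ws)" if w: "w \<in> cball ws \<rho>" for w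
    proof -
      have "norm (Psi w) \<le> norm (Psi w - DPsi ws (w - ws)) + norm (DPsi ws (w - ws))"
        using norm_triangle_sub by (simp add: add.commute)
      also have "\<dots> \<le> (e / 2 + B) * norm (w - ws)"
        using t0[OF w] B(2)[of "w - ws"] by (simp add: algebra_simps)
      also have "\<dots> \<le> (K0 + B + e) * norm (w - ws)" using e \<rho>0 by (intro mult_right_mono) auto
      finally show ?thesis .
    qed
    show "e / 2 * norm (w - ws) \<le> norm (Psi w)" if w: "w \<in> cball ws \<rho>" and s: "symm (VV w)" for w
    proof -
      have "symm (VV (w - ws))" using s symY by auto
      from e(2)[OF this] t0[OF w] norm_triangle_ineq2[of "DPsi ws (w - ws)" "Psi w"]
      show ?thesis by (simp add: norm_minus_commute)
    qed
  qed
qed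

lemma eventually_cball: "W \<longlonglongrightarrow> ws \<Longrightarrow> 0 < \<rho> \<Longrightarrow> \<forall>\<^sub>F k in sequentially. W k \<in> cball ws \<rho>"
  by (drule tendstoD[of W ws _ \<rho>]) (auto elim!: eventually_mono simp: dist_commute)

lemma Flin_dist: obtains K where "0 < K" "\<And>w. norm (FF w - Fmap P xs) \<le> K * norm (w - ws)" "\<And>d. norm (Flin P (fst d)) \<le> K * norm (d :: ('n, 'm, 'p) vpoint)"
proof -
  obtain K where K: "0 < K" "\<And>d. norm (Flin P d) \<le> norm d * K"
    using bounded_linear.pos_bounded[OF bounded_linear_Flin, of P] by blast
  have *: "norm (Flin P (fst d)) \<le> K * norm d" for d :: "('n, 'm, 'p) vpoint"
    using K(2)[of "fst d"] mult_left_mono[OF norm_proj_le(1)[of d] less_imp_le[OF K(1)]]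
    by (simp add: mult.commute)
  moreover have "norm (FF w - Fmap P xs) \<le> K * norm (w - ws)" for w
    using *[of "w - ws"] by (simp add: Fmap_diff)
  ultimately show ?thesis using K(1) that by blast
qed

lemma norm_kernel_compression_le: "norm (Q ** A ** Q) \<le> norm A" using norm_Q_right norm_Q_left order_trans by blast

lemma norm_QF_le: "norm (Q ** F) \<le> norm (F - Fmap P xs)"
  using norm_Q_left[of "F - Fmap P xs"] by (simp add: matmul.diff_right QX)

lemma norm_FQ_le: "norm (F ** Q) \<le> norm (F - Fmap P xs)"
  using norm_Q_right[of "F - Fmap P xs"] by (simp add: matmul.diff_left XQ)

text \<open>
  The two estimates of \<open>lyapunov_block_estimates\<close> with constant \<open>L\<close>.
\<close>

definition block_bounds :: "real \<Rightarrow> real \<Rightarrow> ((real, 'm) vec, 'm) vec \<Rightarrow> bool" where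
  "block_bounds L m F \<longleftrightarrow> (\<forall>Z s. transpose Z = s *\<^sub>R Z \<longrightarrow> \<bar>s\<bar> = 1 \<longrightarrow>
     norm (Z ** Q) \<le> L * (norm (sprod F Z ** Q) + norm (Q ** sprod F Z ** Q) / m + m * norm Z) \<and>
     norm Z \<le> L * (norm (sprod F Z) + norm (Q ** sprod F Z ** Q) / m))"

lemma block_boundsD:
  assumes "block_bounds L m F" "transpose Z = s *\<^sub>R Z" "\<bar>s\<bar> = 1"
  shows "norm (Z ** Q) \<le> L * (norm (sprod F Z ** Q) + norm (Q ** sprod F Z ** Q) / m + m * norm Z)"
    and "norm Z \<le> L * (norm (sprod F Z) + norm (Q ** sprod F Z ** Q) / m)"
  using assms unfolding block_bounds_def by blast+

text \<open>
  The points \<open>W k\<close> follow the central path with parameters \<open>m k\<close> up to residuals of the smaller order \<open>e k\<close>. The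
  iterates, the points after the first half of an iteration, and the trial points are three instances.
\<close>

definition stage :: "(nat \<Rightarrow> ('n, 'm, 'p) vpoint) \<Rightarrow> (nat \<Rightarrow> real) \<Rightarrow> (nat \<Rightarrow> real) \<Rightarrow> bool" where
  "stage W m e \<longleftrightarrow> (\<forall>\<^sub>F k in sequentially. symm (VV (W k)) \<and> 0 < m k \<and> 0 < e k) \<and> W \<longlonglongrightarrow> ws \<and> m \<longlonglongrightarrow> 0 \<and>
     (\<lambda>k. norm (res (m k) (W k))) \<in> O(e) \<and> e \<in> o(m)"

context
  fixes W m e assumes st: "stage W m e"
begin

lemma stageD: "\<forall>\<^sub>F k in sequentially. symm (VV (W k)) \<and> 0 < m k \<and> 0 < e k" "W \<longlonglongrightarrow> ws" "m \<longlonglongrightarrow> 0"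
  "(\<lambda>k. norm (res (m k) (W k))) \<in> O(e)" "e \<in> o(m)"
  using st by (auto simp: stage_def)

lemma stage_res_small: "(\<lambda>k. norm (res (m k) (W k))) \<in> o(m)"
  using stageD(4,5) by (rule landau_o.big_small_trans)

text \<open>
  By \<open>local_bounds\<close> the distance is comparable to \<open>norm (Psi (W k))\<close>, whose main term is \<open>m k\<close> times the identity.
\<close>

lemma stage_dist: "(\<lambda>k. norm (W k - ws)) \<in> O(m)" "m \<in> O(\<lambda>k. norm (W k - ws))"
proof -
  obtain \<rho> \<kappa> K where b: "0 < \<rho>" "0 < \<kappa>" "0 \<le> K"
    "\<And>w. w \<in> cball ws \<rho> \<Longrightarrow> norm (Psi w) \<le> K * norm (w - ws)"
    "\<And>w. w \<in> cball ws \<rho> \<Longrightarrow> symm (VV w) \<Longrightarrow> \<kappa> * norm (w - ws) \<le> norm (Psi w)"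
    by (rule local_bounds) blast
  let ?n = "norm (mat 1 :: ((real, 'm) vec, 'm) vec)"
  have s: "\<forall>\<^sub>F k in sequentially. norm (res (m k) (W k)) \<le> (?n / 2) * norm (m k)"
    using landau_o.smallD[OF stage_res_small, of "?n / 2"] norm_mat1_pos by simp
  have 1: "\<forall>\<^sub>F k in sequentially. norm (norm (W k - ws)) \<le> (2 * ?n / \<kappa>) * norm (m k)"
    using s stageD(1) eventually_cball[OF stageD(2) b(1)]
  proof eventually_elim
    case (elim k)
    have "\<kappa> * norm (W k - ws) \<le> norm (Psi (W k))" using b(5) elim by blast
    also have "\<dots> \<le> norm (res (m k) (W k)) + norm (central_value (m k))"
      using norm_triangle_ineq[of "res (m k) (W k)" "central_value (m k)"] by (simp add: res_def)
    also have "\<dots> \<le> 2 * ?n * m k"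
      using elim mult_pos_pos[OF norm_mat1_pos, of "m k"] by (simp add: norm_central_value mult.commute)
    finally show ?case using b(2) elim by (simp add: field_simps)
  qed
  then show "(\<lambda>k. norm (W k - ws)) \<in> O(m)" by (rule bigoI)
  have 2: "\<forall>\<^sub>F k in sequentially. norm (m k) \<le> (2 * K / ?n) * norm (norm (W k - ws))"
    using s stageD(1) eventually_cball[OF stageD(2) b(1)]
  proof eventually_elim
    case (elim k)
    have "m k * ?n = norm (central_value (m k))" using elim by (simp add: norm_central_value)
    also have "\<dots> \<le> norm (Psi (W k)) + norm (res (m k) (W k))"
      using norm_triangle_ineq4[of "Psi (W k)" "res (m k) (W k)"] by (simp add: res_def)
    also have "\<dots> \<le> K * norm (W k - ws) + m k * ?n / 2" using b(4)[of "W k"] elim by (simp add: mult.commute)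
    finally show ?case using norm_mat1_pos elim by (simp add: field_simps)
  qed
  then show "m \<in> O(\<lambda>k. norm (W k - ws))" by (rule bigoI)
qed

lemma stage_posdef:
  obtains b where "0 < b" "\<forall>\<^sub>F k in sequentially. posdef (FF (W k)) \<and> posdef (VV (W k)) \<and> coercive (b * m k) (FF (W k))"
proof -
  define B where "B = norm Vs + 1"
  have B: "0 < B" by (simp add: B_def add_nonneg_pos)
  have V: "(\<lambda>k. VV (W k)) \<longlonglongrightarrow> Vs" using tendsto_snd[OF tendsto_snd[OF stageD(2)]] by simp
  have F: "(\<lambda>k. FF (W k)) \<longlonglongrightarrow> Fmap P xs"
    unfolding Fmap_def using tendsto_fst[OF stageD(2)]
    by (intro tendsto_intros bounded_linear.tendsto[OF bounded_linear_Flin]) simp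
  have S: "(\<lambda>k. FF (W k) + VV (W k)) \<longlonglongrightarrow> Fmap P xs + Vs" by (intro tendsto_intros F V)
  have s: "\<forall>\<^sub>F k in sequentially. norm (res (m k) (W k)) \<le> (1 / 2) * norm (m k)"
    using landau_o.smallD[OF stage_res_small, of "1/2"] by simp
  have c2: "0 < c / 2" using c by simp
  have "\<forall>\<^sub>F k in sequentially. posdef (FF (W k)) \<and> posdef (VV (W k)) \<and> coercive ((1 / (2 * B)) * m k) (FF (W k))"
    using s stageD(1) tendstoD[OF S c2] tendstoD[OF V zero_less_one]
  proof eventually_elim
    case (elim k)
    let ?F = "FF (W k)" and ?V = "VV (W k)"
    have sV: "symm ?V" and mk: "0 < m k" using elim by auto
    have sF: "symm ?F" by (rule symm_FF)
    have "norm (m k *\<^sub>R mat 1 - sprod ?F ?V) \<le> m k / 2"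
      using third_le[of "W k" "m k"] elim by (simp add: norm_minus_commute)
    from coercive_perturb[OF coercive_mat1 this]
    have cs: "coercive (m k / 2) (sprod ?F ?V)" by simp
    have ps: "posdef (sprod ?F ?V)"
      by (rule coercive_posdef[OF cs]) (use mk sF sV in auto)
    have "coercive (c - c / 2) (?F + ?V)"
      by (rule coercive_perturb[OF coerc]) (use elim in \<open>simp add: dist_norm norm_minus_commute\<close>)
    then have pS: "posdef (?F + ?V)" by (rule coercive_posdef) (use c sF sV in auto)
    have pF: "posdef ?F" by (rule posdef_of_sprod[OF sF sV pS ps])
    have pV: "posdef ?V" by (rule posdef_of_sprod[OF sV sF]) (use pS ps in \<open>simp_all add: add.commute sprod_commute\<close>)
    have "norm ?V \<le> B"
      using elim norm_triangle_ineq2[of ?V Vs] by (simp add: B_def dist_norm)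
    from coercive_of_sprod[OF posdef_psd[OF pF] posdef_psd[OF pV] cs _ this B] mk
    show ?case using pF pV by (simp add: mult.commute)
  qed
  with that[of "1 / (2 * B)"] B show ?thesis by simp
qed

lemma stage_block:
  obtains K L where "0 < K" "0 < L"
    "\<forall>\<^sub>F k in sequentially. norm (FF (W k) - Fmap P xs) \<le> K * m k"
    "\<forall>\<^sub>F k in sequentially. block_bounds L (m k) (FF (W k))"
proof -
  obtain b where b: "0 < b" and pd: "\<forall>\<^sub>F k in sequentially. posdef (FF (W k)) \<and> posdef (VV (W k)) \<and> coercive (b * m k) (FF (W k))"
    by (rule stage_posdef)
  obtain K0 where K0: "0 < K0" "\<And>w. norm (FF w - Fmap P xs) \<le> K0 * norm (w - ws)" by (rule Flin_dist) blast
  obtain K1 where K1: "0 < K1" "\<forall>\<^sub>F k in sequentially. norm (norm (W k - ws)) \<le> K1 * norm (m k)"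
    using landau_o.bigE[OF stage_dist(1)] by blast
  have near: "\<forall>\<^sub>F k in sequentially. norm (FF (W k) - Fmap P xs) \<le> (K0 * K1) * m k"
    using K1(2) stageD(1)
  proof eventually_elim
    case (elim k)
    have "norm (FF (W k) - Fmap P xs) \<le> K0 * norm (W k - ws)" by (rule K0)
    also have "\<dots> \<le> K0 * (K1 * m k)" using elim K0(1) by (intro mult_left_mono) auto
    finally show ?case by simp
  qed
  have K: "0 < K0 * K1" using K0 K1 by simp
  obtain L where L: "0 < L"
    "\<And>F Z m s. \<lbrakk>0 < m; symm F; norm (F - Fmap P xs) \<le> K0 * K1 * m; coercive (b * m) F; transpose Z = s *\<^sub>R Z; \<bar>s\<bar> = 1\<rbrakk>
       \<Longrightarrow> norm (Z ** Q) \<le> L * (norm (sprod F Z ** Q) + norm (Q ** sprod F Z ** Q) / m + m * norm Z)"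
    "\<And>F Z m s. \<lbrakk>0 < m; m \<le> 1 / L; symm F; norm (F - Fmap P xs) \<le> K0 * K1 * m; coercive (b * m) F; transpose Z = s *\<^sub>R Z; \<bar>s\<bar> = 1\<rbrakk>
       \<Longrightarrow> norm Z \<le> L * (norm (sprod F Z) + norm (Q ** sprod F Z ** Q) / m)"
    by (rule lyapunov_block_estimates[OF b less_imp_le[OF K]]) blast
  have "0 < 1 / L" using L(1) by simp
  then have mL: "\<forall>\<^sub>F k in sequentially. m k < 1 / L" using stageD(3) by (rule order_tendstoD(2)[rotated])
  have "\<forall>\<^sub>F k in sequentially. block_bounds L (m k) (FF (W k))"
    using mL near pd stageD(1)
  proof eventually_elim
    case (elim k)
    show ?case unfolding block_bounds_def using L(2)[of "m k" "FF (W k)"] L(3)[of "m k" "FF (W k)"] elim symm_FF(1) by auto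
  qed
  with that[OF K L(1) near] show ?thesis by blast
qed

text \<open>
  By \<open>sprod_commutator_self\<close> the commutator \<open>C\<close> solves \<open>F \<circ> C = [F, E]\<close>, where \<open>E\<close> is the deviation of
  \<open>F \<circ> V\<close> from the central path. As \<open>Q F\<close> and \<open>F Q\<close> are \<open>O(m)\<close>, the amplification \<open>1/m\<close> of the kernel
  block is compensated.
\<close>

lemma stage_commutator: "(\<lambda>k. norm (commutator (FF (W k)) (VV (W k)))) \<in> O(e)"
proof -
  obtain K L where KL: "0 < K" "0 < L" "\<forall>\<^sub>F k in sequentially. norm (FF (W k) - Fmap P xs) \<le> K * m k"
    "\<forall>\<^sub>F k in sequentially. block_bounds L (m k) (FF (W k))"
    by (rule stage_block)
  let ?B = "norm (Fmap P xs) + K"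
  have m1: "\<forall>\<^sub>F k in sequentially. m k < 1" using stageD(3) by (rule order_tendstoD(2)) simp
  have "\<forall>\<^sub>F k in sequentially. norm (norm (commutator (FF (W k)) (VV (W k)))) \<le> (L * (2 * ?B + 2 * K)) * norm (norm (res (m k) (W k)))"
    using KL(3,4) m1 stageD(1)
  proof eventually_elim
    case (elim k)
    let ?F = "FF (W k)" and ?V = "VV (W k)"
    let ?C = "commutator ?F ?V" and ?E = "sprod ?F ?V - m k *\<^sub>R mat 1" and ?r = "norm (res (m k) (W k))"
    have E: "norm ?E \<le> ?r" by (rule third_le)
    have mk: "0 < m k" using elim by simp
    have "K * m k \<le> K" using elim KL(1) by simp
    then have F: "norm ?F \<le> ?B" using elim norm_triangle_ineq2[of ?F "Fmap P xs"] by linarith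
    have C: "sprod ?F ?C = commutator ?F ?E" by (rule sprod_commutator_self)
    have t: "transpose ?C = (-1) *\<^sub>R ?C" using transpose_commutator[OF symm_FF(1)] elim by simp
    have 1: "norm (commutator ?F ?E) \<le> 2 * (?B * ?r)"
    proof -
      have "norm ?F * norm ?E \<le> ?B * ?r" using F E KL(1) by (intro mult_mono) (auto intro: add_nonneg_nonneg)
      then show ?thesis using norm_commutator_le[of ?F ?E] by linarith
    qed
    have 2: "norm (Q ** commutator ?F ?E ** Q) \<le> 2 * K * ?r * m k"
    proof -
      have eq: "Q ** commutator ?F ?E ** Q = (Q ** ?F) ** (?E ** Q) - (Q ** ?E) ** (?F ** Q)"
        unfolding commutator_def by (simp only: mat_algebra)
      have a: "norm (Q ** ?F) \<le> K * m k" "norm (?F ** Q) \<le> K * m k"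
        using norm_QF_le[of ?F] norm_FQ_le[of ?F] elim(1) by linarith+
      have b: "norm (?E ** Q) \<le> ?r" "norm (Q ** ?E) \<le> ?r"
        using norm_Q_right[of ?E] norm_Q_left[of ?E] E by linarith+
      have "norm ((Q ** ?F) ** (?E ** Q)) \<le> (K * m k) * ?r"
        by (rule order_trans[OF norm_matrix_mult_le mult_mono[OF a(1) b(1)]]) (use mk KL(1) in auto)
      moreover have "norm ((Q ** ?E) ** (?F ** Q)) \<le> ?r * (K * m k)"
        by (rule order_trans[OF norm_matrix_mult_le mult_mono[OF b(2) a(2)]]) (use mk KL(1) in auto)
      ultimately show ?thesis
        unfolding eq using norm_triangle_ineq4[of "(Q ** ?F) ** (?E ** Q)" "(Q ** ?E) ** (?F ** Q)"]
        by (simp add: algebra_simps)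
    qed
    then have 3: "norm (Q ** commutator ?F ?E ** Q) / m k \<le> 2 * K * ?r" using mk by (simp add: field_simps)
    have "norm ?C \<le> L * (norm (sprod ?F ?C) + norm (Q ** sprod ?F ?C ** Q) / m k)"
      using block_boundsD(2)[OF elim(2) t] by simp
    also have "\<dots> \<le> L * (2 * (?B * ?r) + 2 * K * ?r)"
      unfolding C using 1 3 KL(2) by (intro mult_left_mono add_mono) auto
    finally show ?case by (simp add: algebra_simps)
  qed
  then have "(\<lambda>k. norm (commutator (FF (W k)) (VV (W k)))) \<in> O(\<lambda>k. norm (res (m k) (W k)))" by (rule bigoI)
  then show ?thesis using stageD(4) by (rule landau_o.big_trans)
qed

end

end

section \<open>Newton directions\<close>

lemma bigo_dominated:
  fixes a b :: "nat \<Rightarrow> real"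
  assumes "\<forall>\<^sub>F k in sequentially. \<bar>a k\<bar> \<le> C * b k" "b \<in> O(g)" shows "a \<in> O(g)"
proof -
  have "\<forall>\<^sub>F k in sequentially. norm (a k) \<le> \<bar>C\<bar> * norm (b k)"
    using assms(1) by (rule eventually_mono) (simp add: abs_mult[symmetric])
  then have "a \<in> O(b)" by (rule bigoI)
  then show ?thesis using assms(2) by (rule landau_o.big_trans)
qed

lemma smallo_dominated:
  fixes a b :: "nat \<Rightarrow> real"
  assumes "\<forall>\<^sub>F k in sequentially. \<bar>a k\<bar> \<le> C * b k" "b \<in> o(g)" shows "a \<in> o(g)"
  using landau_o.big_small_trans[OF bigo_dominated[OF assms(1) landau_o.big_refl] assms(2)] .

context limit_point
begin

definition pert_at :: "('n, 'm, 'p) vpoint \<Rightarrow> ('n, 'm, 'p) vpoint \<Rightarrow> ((real, 'm) vec, 'm) vec" where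
  "pert_at w d = pert (FF w) (VV w) (Flin P (fst d))"

definition third_component :: "((real, 'm) vec, 'm) vec \<Rightarrow> ('n, 'm, 'p) vpoint" where
  "third_component A = (0, 0, A)"

text \<open>
  Both half steps use such a direction, see \<open>step21_imp_direction\<close> and \<open>step22_direction\<close>.
\<close>

definition direction :: "real \<Rightarrow> ('n, 'm, 'p) vpoint \<Rightarrow> ('n, 'm, 'p) vpoint \<Rightarrow> bool" where
  "direction \<mu> w d \<longleftrightarrow> symm (VV d) \<and> Psi w + DPsi w d = central_value \<mu> - third_component (pert_at w d)"

lemma norm_third_component: "norm (third_component A) = norm A" by (simp add: third_component_def)

lemma linear_third_component: "linear third_component" by (rule linearI) (simp_all add: third_component_def)

lemma bilinear_commutator: "bounded_bilinear (commutator :: real^'k^'k::finite \<Rightarrow> real^'k^'k \<Rightarrow> real^'k^'k)"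
  unfolding commutator_def
proof (rule bounded_bilinear.intro)
  show "\<exists>K. \<forall>A B :: real^'k^'k. norm (A ** B - B ** A) \<le> norm A * norm B * K"
  proof (intro exI[of _ 2] allI)
    show "norm (A ** B - B ** A) \<le> norm A * norm B * 2" for A B :: "real^'k^'k"
      using norm_commutator_le[of A B] unfolding commutator_def by simp
  qed
qed (simp_all add: mat_algebra algebra_simps)

lemma transpose_commutator_skew:
  assumes "transpose C = - C" "symm Z" shows "symm (commutator C Z)"
  unfolding symm_def commutator_def transpose_diff matrix_transpose_mul assms(1) symmD[OF assms(2)]
  by (simp add: matmul.minus_left matmul.minus_right)

lemma norm_pert_le: "norm (pert F V D) \<le> norm (commutator F V) * norm (lyap_inv F D) / 4"
  using norm_commutator_le[of "commutator F V" "lyap_inv F D"] by (simp add: pert_def)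

context
  fixes W m e assumes st: "stage W m e"
begin

text \<open>
  The commutator is \<open>O(e)\<close> and the Lyapunov inverse has norm \<open>O(1/m)\<close>; as \<open>e = o(m)\<close>, the perturbation of the Newton operator tends to 0.
\<close>

lemma stage_pert:
  obtains K where "0 < K"
    "\<forall>\<^sub>F k in sequentially. \<forall>D. symm D \<longrightarrow> norm (lyap_inv (FF (W k)) D) \<le> K / m k * norm D"
    "\<forall>\<^sub>F k in sequentially. \<forall>d. norm (pert_at (W k) d) \<le> K * (e k / m k) * norm d"
proof -
  obtain K0 where K0: "0 < K0" "\<And>d. norm (Flin P (fst d)) \<le> K0 * norm (d :: ('n, 'm, 'p) vpoint)" by (rule Flin_dist) blast
  obtain K L where KL: "0 < K" "0 < L" "\<forall>\<^sub>F k in sequentially. norm (FF (W k) - Fmap P xs) \<le> K * m k"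
    "\<forall>\<^sub>F k in sequentially. block_bounds L (m k) (FF (W k))"
    by (rule stage_block[OF st])
  obtain b where pd: "\<forall>\<^sub>F k in sequentially. posdef (FF (W k)) \<and> posdef (VV (W k)) \<and> coercive (b * m k) (FF (W k))"
    by (rule stage_posdef[OF st])
  have m1: "\<forall>\<^sub>F k in sequentially. m k < 1" using stageD(3)[OF st] by (rule order_tendstoD(2)) simp
  obtain C where C: "0 < C" "\<forall>\<^sub>F k in sequentially. norm (norm (commutator (FF (W k)) (VV (W k)))) \<le> C * norm (e k)"
    using landau_o.bigE[OF stage_commutator[OF st]] by blast
  have 1: "\<forall>\<^sub>F k in sequentially. \<forall>D. symm D \<longrightarrow> norm (lyap_inv (FF (W k)) D) \<le> (2 * L) / m k * norm D"
    using KL(4) pd m1 stageD(1)[OF st]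
  proof eventually_elim
    case (elim k)
    show ?case
    proof (intro allI impI)
      fix D :: "((real, 'm) vec, 'm) vec" assume D: "symm D"
      let ?Z = "lyap_inv (FF (W k)) D"
      have "posdef (FF (W k))" using elim by blast
      note Z = lyap_inv[OF this D]
      have mk: "0 < m k" "m k < 1" using elim by auto
      have "norm ?Z \<le> L * (norm D + norm (Q ** D ** Q) / m k)"
        using block_boundsD(2)[OF elim(1), of ?Z 1] Z by (simp add: symm_def)
      also have "\<dots> \<le> L * (norm D / m k + norm D / m k)"
      proof (intro mult_left_mono add_mono)
        have "norm D * m k \<le> norm D" using mk by (simp add: mult_left_le)
        then show "norm D \<le> norm D / m k" using mk by (simp add: pos_le_divide_eq)
        show "norm (Q ** D ** Q) / m k \<le> norm D / m k"
          using norm_kernel_compression_le[of D] mk by (simp add: divide_right_mono)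
      qed (use KL(2) in simp)
      also have "\<dots> = (2 * L) / m k * norm D" by (simp add: field_simps)
      finally show "norm ?Z \<le> (2 * L) / m k * norm D" .
    qed
  qed
  have 2: "\<forall>\<^sub>F k in sequentially. \<forall>d. norm (pert_at (W k) d) \<le> (C * L * K0 / 2) * (e k / m k) * norm d"
    using 1 C(2) stageD(1)[OF st]
  proof eventually_elim
    case (elim k)
    show ?case
    proof
      fix d :: "('n, 'm, 'p) vpoint"
      let ?D = "Flin P (fst d)" and ?F = "FF (W k)" and ?V = "VV (W k)"
      have mk: "0 < m k" and ek: "0 < e k" using elim by auto
      have "norm (lyap_inv ?F ?D) \<le> (2 * L) / m k * norm ?D"
        using elim(1)[rule_format, OF symm_FF(2)] .
      also have "\<dots> \<le> (2 * L) / m k * (K0 * norm d)"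
        using KL(2) mk by (intro mult_left_mono K0) auto
      finally have l: "norm (lyap_inv ?F ?D) \<le> (2 * L) / m k * (K0 * norm d)" .
      have "norm (commutator ?F ?V) * norm (lyap_inv ?F ?D) \<le> (C * e k) * ((2 * L) / m k * (K0 * norm d))"
        using elim(2) ek C(1) by (intro mult_mono l) auto
      then show "norm (pert_at (W k) d) \<le> (C * L * K0 / 2) * (e k / m k) * norm d"
      proof -
        assume a: "norm (commutator ?F ?V) * norm (lyap_inv ?F ?D) \<le> (C * e k) * ((2 * L) / m k * (K0 * norm d))"
        have "(C * e k) * ((2 * L) / m k * (K0 * norm d)) / 4 = (C * L * K0 / 2) * (e k / m k) * norm d"
          by (simp add: field_simps)
        with order_trans[OF norm_pert_le[of ?F ?V ?D] divide_right_mono[OF a, of 4]]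
        show ?thesis unfolding pert_at_def by (simp only:)
      qed
    qed
  qed
  let ?K = "max (2 * L) (C * L * K0 / 2)"
  show ?thesis
  proof (rule that[of ?K])
    show "0 < ?K" using KL(2) by simp
    show "\<forall>\<^sub>F k in sequentially. \<forall>D. symm D \<longrightarrow> norm (lyap_inv (FF (W k)) D) \<le> ?K / m k * norm D"
      using 1 stageD(1)[OF st]
    proof eventually_elim
      case (elim k)
      show ?case
      proof (intro allI impI)
        fix D :: "((real, 'm) vec, 'm) vec" assume "symm D"
        then have "norm (lyap_inv (FF (W k)) D) \<le> (2 * L) / m k * norm D" using elim(1) by blast
        also have "\<dots> \<le> ?K / m k * norm D"
          using elim(2) by (intro mult_right_mono divide_right_mono) auto
        finally show "norm (lyap_inv (FF (W k)) D) \<le> ?K / m k * norm D" .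
      qed
    qed
    show "\<forall>\<^sub>F k in sequentially. \<forall>d. norm (pert_at (W k) d) \<le> ?K * (e k / m k) * norm d"
      using 2 stageD(1)[OF st]
    proof eventually_elim
      case (elim k)
      show ?case
      proof
        fix d :: "('n, 'm, 'p) vpoint"
        have "norm (pert_at (W k) d) \<le> (C * L * K0 / 2) * (e k / m k) * norm d" using elim(1) by blast
        also have "\<dots> \<le> ?K * (e k / m k) * norm d"
          using elim(2) by (intro mult_right_mono) auto
        finally show "norm (pert_at (W k) d) \<le> ?K * (e k / m k) * norm d" .
      qed
    qed
  qed
qed

lemma stage_ratio:
  assumes "0 < a" shows "\<forall>\<^sub>F k in sequentially. e k / m k \<le> a"
  using landau_o.smallD[OF stageD(5)[OF st] assms] stageD(1)[OF st]
  by eventually_elim (simp add: field_simps)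

lemma stage_nonsingular:
  obtains \<kappa> where "0 < \<kappa>"
    "\<forall>\<^sub>F k in sequentially. \<forall>h. symm (VV h) \<longrightarrow> \<kappa> * norm h \<le> norm (DPsi (W k) h + third_component (pert_at (W k) h))"
proof -
  obtain \<rho> \<kappa> where b: "0 < \<rho>" "0 < \<kappa>"
    "\<And>w h. w \<in> cball ws \<rho> \<Longrightarrow> symm (VV h) \<Longrightarrow> \<kappa> * norm h \<le> norm (DPsi w h)"
    by (rule local_bounds) blast
  obtain K where K: "0 < K" "\<forall>\<^sub>F k in sequentially. \<forall>d. norm (pert_at (W k) d) \<le> K * (e k / m k) * norm d"
    by (rule stage_pert)
  have "0 < \<kappa> / (2 * K)" using b K by simp
  from stage_ratio[OF this] eventually_cball[OF stageD(2)[OF st] b(1)] K(2)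
  have "\<forall>\<^sub>F k in sequentially. \<forall>h. symm (VV h) \<longrightarrow> (\<kappa> / 2) * norm h \<le> norm (DPsi (W k) h + third_component (pert_at (W k) h))"
  proof eventually_elim
    case (elim k)
    show ?case
    proof (intro allI impI)
      fix h :: "('n, 'm, 'p) vpoint" assume h: "symm (VV h)"
      have "K * (e k / m k) \<le> \<kappa> / 2" using elim(1) K(1) by (simp add: field_simps)
      then have "K * (e k / m k) * norm h \<le> \<kappa> / 2 * norm h" by (rule mult_right_mono) simp
      then have "norm (pert_at (W k) h) \<le> \<kappa> / 2 * norm h" by (rule order_trans[OF spec[OF elim(3)]])
      moreover have "\<kappa> * norm h \<le> norm (DPsi (W k) h)" by (rule b(3)[OF elim(2) h])
      ultimately show "(\<kappa> / 2) * norm h \<le> norm (DPsi (W k) h + third_component (pert_at (W k) h))"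
        using norm_triangle_ineq2[of "DPsi (W k) h" "- third_component (pert_at (W k) h)"]
        by (simp add: norm_third_component)
    qed
  qed
  with that[of "\<kappa> / 2"] b(2) show ?thesis by simp
qed

lemma linear_pert_at: assumes "posdef (FF w)" shows "linear (pert_at w)"
proof -
  have l: "linear (\<lambda>h :: ('n, 'm, 'p) vpoint. lyap_inv (FF w) (Flin P (fst h)))"
  proof (rule linearI)
    fix h h' :: "('n, 'm, 'p) vpoint" and a :: real
    note z = lyap_inv[OF assms symm_FF(2)]
    note lf = bounded_linear.linear[OF bounded_linear_Flin[of P]]
    show "lyap_inv (FF w) (Flin P (fst (h + h'))) = lyap_inv (FF w) (Flin P (fst h)) + lyap_inv (FF w) (Flin P (fst h'))"
      using z by (intro lyap_inv_unique[OF assms]) (auto simp: sprod.add_right linear_add[OF lf])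
    show "lyap_inv (FF w) (Flin P (fst (a *\<^sub>R h))) = a *\<^sub>R lyap_inv (FF w) (Flin P (fst h))"
      using z by (intro lyap_inv_unique[OF assms]) (auto simp: sprod.scaleR_right linear_cmul[OF lf])
  qed
  show ?thesis
    by (rule linearI) (simp_all only: pert_at_def pert_def linear_add[OF l] linear_cmul[OF l]
        bounded_bilinear.add_right[OF bilinear_commutator] bounded_bilinear.scaleR_right[OF bilinear_commutator]
        scaleR_add_right scaleR_left_commute)
qed

lemma symm_pert_at: assumes "posdef (FF w)" "symm (VV w)" shows "symm (pert_at w d)"
  unfolding pert_at_def pert_def
  by (intro symm_simps transpose_commutator_skew transpose_commutator symm_FF assms lyap_inv(1))

text \<open>
  The perturbed Newton operator maps the triples with symmetric matrix part injectively into themselves.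
\<close>

lemma direction_exists: "\<forall>\<^sub>F k in sequentially. \<exists>d. direction (\<mu> k) (W k) d"
proof -
  obtain \<kappa> where k: "0 < \<kappa>"
    "\<forall>\<^sub>F k in sequentially. \<forall>h. symm (VV h) \<longrightarrow> \<kappa> * norm h \<le> norm (DPsi (W k) h + third_component (pert_at (W k) h))"
    by (rule stage_nonsingular)
  obtain \<rho> where b: "0 < \<rho>" "\<And>w. w \<in> cball ws \<rho> \<Longrightarrow> fst w \<in> U" by (rule local_bounds) blast
  obtain b where pd: "\<forall>\<^sub>F k in sequentially. posdef (FF (W k)) \<and> posdef (VV (W k)) \<and> coercive (b * m k) (FF (W k))"
    by (rule stage_posdef[OF st])
  show ?thesis
    using k(2) eventually_cball[OF stageD(2)[OF st] b(1)] pd stageD(1)[OF st]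
  proof eventually_elim
    case (elim k)
    let ?w = "W k"
    define M where "M h = DPsi ?w h + third_component (pert_at ?w h)" for h
    define S where "S = {h :: ('n, 'm, 'p) vpoint. symm (VV h)}"
    have pF: "posdef (FF ?w)" and sV: "symm (VV ?w)" using elim by auto
    have U: "fst ?w \<in> U" by (rule b(2)[OF elim(2)])
    have lD: "linear (DPsi ?w)"
      using has_derivative_linear[OF Psi_derivative[OF U, of "fst (snd ?w)" "VV ?w"]] by simp
    have lM: "linear M"
      unfolding M_def by (intro linear_compose_add lD linear_compose[OF linear_pert_at[OF pF] linear_third_component, unfolded o_def])
    have sub: "subspace S" by (auto simp: subspace_def S_def)
    have third: "VV (DPsi ?w h) = sprod (FF ?w) (VV h) + sprod (Flin P (fst h)) (VV ?w)" for h
      by (simp add: DPsi_def split_def)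
    have "M h \<in> S" if "h \<in> S" for h
    proof -
      have "VV (M h) = sprod (FF ?w) (VV h) + sprod (Flin P (fst h)) (VV ?w) + pert_at ?w h"
        by (simp add: M_def third third_component_def)
      moreover have "symm (VV h)" using that by (simp add: S_def)
      ultimately show ?thesis unfolding S_def mem_Collect_eq
        by (simp only:) (intro symm_simps symm_FF sV symm_pert_at pF)
    qed
    then have 1: "M ` S \<subseteq> S" by blast
    have 2: "h = 0" if "h \<in> S" "M h = 0" for h
    proof -
      have "symm (VV h)" using that(1) by (simp add: S_def)
      then have "\<kappa> * norm h \<le> norm (M h)" using elim(1) unfolding M_def by blast
      then show ?thesis using k(1) that(2) by (simp add: mult_le_0_iff)
    qed
    have MS: "M ` S = S" by (rule injective_endomorphism_surjective[OF sub lM 1 2])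
    have "VV (central_value (\<mu> k) - Psi ?w) = \<mu> k *\<^sub>R mat 1 - sprod (FF ?w) (VV ?w)"
      by (simp add: Psi_def split_def central_value_def)
    moreover have "symm (\<mu> k *\<^sub>R mat 1 - sprod (FF ?w) (VV ?w))"
      by (intro symm_simps symm_FF sV)
    ultimately have "central_value (\<mu> k) - Psi ?w \<in> M ` S" unfolding MS by (simp add: S_def)
    then obtain d where d: "central_value (\<mu> k) - Psi ?w = M d" "d \<in> S" by (rule imageE)
    have "Psi ?w + DPsi ?w d = central_value (\<mu> k) - third_component (pert_at ?w d)"
      using d(1) unfolding M_def by (simp add: diff_eq_eq eq_diff_eq ac_simps)
    then show ?case using d(2) unfolding direction_def S_def by blast
  qed
qed

context
  fixes \<mu> D
  assumes dir: "\<forall>\<^sub>F k in sequentially. direction (\<mu> k) (W k) (D k)"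
    and r0: "(\<lambda>k. norm (res (\<mu> k) (W k))) \<longlonglongrightarrow> 0"
begin

lemma direction_size: "(\<lambda>k. norm (D k)) \<in> O(\<lambda>k. norm (res (\<mu> k) (W k)))"
proof -
  obtain \<kappa> where k: "0 < \<kappa>"
    "\<forall>\<^sub>F k in sequentially. \<forall>h. symm (VV h) \<longrightarrow> \<kappa> * norm h \<le> norm (DPsi (W k) h + third_component (pert_at (W k) h))"
    by (rule stage_nonsingular)
  have "\<forall>\<^sub>F k in sequentially. norm (norm (D k)) \<le> (1 / \<kappa>) * norm (norm (res (\<mu> k) (W k)))"
    using k(2) dir
  proof eventually_elim
    case (elim k)
    have "DPsi (W k) (D k) + third_component (pert_at (W k) (D k)) = - res (\<mu> k) (W k)"
      using elim(2) unfolding direction_def res_def by (simp add: eq_diff_eq ac_simps)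
    then have "\<kappa> * norm (D k) \<le> norm (res (\<mu> k) (W k))"
      using elim(1)[rule_format, of "D k"] elim(2) unfolding direction_def by simp
    then show ?case using k(1) by (simp add: field_simps)
  qed
  then show ?thesis by (rule bigoI)
qed

lemma direction_tendsto: "D \<longlonglongrightarrow> 0" "(\<lambda>k. W k + D k) \<longlonglongrightarrow> ws"
proof -
  obtain C where C: "\<forall>\<^sub>F k in sequentially. norm (norm (D k)) \<le> C * norm (norm (res (\<mu> k) (W k)))"
    using landau_o.bigE[OF direction_size] by blast
  have "(\<lambda>k. norm (D k)) \<longlonglongrightarrow> 0"
    by (rule Lim_null_comparison[OF C]) (use tendsto_mult_right_zero[OF r0, of C] in simp)
  then show D: "D \<longlonglongrightarrow> 0" by (rule tendsto_norm_zero_cancel)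
  show "(\<lambda>k. W k + D k) \<longlonglongrightarrow> ws" using tendsto_add[OF stageD(2)[OF st] D] by simp
qed

text \<open>
  After a full step the perturbation and a quadratic remainder are left.
\<close>

lemma direction_residual:
  "(\<lambda>k. norm (res (\<mu> k) (W k + D k) + third_component (pert_at (W k) (D k)))) \<in> O(\<lambda>k. (norm (D k))\<^sup>2)"
proof -
  obtain \<rho> K where b: "0 < \<rho>"
    "\<And>w d. w \<in> cball ws \<rho> \<Longrightarrow> w + d \<in> cball ws \<rho> \<Longrightarrow> norm (Psi (w + d) - Psi w - DPsi w d) \<le> K * (norm d)\<^sup>2"
    by (rule local_bounds) blast
  have "\<forall>\<^sub>F k in sequentially. norm (norm (res (\<mu> k) (W k + D k) + third_component (pert_at (W k) (D k)))) \<le> K * norm ((norm (D k))\<^sup>2)"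
    using dir eventually_cball[OF stageD(2)[OF st] b(1)] eventually_cball[OF direction_tendsto(2) b(1)]
  proof eventually_elim
    case (elim k)
    have "res (\<mu> k) (W k + D k) + third_component (pert_at (W k) (D k)) = Psi (W k + D k) - (Psi (W k) + DPsi (W k) (D k))"
      using elim(1) unfolding direction_def res_def by simp
    then show ?case using b(2)[OF elim(2,3)] by (simp add: diff_diff_eq)
  qed
  then show ?thesis by (rule bigoI)
qed

lemma direction_third:
  "\<forall>\<^sub>F k in sequentially. sprod (FF (W k)) (VV (W k)) + sprod (FF (W k)) (VV (D k)) + sprod (Flin P (fst (D k))) (VV (W k))
     = \<mu> k *\<^sub>R mat 1 - pert_at (W k) (D k)"
  using dir
proof eventually_elim
  case (elim k)
  have "VV (Psi (W k) + DPsi (W k) (D k)) = \<mu> k *\<^sub>R mat 1 - pert_at (W k) (D k)"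
    using elim unfolding direction_def by (simp add: central_value_def third_component_def)
  then show ?case by (simp add: Psi_def DPsi_def split_def add.assoc)
qed

end

end

end

section \<open>Two consecutive Newton directions\<close>

lemma smallo_1_of_tendsto:
  fixes a :: "nat \<Rightarrow> real"
  assumes "a \<longlonglongrightarrow> 0" shows "a \<in> o(\<lambda>_. 1)"
  using assms by (intro smalloI_tendsto) auto

lemma tendsto_of_smallo:
  fixes a b :: "nat \<Rightarrow> real"
  assumes "a \<in> o(b)" "b \<longlonglongrightarrow> 0" shows "a \<longlonglongrightarrow> 0"
proof -
  have "\<forall>\<^sub>F k in sequentially. norm (a k) \<le> 1 * norm (b k)" using landau_o.smallD[OF assms(1), of 1] by simp
  then show ?thesis by (rule Lim_null_comparison) (use tendsto_norm_zero[OF assms(2)] in simp)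
qed

lemma bigo_times_smallo_1:
  fixes a b g :: "nat \<Rightarrow> real"
  assumes "a \<in> O(g)" "b \<in> o(\<lambda>_. 1)"
  shows "(\<lambda>k. a k * b k) \<in> o(g)" "(\<lambda>k. b k * a k) \<in> o(g)"
  using landau_o.big_small_mult[OF assms] landau_o.small_big_mult[OF assms(2,1)] by simp_all

context limit_point
begin

text \<open>
  If \<open>F \<circ> Z\<close> is \<open>o(m)\<close> on the kernel of the limit, then \<open>Z\<close> tends to 0 there.
\<close>

lemma stage_Q_block:
  fixes Z :: "nat \<Rightarrow> ((real, 'm) vec, 'm) vec"
  assumes st: "stage W m e" and Z: "\<forall>\<^sub>F k in sequentially. symm (Z k)"
    and D: "\<forall>\<^sub>F k in sequentially. norm (sprod (FF (W k)) (Z k) ** Q) \<le> a k"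
    and a: "a \<in> o(m)" and mZ: "(\<lambda>k. m k * norm (Z k)) \<in> o(\<lambda>_. 1)"
  shows "(\<lambda>k. norm (Z k ** Q)) \<in> o(\<lambda>_. 1)"
proof -
  obtain K L where KL: "0 < K" "0 < L" "\<forall>\<^sub>F k in sequentially. norm (FF (W k) - Fmap P xs) \<le> K * m k"
    "\<forall>\<^sub>F k in sequentially. block_bounds L (m k) (FF (W k))"
    by (rule stage_block[OF st])
  have "\<forall>\<^sub>F k in sequentially. \<bar>norm (Z k ** Q)\<bar> \<le> L * (a k + a k / m k + m k * norm (Z k))"
    using KL(4) Z D stageD(1)[OF st]
  proof eventually_elim
    case (elim k)
    have mk: "0 < m k" using elim by simp
    have q: "norm (Q ** sprod (FF (W k)) (Z k) ** Q) \<le> a k"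
      using norm_Q_left[of "sprod (FF (W k)) (Z k) ** Q"] elim(3) by (simp add: matrix_mul_assoc)
    have "norm (Z k ** Q) \<le> L * (norm (sprod (FF (W k)) (Z k) ** Q) + norm (Q ** sprod (FF (W k)) (Z k) ** Q) / m k + m k * norm (Z k))"
      using block_boundsD(1)[OF elim(1), of "Z k" 1] elim(2) by (simp add: symm_def)
    also have "\<dots> \<le> L * (a k + a k / m k + m k * norm (Z k))"
      using KL(2) elim(3) q mk by (intro mult_left_mono add_mono divide_right_mono) auto
    finally show ?case by simp
  qed
  moreover have "(\<lambda>k. a k + a k / m k + m k * norm (Z k)) \<in> o(\<lambda>_. 1)"
  proof (intro sum_in_smallo mZ)
    show "a \<in> o(\<lambda>_. 1)"
      by (rule smallo_1_of_tendsto) (rule tendsto_of_smallo[OF a stageD(3)[OF st]])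
    show "(\<lambda>k. a k / m k) \<in> o(\<lambda>_. 1)"
      by (rule smallo_1_of_tendsto) (rule smalloD_tendsto[OF a])
  qed
  ultimately show ?thesis by (rule smallo_dominated)
qed

lemma third_quadratic: "sprod (FF (w + d)) (VV (w + d)) =
    (sprod (FF w) (VV w) + sprod (FF w) (VV d) + sprod (Flin P (fst d)) (VV w)) + sprod (Flin P (fst d)) (VV d)"
  by (simp add: Fmap_add sprod.add_left sprod.add_right)

text \<open>
  The exponents of the algorithm enter through the three comparisons \<open>\<mu> = o(m)\<close>, \<open>e = o(\<mu>)\<close> and
  \<open>m\<^sup>2 = o(e)\<close>; the last one makes the quadratic remainder of the first direction negligible.
\<close>

context
  fixes W D1 :: "nat \<Rightarrow> ('n, 'm, 'p) vpoint" and m \<mu> e :: "nat \<Rightarrow> real"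
  assumes st: "stage W m e"
    and dir1: "\<forall>\<^sub>F k in sequentially. direction (\<mu> k) (W k) (D1 k)"
    and mupos: "\<forall>\<^sub>F k in sequentially. 0 < \<mu> k"
    and mu: "\<mu> \<in> o(m)" and emu: "e \<in> o(\<mu>)" and m2: "(\<lambda>k. (m k)\<^sup>2) \<in> o(e)"
begin

lemma first_residual: "(\<lambda>k. norm (res (\<mu> k) (W k))) \<in> O(m)" "(\<lambda>k. norm (res (\<mu> k) (W k))) \<longlonglongrightarrow> 0"
proof -
  let ?n = "norm (mat 1 :: ((real, 'm) vec, 'm) vec)"
  have "\<forall>\<^sub>F k in sequentially. \<bar>norm (res (\<mu> k) (W k))\<bar> \<le> 1 * (norm (res (m k) (W k)) + (m k * ?n + \<mu> k * ?n))"
    using stageD(1)[OF st] mupos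
  proof eventually_elim
    case (elim k)
    have "res (\<mu> k) (W k) = res (m k) (W k) + (central_value (m k) - central_value (\<mu> k))" by (simp add: res_def)
    then show ?case
      using norm_triangle_ineq[of "res (m k) (W k)" "central_value (m k) - central_value (\<mu> k)"]
        norm_triangle_ineq4[of "central_value (m k)" "central_value (\<mu> k)"] elim by (simp add: norm_central_value)
  qed
  moreover have "(\<lambda>k. norm (res (m k) (W k)) + (m k * ?n + \<mu> k * ?n)) \<in> O(m)"
    using stage_res_small[OF st] mu by (intro sum_in_bigo) (auto intro: landau_o.small_imp_big)
  ultimately show 1: "(\<lambda>k. norm (res (\<mu> k) (W k))) \<in> O(m)" by (rule bigo_dominated)
  obtain C where "\<forall>\<^sub>F k in sequentially. norm (norm (res (\<mu> k) (W k))) \<le> C * norm (m k)"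
    using landau_o.bigE[OF 1] by blast
  then show "(\<lambda>k. norm (res (\<mu> k) (W k))) \<longlonglongrightarrow> 0"
    by (rule Lim_null_comparison)
      (use tendsto_mult_right_zero[OF tendsto_norm_zero[OF stageD(3)[OF st]], of C] in simp)
qed

lemma first_direction_size: "(\<lambda>k. norm (D1 k)) \<in> O(m)"
  using direction_size[OF st dir1 first_residual(2)] first_residual(1) by (rule landau_o.big_trans)

lemma first_direction_square: "(\<lambda>k. (norm (D1 k))\<^sup>2) \<in> o(e)"
  using landau_o.big_small_trans[OF landau_o.big_power[OF first_direction_size, of 2] m2] by simp

lemma first_pert_size: "(\<lambda>k. norm (pert_at (W k) (D1 k))) \<in> O(e)"
proof -
  obtain K where K: "\<forall>\<^sub>F k in sequentially. \<forall>d. norm (pert_at (W k) d) \<le> K * (e k / m k) * norm d"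
    by (rule stage_pert[OF st])
  have "\<forall>\<^sub>F k in sequentially. \<bar>norm (pert_at (W k) (D1 k))\<bar> \<le> K * (e k / m k * norm (D1 k))"
    using K
  proof eventually_elim
    case (elim k) then show ?case using spec[OF elim, of "D1 k"] by (simp only: abs_norm_cancel mult.assoc)
  qed
  moreover have "(\<lambda>k. e k / m k * norm (D1 k)) \<in> O(\<lambda>k. e k / m k * m k)"
    by (rule landau_o.big.mult[OF landau_o.big_refl first_direction_size])
  then have "(\<lambda>k. e k / m k * norm (D1 k)) \<in> O(e)"
    by (rule landau_o.big_trans) (rule bigoI[of _ 1], use stageD(1)[OF st] in \<open>auto elim: eventually_mono\<close>)
  ultimately show ?thesis by (rule bigo_dominated)
qed

text \<open>
  After the first direction the residual is still \<open>O(e)\<close>, but it now refers to the smaller parameter \<open>\<mu>\<close>.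
\<close>

lemma half_stage: "stage (\<lambda>k. W k + D1 k) \<mu> e"
  unfolding stage_def
proof (intro conjI)
  show "\<forall>\<^sub>F k in sequentially. symm (VV (W k + D1 k)) \<and> 0 < \<mu> k \<and> 0 < e k"
    using stageD(1)[OF st] dir1 mupos by eventually_elim (auto simp: direction_def)
  show "(\<lambda>k. W k + D1 k) \<longlonglongrightarrow> ws" by (rule direction_tendsto(2)[OF st dir1 first_residual(2)])
  show "\<mu> \<longlonglongrightarrow> 0" by (rule tendsto_of_smallo[OF mu stageD(3)[OF st]])
  show "e \<in> o(\<mu>)" by (rule emu)
  have "\<forall>\<^sub>F k in sequentially. \<bar>norm (res (\<mu> k) (W k + D1 k))\<bar> \<le>
      1 * (norm (res (\<mu> k) (W k + D1 k) + third_component (pert_at (W k) (D1 k))) + norm (pert_at (W k) (D1 k)))"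
  proof (rule always_eventually, rule allI)
    fix k
    show "\<bar>norm (res (\<mu> k) (W k + D1 k))\<bar> \<le>
      1 * (norm (res (\<mu> k) (W k + D1 k) + third_component (pert_at (W k) (D1 k))) + norm (pert_at (W k) (D1 k)))"
      using norm_triangle_ineq4[of "res (\<mu> k) (W k + D1 k) + third_component (pert_at (W k) (D1 k))" "third_component (pert_at (W k) (D1 k))"]
      by (simp add: norm_third_component)
  qed
  moreover have "(\<lambda>k. norm (res (\<mu> k) (W k + D1 k) + third_component (pert_at (W k) (D1 k))) + norm (pert_at (W k) (D1 k))) \<in> O(e)"
    by (intro sum_in_bigo first_pert_size landau_o.big_trans[OF direction_residual[OF st dir1 first_residual(2)]]
        landau_o.small_imp_big[OF first_direction_square])
  ultimately show "(\<lambda>k. norm (res (\<mu> k) (W k + D1 k))) \<in> O(e)" by (rule bigo_dominated)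
qed

text \<open>
  With \<open>Z\<close> the Lyapunov preimage of the increment of \<open>F\<close>, the matrix \<open>Z + I\<close> is the preimage of the new \<open>F\<close>, which is
  \<open>O(\<mu>) = o(m)\<close> on the kernel; so \<open>(Z + I) Q\<close> tends to 0. Commutators do not see the identity, and in
  \<open>Q [C, Z + I] Q\<close> every term has a factor \<open>(Z + I) Q\<close> or its transpose.
\<close>

lemma half_kernel_block:
  "(\<lambda>k. norm (Q ** (sprod (FF (W k + D1 k)) (VV (W k + D1 k)) - \<mu> k *\<^sub>R mat 1) ** Q)) \<in> o(e)"
proof -
  let ?Z = "\<lambda>k. lyap_inv (FF (W k)) (Flin P (fst (D1 k)))"
  let ?C = "\<lambda>k. commutator (FF (W k)) (VV (W k))"
  obtain K where K: "0 < K" "\<And>w. norm (FF w - Fmap P xs) \<le> K * norm (w - ws)"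
    "\<And>d. norm (Flin P (fst d)) \<le> K * norm (d :: ('n, 'm, 'p) vpoint)" by (rule Flin_dist) blast
  obtain K1 where K1: "0 < K1"
    "\<forall>\<^sub>F k in sequentially. \<forall>D. symm D \<longrightarrow> norm (lyap_inv (FF (W k)) D) \<le> K1 / m k * norm D"
    by (rule stage_pert[OF st])
  obtain b where pd: "\<forall>\<^sub>F k in sequentially. posdef (FF (W k)) \<and> posdef (VV (W k)) \<and> coercive (b * m k) (FF (W k))"
    by (rule stage_posdef[OF st])
  have Zsym: "\<forall>\<^sub>F k in sequentially. symm (?Z k) \<and> sprod (FF (W k)) (?Z k) = Flin P (fst (D1 k))"
    using pd by eventually_elim (intro conjI lyap_inv symm_FF(2), simp_all)
  have ZQ: "(\<lambda>k. norm ((?Z k + mat 1) ** Q)) \<in> o(\<lambda>_. 1)"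
  proof (rule stage_Q_block[OF st])
    show "\<forall>\<^sub>F k in sequentially. symm (?Z k + mat 1)" using Zsym by eventually_elim auto
    show "\<forall>\<^sub>F k in sequentially. norm (sprod (FF (W k)) (?Z k + mat 1) ** Q) \<le> K * norm (W k + D1 k - ws)"
      using Zsym
    proof eventually_elim
      case (elim k)
      have "sprod (FF (W k)) (?Z k + mat 1) = Flin P (fst (D1 k)) + FF (W k)"
        using elim by (simp add: sprod.add_right)
      also have "\<dots> = FF (W k + D1 k)" by (simp add: Fmap_add)
      finally have "sprod (FF (W k)) (?Z k + mat 1) = FF (W k + D1 k)" .
      then show ?case using order_trans[OF norm_FQ_le K(2)[of "W k + D1 k"]] by simp
    qed
    show "(\<lambda>k. K * norm (W k + D1 k - ws)) \<in> o(m)"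
      using landau_o.big_small_trans[OF stage_dist(1)[OF half_stage] mu] by simp
    have "\<forall>\<^sub>F k in sequentially. \<bar>m k * norm (?Z k + mat 1)\<bar> \<le> 1 * (K1 * K * norm (D1 k) + m k * norm (mat 1 :: ((real, 'm) vec, 'm) vec))"
      using K1(2) stageD(1)[OF st]
    proof eventually_elim
      case (elim k)
      have mk: "0 < m k" using elim by simp
      have "norm (?Z k) \<le> K1 / m k * norm (Flin P (fst (D1 k)))" by (rule elim(1)[rule_format, OF symm_FF(2)])
      also have "\<dots> \<le> K1 / m k * (K * norm (D1 k))" using K1(1) mk by (intro mult_left_mono K(3)) auto
      finally have "m k * norm (?Z k) \<le> K1 * K * norm (D1 k)" using mk by (simp add: field_simps)
      moreover have "m k * norm (?Z k + mat 1) \<le> m k * (norm (?Z k) + norm (mat 1 :: ((real, 'm) vec, 'm) vec))"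
        using mk by (intro mult_left_mono norm_triangle_ineq) auto
      ultimately show ?case using mk by (simp add: abs_mult algebra_simps)
    qed
    note dom = this
    have "(\<lambda>k. K1 * K * norm (D1 k) + m k * norm (mat 1 :: ((real, 'm) vec, 'm) vec)) \<longlonglongrightarrow> K1 * K * 0 + 0 * norm (mat 1 :: ((real, 'm) vec, 'm) vec)"
      using tendsto_norm_zero[OF direction_tendsto(1)[OF st dir1 first_residual(2)]] stageD(3)[OF st] by (intro tendsto_intros)
    then have "(\<lambda>k. K1 * K * norm (D1 k) + m k * norm (mat 1 :: ((real, 'm) vec, 'm) vec)) \<in> o(\<lambda>_. 1)"
      by (intro smallo_1_of_tendsto) simp
    then show "(\<lambda>k. m k * norm (?Z k + mat 1)) \<in> o(\<lambda>_. 1)" by (rule smallo_dominated[OF dom])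
  qed
  have "\<forall>\<^sub>F k in sequentially. \<bar>norm (Q ** (sprod (FF (W k + D1 k)) (VV (W k + D1 k)) - \<mu> k *\<^sub>R mat 1) ** Q)\<bar>
      \<le> 1 * (norm (?C k) * norm ((?Z k + mat 1) ** Q) + K * (norm (D1 k))\<^sup>2)"
    using Zsym direction_third[OF st dir1 first_residual(2)]
  proof eventually_elim
    case (elim k)
    let ?Y = "?Z k + mat 1"
    have Ys: "transpose ?Y = ?Y" using elim by (simp add: symm_def transpose_add)
    have QY: "norm (Q ** ?Y) = norm (?Y ** Q)"
    proof -
      have "norm (Q ** ?Y) = norm (transpose (?Y ** Q))" by (simp only: matrix_transpose_mul symmD[OF symQ] Ys)
      then show ?thesis by (simp only: norm_transpose)
    qed
    have "commutator (?C k) ?Y = commutator (?C k) (?Z k)"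
      by (simp add: commutator_def[of "?C k"] matmul.add_left matmul.add_right)
    then have pwk: "pert_at (W k) (D1 k) = (1/8) *\<^sub>R commutator (?C k) ?Y" by (simp add: pert_at_def pert_def)
    have eq: "Q ** commutator (?C k) ?Y ** Q = Q ** ?C k ** (?Y ** Q) - (Q ** ?Y) ** (?C k ** Q)"
      by (simp only: commutator_def[of "?C k"] matmul.diff_left matmul.diff_right matrix_mul_assoc)
    have "norm (Q ** ?C k ** (?Y ** Q)) \<le> norm (?C k) * norm (?Y ** Q)"
      by (rule order_trans[OF norm_matrix_mult_le mult_right_mono[OF norm_Q_left]]) simp
    moreover have "norm ((Q ** ?Y) ** (?C k ** Q)) \<le> norm (?Y ** Q) * norm (?C k)"
      unfolding QY[symmetric] by (rule order_trans[OF norm_matrix_mult_le mult_left_mono[OF norm_Q_right]]) simp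
    ultimately have c: "norm (Q ** commutator (?C k) ?Y ** Q) \<le> 2 * (norm (?C k) * norm (?Y ** Q))"
      unfolding eq using norm_triangle_ineq4[of "Q ** ?C k ** (?Y ** Q)" "(Q ** ?Y) ** (?C k ** Q)"]
        mult.commute[of "norm (?Y ** Q)" "norm (?C k)"] by linarith
    have QpQ: "norm (Q ** pert_at (W k) (D1 k) ** Q) \<le> norm (?C k) * norm (?Y ** Q)"
      unfolding pwk matmul.scaleR_left matmul.scaleR_right norm_scaleR
    proof -
      have "\<bar>1 / 8 :: real\<bar> = 1 / 8" by simp
      then show "\<bar>1 / 8\<bar> * norm (Q ** commutator (?C k) ?Y ** Q) \<le> norm (?C k) * norm (?Y ** Q)"
        using c mult_nonneg_nonneg[OF norm_ge_zero[of "?C k"] norm_ge_zero[of "?Y ** Q"]]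
        by (simp only:)
    qed
    have "norm (Q ** sprod (Flin P (fst (D1 k))) (VV (D1 k)) ** Q) \<le> norm (Flin P (fst (D1 k))) * norm (VV (D1 k))"
      by (rule order_trans[OF norm_kernel_compression_le norm_sprod_le])
    also have "\<dots> \<le> (K * norm (D1 k)) * norm (D1 k)"
      using K(1) by (intro mult_mono K(3) norm_proj_le) auto
    finally have q: "norm (Q ** sprod (Flin P (fst (D1 k))) (VV (D1 k)) ** Q) \<le> K * (norm (D1 k))\<^sup>2"
      by (simp add: power2_eq_square mult.assoc)
    have "sprod (FF (W k + D1 k)) (VV (W k + D1 k)) - \<mu> k *\<^sub>R mat 1
        = sprod (Flin P (fst (D1 k))) (VV (D1 k)) - pert_at (W k) (D1 k)"
      unfolding third_quadratic elim(2) by simp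
    then have "Q ** (sprod (FF (W k + D1 k)) (VV (W k + D1 k)) - \<mu> k *\<^sub>R mat 1) ** Q
        = Q ** sprod (Flin P (fst (D1 k))) (VV (D1 k)) ** Q - Q ** pert_at (W k) (D1 k) ** Q"
      by (simp only: matmul.diff_left matmul.diff_right)
    then show ?case
      using QpQ q norm_triangle_ineq4[of "Q ** sprod (Flin P (fst (D1 k))) (VV (D1 k)) ** Q" "Q ** pert_at (W k) (D1 k) ** Q"]
      by simp
  qed
  moreover have "(\<lambda>k. norm (?C k) * norm ((?Z k + mat 1) ** Q) + K * (norm (D1 k))\<^sup>2) \<in> o(e)"
    using bigo_times_smallo_1(1)[OF stage_commutator[OF st] ZQ] first_direction_square by (intro sum_in_smallo) simp_all
  ultimately show ?thesis by (rule smallo_dominated)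
qed

context
  fixes D2 :: "nat \<Rightarrow> ('n, 'm, 'p) vpoint"
  assumes dir2: "\<forall>\<^sub>F k in sequentially. direction (\<mu> k) (W k + D1 k) (D2 k)"
begin

abbreviation "X k \<equiv> W k + D1 k"

lemma half_residual: "(\<lambda>k. norm (res (\<mu> k) (X k))) \<in> O(e)" "(\<lambda>k. norm (res (\<mu> k) (X k))) \<longlonglongrightarrow> 0"
proof -
  show "(\<lambda>k. norm (res (\<mu> k) (X k))) \<in> O(e)" by (rule stageD(4)[OF half_stage])
  show "(\<lambda>k. norm (res (\<mu> k) (X k))) \<longlonglongrightarrow> 0"
    by (rule tendsto_of_smallo[OF stage_res_small[OF half_stage] stageD(3)[OF half_stage]])
qed

lemma second_direction_size: "(\<lambda>k. norm (D2 k)) \<in> O(e)"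
  using direction_size[OF half_stage dir2 half_residual(2)] half_residual(1) by (rule landau_o.big_trans)

lemma ratio_small: "(\<lambda>k. e k / \<mu> k) \<in> o(\<lambda>_. 1)"
  by (rule smallo_1_of_tendsto) (rule smalloD_tendsto[OF emu])

lemma second_pert_small: "(\<lambda>k. norm (pert_at (X k) (D2 k))) \<in> o(e)"
proof -
  obtain K where K: "\<forall>\<^sub>F k in sequentially. \<forall>d. norm (pert_at (X k) d) \<le> K * (e k / \<mu> k) * norm d"
    by (rule stage_pert[OF half_stage])
  have "\<forall>\<^sub>F k in sequentially. \<bar>norm (pert_at (X k) (D2 k))\<bar> \<le> K * (e k / \<mu> k * norm (D2 k))"
    using K
  proof eventually_elim
    case (elim k) then show ?case using spec[OF elim, of "D2 k"] by (simp only: abs_norm_cancel mult.assoc)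
  qed
  then show ?thesis by (rule smallo_dominated) (rule bigo_times_smallo_1(2)[OF second_direction_size ratio_small])
qed

text \<open>
  Compress the linearized matrix equation to the kernel: the term with the increment of \<open>V\<close> disappears to first order,
  the right-hand side is \<open>o(e)\<close> by \<open>half_kernel_block\<close>, and the limit of \<open>V\<close> is coercive there.
\<close>

lemma second_direction_kernel_block: "(\<lambda>k. norm (Q ** Flin P (fst (D2 k)) ** Q)) \<in> o(e)"
proof -
  obtain K where K: "0 < K" "\<And>w. norm (FF w - Fmap P xs) \<le> K * norm (w - ws)"
    "\<And>d. norm (Flin P (fst d)) \<le> K * norm (d :: ('n, 'm, 'p) vpoint)" by (rule Flin_dist) blast
  let ?E = "\<lambda>k. sprod (FF (X k)) (VV (X k)) - \<mu> k *\<^sub>R mat 1"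
  have "\<forall>\<^sub>F k in sequentially. \<bar>norm (Q ** Flin P (fst (D2 k)) ** Q)\<bar> \<le> (1 / c) *
     (norm (pert_at (X k) (D2 k)) + norm (Q ** ?E k ** Q) + 2 * K * (norm (X k - ws) * norm (D2 k)))"
    using direction_third[OF half_stage dir2 half_residual(2)]
  proof eventually_elim
    case (elim k)
    let ?D = "Flin P (fst (D2 k))" and ?F = "FF (X k)" and ?V = "VV (X k)" and ?d = "norm (X k - ws)"
    have 1: "sprod Vs ?D = - pert_at (X k) (D2 k) - ?E k - sprod ?F (VV (D2 k)) - sprod ?D (?V - Vs)"
    proof -
      have "sprod ?D ?V = \<mu> k *\<^sub>R mat 1 - pert_at (X k) (D2 k) - sprod ?F ?V - sprod ?F (VV (D2 k))"
        using elim by (simp add: eq_diff_eq ac_simps)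
      moreover have "sprod Vs ?D = sprod ?D ?V - sprod ?D (?V - Vs)"
        by (simp add: sprod.diff_right sprod_commute[of Vs])
      ultimately show ?thesis by simp
    qed
    have 2: "norm (Q ** sprod ?F (VV (D2 k)) ** Q) \<le> K * ?d * norm (D2 k)"
    proof -
      have eq: "Q ** sprod ?F (VV (D2 k)) ** Q = (1/2) *\<^sub>R ((Q ** ?F) ** (VV (D2 k) ** Q) + (Q ** VV (D2 k)) ** (?F ** Q))"
        by (simp only: sprod_def matmul.scaleR_left matmul.scaleR_right matmul.add_left matmul.add_right matrix_mul_assoc)
      have a: "norm (Q ** ?F) \<le> K * ?d" "norm (?F ** Q) \<le> K * ?d"
        by (rule order_trans[OF norm_QF_le K(2)], rule order_trans[OF norm_FQ_le K(2)])
      have v: "norm (VV (D2 k) ** Q) \<le> norm (D2 k)" "norm (Q ** VV (D2 k)) \<le> norm (D2 k)"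
        by (rule order_trans[OF norm_Q_right norm_proj_le(2)], rule order_trans[OF norm_Q_left norm_proj_le(2)])
      have "norm ((Q ** ?F) ** (VV (D2 k) ** Q)) \<le> (K * ?d) * norm (D2 k)"
        by (rule order_trans[OF norm_matrix_mult_le mult_mono[OF a(1) v(1)]]) (use K(1) in auto)
      moreover have "norm ((Q ** VV (D2 k)) ** (?F ** Q)) \<le> norm (D2 k) * (K * ?d)"
        by (rule order_trans[OF norm_matrix_mult_le mult_mono[OF v(2) a(2)]]) (use K(1) in auto)
      ultimately show ?thesis
        unfolding eq norm_scaleR
        using norm_triangle_ineq[of "(Q ** ?F) ** (VV (D2 k) ** Q)" "(Q ** VV (D2 k)) ** (?F ** Q)"]
        by (simp add: mult.commute)
    qed
    have "norm (VV (X k - ws)) \<le> ?d" by (rule norm_proj_le(2))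
    then have V: "norm (?V - Vs) \<le> ?d" by simp
    have "norm (Q ** sprod ?D (?V - Vs) ** Q) \<le> norm ?D * norm (?V - Vs)"
      by (rule order_trans[OF norm_kernel_compression_le norm_sprod_le])
    also have "\<dots> \<le> (K * norm (D2 k)) * ?d" using K(1) by (intro mult_mono K(3) V) auto
    finally have 3: "norm (Q ** sprod ?D (?V - Vs) ** Q) \<le> K * ?d * norm (D2 k)" by (simp add: mult_ac)
    have eq: "Q ** sprod Vs ?D ** Q = - (Q ** pert_at (X k) (D2 k) ** Q) - Q ** ?E k ** Q - Q ** sprod ?F (VV (D2 k)) ** Q - Q ** sprod ?D (?V - Vs) ** Q"
      unfolding 1 by (simp only: matmul.diff_left matmul.diff_right matmul.minus_left matmul.minus_right)
    have "norm (Q ** sprod Vs ?D ** Q) \<le> norm (pert_at (X k) (D2 k)) + norm (Q ** ?E k ** Q) + 2 * K * (?d * norm (D2 k))"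
    proof -
      let ?a = "Q ** pert_at (X k) (D2 k) ** Q" and ?b = "Q ** ?E k ** Q" and ?f = "Q ** sprod ?F (VV (D2 k)) ** Q"
        and ?g = "Q ** sprod ?D (?V - Vs) ** Q"
      have "norm (- ?a - ?b - ?f - ?g) \<le> norm ?a + norm ?b + norm ?f + norm ?g"
        using norm_triangle_ineq4[of "- ?a - ?b - ?f" ?g] norm_triangle_ineq4[of "- ?a - ?b" ?f]
          norm_triangle_ineq4[of "- ?a" ?b] norm_minus_cancel[of ?a] by linarith
      moreover have "norm ?a \<le> norm (pert_at (X k) (D2 k))" by (rule norm_kernel_compression_le)
      ultimately show ?thesis unfolding eq using 2 3 by (simp add: mult.assoc)
    qed
    then show ?case
      using norm_kernel_block_le[OF symm_FF(2)[of "fst (D2 k)"]] c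
      by (simp add: divide_right_mono order_trans)
  qed
  moreover have "(\<lambda>k. norm (pert_at (X k) (D2 k)) + norm (Q ** ?E k ** Q) + 2 * K * (norm (X k - ws) * norm (D2 k))) \<in> o(e)"
  proof (intro sum_in_smallo second_pert_small half_kernel_block)
    have "(\<lambda>k. norm (X k - ws)) \<longlonglongrightarrow> 0"
      using stageD(2)[OF half_stage] by (intro tendsto_norm_zero) (simp add: LIM_zero)
    then have "(\<lambda>k. norm (X k - ws) * norm (D2 k)) \<in> o(e)"
      by (intro bigo_times_smallo_1(2)[OF second_direction_size] smallo_1_of_tendsto)
    then show "(\<lambda>k. 2 * K * (norm (X k - ws) * norm (D2 k))) \<in> o(e)" by simp
  qed
  ultimately show ?thesis by (rule smallo_dominated)
qed

lemma mu_nonzero: "\<forall>\<^sub>F k in sequentially. \<mu> k \<noteq> 0" using mupos by eventually_elim simp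

lemma eps_over_ratio_small: "e \<in> o(\<lambda>k. e k / \<mu> k)"
proof -
  have "(\<lambda>k. e k / \<mu> k * \<mu> k) \<in> o(\<lambda>k. e k / \<mu> k)"
    by (rule bigo_times_smallo_1(1)[OF landau_o.big_refl smallo_1_of_tendsto[OF stageD(3)[OF half_stage]]])
  moreover have "e \<in> O(\<lambda>k. e k / \<mu> k * \<mu> k)"
    by (rule bigoI[of _ 1]) (use mu_nonzero in \<open>auto elim: eventually_mono\<close>)
  ultimately show ?thesis by (rule landau_o.big_small_trans[rotated])
qed

text \<open>
  Only the kernel block, which is \<open>o(e)\<close>, is divided by \<open>\<mu>\<close>, so the Lyapunov preimage is \<open>o(e / \<mu>)\<close> instead of \<open>O(e / \<mu>)\<close>.
\<close>

lemma second_pert_size: "(\<lambda>k. norm (pert_at (X k) (D2 k))) \<in> o(\<lambda>k. (e k)\<^sup>2 / \<mu> k)"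
proof -
  let ?Z = "\<lambda>k. lyap_inv (FF (X k)) (Flin P (fst (D2 k)))"
  let ?C = "\<lambda>k. commutator (FF (X k)) (VV (X k))"
  obtain K L where KL: "0 < K" "0 < L" "\<forall>\<^sub>F k in sequentially. norm (FF (X k) - Fmap P xs) \<le> K * \<mu> k"
    "\<forall>\<^sub>F k in sequentially. block_bounds L (\<mu> k) (FF (X k))"
    by (rule stage_block[OF half_stage])
  obtain K0 where K0: "0 < K0" "\<And>d. norm (Flin P (fst d)) \<le> K0 * norm (d :: ('n, 'm, 'p) vpoint)" by (rule Flin_dist) blast
  obtain b where pd: "\<forall>\<^sub>F k in sequentially. posdef (FF (X k)) \<and> posdef (VV (X k)) \<and> coercive (b * \<mu> k) (FF (X k))"
    by (rule stage_posdef[OF half_stage])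
  have "\<forall>\<^sub>F k in sequentially. \<bar>norm (?Z k)\<bar> \<le> L * (K0 * norm (D2 k) + norm (Q ** Flin P (fst (D2 k)) ** Q) / \<mu> k)"
    using KL(4) pd
  proof eventually_elim
    case (elim k)
    have "posdef (FF (X k))" using elim by blast
    note z = lyap_inv[OF this symm_FF(2)[of "fst (D2 k)"]]
    have "norm (?Z k) \<le> L * (norm (Flin P (fst (D2 k))) + norm (Q ** Flin P (fst (D2 k)) ** Q) / \<mu> k)"
      using block_boundsD(2)[OF elim(1), of "?Z k" 1] z by (simp add: symm_def)
    also have "\<dots> \<le> L * (K0 * norm (D2 k) + norm (Q ** Flin P (fst (D2 k)) ** Q) / \<mu> k)"
      using KL(2) by (intro mult_left_mono add_right_mono K0) auto
    finally show ?case by simp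
  qed
  moreover have "(\<lambda>k. K0 * norm (D2 k) + norm (Q ** Flin P (fst (D2 k)) ** Q) / \<mu> k) \<in> o(\<lambda>k. e k / \<mu> k)"
    using landau_o.big_small_trans[OF second_direction_size eps_over_ratio_small] landau_o.small.divide_right[OF mu_nonzero second_direction_kernel_block]
    by (intro sum_in_smallo) simp_all
  ultimately have Z: "(\<lambda>k. norm (?Z k)) \<in> o(\<lambda>k. e k / \<mu> k)" by (rule smallo_dominated)
  have "\<forall>\<^sub>F k in sequentially. \<bar>norm (pert_at (X k) (D2 k))\<bar> \<le> (1/4) * (norm (?C k) * norm (?Z k))"
    by (rule always_eventually, rule allI) (use norm_pert_le in \<open>simp add: pert_at_def\<close>)
  moreover have "(\<lambda>k. norm (?C k) * norm (?Z k)) \<in> o(\<lambda>k. (e k)\<^sup>2 / \<mu> k)"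
    using landau_o.big_small_mult[OF stage_commutator[OF half_stage] Z] by (simp add: power2_eq_square)
  ultimately show ?thesis by (rule smallo_dominated)
qed

lemma trial_residual: "(\<lambda>k. norm (res (\<mu> k) (X k + D2 k))) \<in> o(\<lambda>k. (e k)\<^sup>2 / \<mu> k)"
proof -
  have "\<forall>\<^sub>F k in sequentially. \<bar>norm (res (\<mu> k) (X k + D2 k))\<bar> \<le>
      1 * (norm (res (\<mu> k) (X k + D2 k) + third_component (pert_at (X k) (D2 k))) + norm (pert_at (X k) (D2 k)))"
  proof (rule always_eventually, rule allI)
    fix k
    show "\<bar>norm (res (\<mu> k) (X k + D2 k))\<bar> \<le>
      1 * (norm (res (\<mu> k) (X k + D2 k) + third_component (pert_at (X k) (D2 k))) + norm (pert_at (X k) (D2 k)))"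
      using norm_triangle_ineq4[of "res (\<mu> k) (X k + D2 k) + third_component (pert_at (X k) (D2 k))" "third_component (pert_at (X k) (D2 k))"]
      by (simp add: norm_third_component)
  qed
  moreover have "(\<lambda>k. norm (res (\<mu> k) (X k + D2 k) + third_component (pert_at (X k) (D2 k))) + norm (pert_at (X k) (D2 k))) \<in> o(\<lambda>k. (e k)\<^sup>2 / \<mu> k)"
  proof (intro sum_in_smallo second_pert_size landau_o.big_small_trans[OF direction_residual[OF half_stage dir2 half_residual(2)]])
    have "(\<lambda>k. (norm (D2 k))\<^sup>2) \<in> O(\<lambda>k. (e k)\<^sup>2)" by (rule landau_o.big_power[OF second_direction_size])
    moreover have "(\<lambda>k. e k * e k) \<in> o(\<lambda>k. e k * (e k / \<mu> k))" by (rule landau_o.big_small_mult[OF landau_o.big_refl eps_over_ratio_small])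
    ultimately show "(\<lambda>k. (norm (D2 k))\<^sup>2) \<in> o(\<lambda>k. (e k)\<^sup>2 / \<mu> k)"
      by (auto simp: power2_eq_square intro: landau_o.big_small_trans)
  qed
  ultimately show ?thesis by (rule smallo_dominated)
qed

lemma trial_stage: "stage (\<lambda>k. X k + D2 k) \<mu> (\<lambda>k. (e k)\<^sup>2 / \<mu> k)"
  unfolding stage_def
proof (intro conjI)
  show "\<forall>\<^sub>F k in sequentially. symm (VV (X k + D2 k)) \<and> 0 < \<mu> k \<and> 0 < (e k)\<^sup>2 / \<mu> k"
    using stageD(1)[OF half_stage] dir2 by eventually_elim (auto simp: direction_def)
  show "(\<lambda>k. X k + D2 k) \<longlonglongrightarrow> ws" by (rule direction_tendsto(2)[OF half_stage dir2 half_residual(2)])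
  show "\<mu> \<longlonglongrightarrow> 0" by (rule stageD(3)[OF half_stage])
  show "(\<lambda>k. norm (res (\<mu> k) (X k + D2 k))) \<in> O(\<lambda>k. (e k)\<^sup>2 / \<mu> k)" by (rule landau_o.small_imp_big[OF trial_residual])
  have "(\<lambda>k. e k * (e k / \<mu> k)) \<in> o(\<mu>)" by (rule bigo_times_smallo_1(1)[OF landau_o.small_imp_big[OF emu] ratio_small])
  then show "(\<lambda>k. (e k)\<^sup>2 / \<mu> k) \<in> o(\<mu>)" by (simp add: power2_eq_square)
qed

end

end

end

section \<open>Residuals of measures and of mass vectors\<close>

lemma sum_symmetric_pairs:
  fixes f :: "'m::{finite,linorder} \<Rightarrow> 'm \<Rightarrow> real"
  assumes "\<And>i j. f i j = f j i"
  shows "(\<Sum>i\<in>UNIV. \<Sum>j\<in>UNIV. f i j) = (\<Sum>i\<in>UNIV. \<Sum>j\<in>UNIV. if i = j then f i i else if j < i then 2 * f i j else 0)"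
proof -
  let ?a = "\<lambda>i j. if i = j then f i i else 0" and ?b = "\<lambda>i j. if j < i then f i j else 0"
  have sw: "(\<Sum>i\<in>UNIV. \<Sum>j\<in>UNIV. if i < j then f i j else 0) = (\<Sum>i\<in>UNIV. \<Sum>j\<in>UNIV. ?b i j)"
    by (subst sum.swap) (intro sum.cong refl, simp add: assms)
  have "(\<Sum>i\<in>UNIV. \<Sum>j\<in>UNIV. f i j) = (\<Sum>i\<in>UNIV. \<Sum>j\<in>UNIV. ?a i j + ?b i j + (if i < j then f i j else 0))"
    by (intro sum.cong refl) auto
  also have "\<dots> = (\<Sum>i\<in>UNIV. \<Sum>j\<in>UNIV. ?a i j + ?b i j + ?b i j)"
    unfolding sum.distrib sw ..
  also have "\<dots> = (\<Sum>i\<in>UNIV. \<Sum>j\<in>UNIV. if i = j then f i i else if j < i then 2 * f i j else 0)"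
    by (intro sum.cong refl) auto
  finally show ?thesis .
qed

lemma linear_svec: "linear svec"
  by (rule linearI) (auto simp: svec_def vec_eq_iff algebra_simps)

text \<open>
  The factor \<open>sqrt 2\<close> accounts for the entries above the diagonal.
\<close>

lemma norm_svec: assumes "symm X" shows "norm (svec X) = norm X"
proof -
  have s: "X $ i $ j = X $ j $ i" for i j
    using assms unfolding symm_def transpose_def vec_eq_iff by simp
  have "(norm (svec X))\<^sup>2 = (\<Sum>p\<in>UNIV. (svec X $ p)\<^sup>2)"
    unfolding power2_norm_eq_inner inner_vec_def by (simp add: power2_eq_square)
  also have "\<dots> = (\<Sum>i\<in>UNIV. \<Sum>j\<in>UNIV. (svec X $ (i, j))\<^sup>2)"
    unfolding UNIV_Times_UNIV[symmetric] by (simp add: sum.cartesian_product split_def)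
  also have "\<dots> = (\<Sum>i\<in>UNIV. \<Sum>j\<in>UNIV. if i = j then (X$i$i)\<^sup>2 else if j < i then 2 * (X$i$j)\<^sup>2 else 0)"
    by (intro sum.cong refl) (simp add: svec_def power_mult_distrib)
  also have "\<dots> = (norm X)\<^sup>2"
    unfolding norm_matrix_sq by (rule sum_symmetric_pairs[symmetric]) (simp add: s)
  finally show ?thesis by simp
qed

lemma smat_svec:
  fixes X :: "real^('m::{finite,linorder})^('m::{finite,linorder})"
  assumes "symm X" shows "smat (svec X) = X"
proof -
  have "inj_on svec {X :: ((real, 'm) vec, 'm) vec. symm X}"
  proof (rule inj_onI)
    fix A B :: "((real, 'm) vec, 'm) vec" assume *: "A \<in> {X. symm X}" "B \<in> {X. symm X}" "svec A = svec B"
    then have "symm (A - B)" by auto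
    from norm_svec[OF this] *(3) show "A = B" by (simp add: linear_diff[OF linear_svec])
  qed
  then show ?thesis unfolding smat_def using assms by (intro inv_into_f_f) auto
qed

context reduced_sisdp
begin

definition masses :: "real^'n \<Rightarrow> (real^'q) measure \<Rightarrow> real^'p" where
  "masses x y = (\<chi> i. if i \<in> J then measure y {tt i x} else 0)"

text \<open>
  The measure \<open>y\<close> is determined by its masses at the points \<open>tt i x\<close>, and these points are distinct.
\<close>

definition carried :: "real^'n \<Rightarrow> (real^'q) measure \<Rightarrow> bool" where
  "carried x y \<longleftrightarrow> x \<in> U \<and> inj_on (\<lambda>i. tt i x) J \<and> sets y = sets RT \<and> finite_measure y \<and>
     emeasure y (T - (\<lambda>i. tt i x) ` J) = 0"

text \<open>
  For such measures the residuals of the measure are components of \<open>Psi\<close>; the envelope formula replaces the gradients of \<open>con P\<close> by those of \<open>gh i\<close>.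
\<close>

lemma phi_carried:
  assumes y: "carried x y"
  shows "phi1 P (x, y, V) = fst (Psi (x, masses x y, V))"
    and "phi2 P (x, y, V) = (\<Sum>i\<in>J. masses x y $ i * gh i x)"
proof -
  note c = y[unfolded carried_def]
  have "integral\<^sup>L y (\<lambda>\<tau>. grad (\<lambda>z. con P z \<tau>) x) = (\<Sum>i\<in>J. measure y {tt i x} *\<^sub>R grad (\<lambda>z. con P z (tt i x)) x)"
    using c by (intro integral_discrete grad_con_continuous) auto
  also have "\<dots> = (\<Sum>i\<in>J. masses x y $ i *\<^sub>R grad (gh i) x)"
    using c by (intro sum.cong refl) (simp add: masses_def envelope(1))
  finally show "phi1 P (x, y, V) = fst (Psi (x, masses x y, V))" by (simp add: phi1_def Psi_def)
  have "integral\<^sup>L y (con P x) = (\<Sum>i\<in>J. measure y {tt i x} *\<^sub>R con P x (tt i x))"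
    using c by (intro integral_discrete con_continuous) auto
  also have "\<dots> = (\<Sum>i\<in>J. masses x y $ i * gh i x)"
    by (intro sum.cong refl) (simp add: masses_def ghat_def)
  finally show "phi2 P (x, y, V) = (\<Sum>i\<in>J. masses x y $ i * gh i x)" by (simp add: phi2_def)
qed

lemma norm_phi3: "symm V \<Longrightarrow> norm (phi3 P \<mu> (x, y, V)) = norm (sprod (Fmap P x) V - \<mu> *\<^sub>R mat 1)"
  unfolding phi3_def split using symm_Fmap(1)[OF wf] by (intro norm_svec) auto

lemma Rres_parts:
  assumes "Rres P \<mu> w \<le> e"
  shows "theta P (fst w) \<le> e" "norm (phi1 P w) \<le> e" "\<bar>phi2 P w\<bar> \<le> e" "norm (phi3 P \<mu> w) \<le> e"
proof -
  have "sqrt (a\<^sup>2) \<le> e" if "a\<^sup>2 \<le> (theta P (fst w))\<^sup>2 + (norm (phi1 P w))\<^sup>2 + (phi2 P w)\<^sup>2 + (norm (phi3 P \<mu> w))\<^sup>2" for a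
    using real_sqrt_le_mono[OF that] assms by (simp add: Rres_def)
  note * = this[unfolded real_sqrt_abs]
  show "theta P (fst w) \<le> e" "norm (phi1 P w) \<le> e" "\<bar>phi2 P w\<bar> \<le> e" "norm (phi3 P \<mu> w) \<le> e"
    using *[of "theta P (fst w)"] *[of "norm (phi1 P w)"] *[of "phi2 P w"] *[of "norm (phi3 P \<mu> w)"] by auto
qed

lemma Rres_le: "Rres P \<mu> w \<le> \<bar>theta P (fst w)\<bar> + norm (phi1 P w) + \<bar>phi2 P w\<bar> + norm (phi3 P \<mu> w)"
proof -
  have "sqrt (a\<^sup>2 + b\<^sup>2 + c\<^sup>2 + d\<^sup>2) \<le> \<bar>a\<bar> + \<bar>b\<bar> + \<bar>c\<bar> + \<bar>d\<bar>" for a b c d :: real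
  proof (rule real_le_lsqrt)
    have "a\<^sup>2 + b\<^sup>2 + c\<^sup>2 + d\<^sup>2 = \<bar>a\<bar>\<^sup>2 + \<bar>b\<bar>\<^sup>2 + \<bar>c\<bar>\<^sup>2 + \<bar>d\<bar>\<^sup>2" by simp
    also have "\<dots> \<le> (\<bar>a\<bar> + \<bar>b\<bar> + \<bar>c\<bar> + \<bar>d\<bar>)\<^sup>2"
      by (simp add: power2_eq_square algebra_simps)
    finally show "a\<^sup>2 + b\<^sup>2 + c\<^sup>2 + d\<^sup>2 \<le> (\<bar>a\<bar> + \<bar>b\<bar> + \<bar>c\<bar> + \<bar>d\<bar>)\<^sup>2" .
  qed auto
  from this[of "theta P (fst w)" "norm (phi1 P w)" "phi2 P w" "norm (phi3 P \<mu> w)"] show ?thesis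
    by (simp add: Rres_def)
qed

text \<open>
  Complementary slackness holds for every single \<open>i\<close> because all terms of the vanishing sum have the same sign. Strict
  complementarity then separates active from inactive indices.
\<close>

lemma KKT_Psi:
  assumes K: "KKT P (xs, ym, Vs)"
    and sc: "\<And>i. i \<in> J \<Longrightarrow> - gh i xs + masses xs ym $ i > 0"
  shows "carried xs ym" "Psi (xs, masses xs ym, Vs) = 0"
    "i \<in> I \<Longrightarrow> 0 < masses xs ym $ i" "i \<notin> I \<Longrightarrow> masses xs ym $ i = 0" "i \<in> J \<Longrightarrow> i \<notin> I \<Longrightarrow> gh i xs < 0"
proof -
  let ?y = "masses xs ym"
  show c: "carried xs ym"
    using K KKT_discrete[OF K] xsU eventually_nhds_x_imp_x[OF eventually_inj]
    by (auto simp: carried_def KKT_def Mplus_def)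
  have le: "gh i xs \<le> 0" if "i \<in> J" for i
    using K tau_T[OF that xsU] by (auto simp: KKT_def ghat_def)
  have nn: "0 \<le> ?y $ i" for i by (simp add: masses_def)
  have "(\<Sum>i\<in>J. - (?y $ i * gh i xs)) = 0"
    using K phi_carried(2)[OF c, of Vs] by (simp add: KKT_def sum_negf)
  then have z: "?y $ i * gh i xs = 0" if "i \<in> J" for i
    using le nn that by (subst (asm) sum_nonneg_eq_0_iff) (auto simp: mult_nonneg_nonpos)
  show y0: "?y $ i = 0" if "i \<notin> I" for i
  proof (cases "i \<in> J")
    case True then show ?thesis using z[OF True] that by (auto simp: Iact_def)
  qed (simp add: masses_def)
  show "0 < ?y $ i" if "i \<in> I" for i using sc[OF I_J[OF that]] that by (simp add: Iact_def)
  show "gh i xs < 0" if "i \<in> J" "i \<notin> I" for i using sc[OF that(1)] y0[OF that(2)] by simp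
  have "fst (Psi (xs, ?y, Vs)) = 0" using K phi_carried(1)[OF c, of Vs] by (simp add: KKT_def)
  moreover have "fst (snd (Psi (xs, ?y, Vs))) = 0" using y0 by (auto simp: Psi_def vec_eq_iff Iact_def)
  moreover have "snd (snd (Psi (xs, ?y, Vs))) = 0" using K by (simp add: Psi_def KKT_def)
  ultimately show "Psi (xs, ?y, Vs) = 0" by (simp add: prod_eq_iff)
qed

text \<open>
  A vector in the kernel has no inactive mass component, so it is a direction in the domain of \<open>Phi0\<close>. Along a
  line in that direction \<open>Phi0\<close> is a linear image of \<open>Psi\<close>; thus the two derivatives agree on it. Lines are used
  because the derivative of \<open>Phi0\<close> is taken within a subspace.
\<close>

lemma DPsi_nonsingular:
  assumes V: "symm V" and y0: "\<And>i. i \<notin> I \<Longrightarrow> y $ i = 0"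
    and D: "(Phi0 P r xs has_derivative D) (at (xs, y, svec V) within Phi0_space P r xs)"
    and bij: "bij_betw D (Phi0_space P r xs) (Phi0_space P r xs)"
    and h: "DPsi (xs, y, V) (dx, dy, dV) = 0" and dV: "symm dV"
  shows "dx = 0" "dy = 0" "dV = 0"
proof -
  have dy0: "dy $ i = 0" if "i \<notin> I" for i
    using arg_cong[OF h, of "\<lambda>u. fst (snd u) $ i"] that by (simp add: DPsi_def)
  \<comment> \<open>\<open>lft\<close> passes from the values of \<open>Psi\<close> to the codomain of \<open>Phi0\<close>\<close>
  define lft where "lft = (\<lambda>u :: ('n, 'm, 'p) vpoint. (fst u, (\<chi> i. if i \<in> I then fst (snd u) $ i else 0) :: real^'p, svec (snd (snd u))))"
  have bl: "bounded_linear lft"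
    by (rule linear_conv_bounded_linear[THEN iffD1], rule linearI)
      (auto simp: lft_def vec_eq_iff linear_add[OF linear_svec] linear_cmul[OF linear_svec])
  let ?p = "(xs, y, svec V)" and ?d = "(dx, dy, svec dV)" and ?S = "Phi0_space P r xs"
  have path: "?p + t *\<^sub>R ?d = (xs + t *\<^sub>R dx, y + t *\<^sub>R dy, svec (V + t *\<^sub>R dV))" for t
    by (simp add: linear_add[OF linear_svec] linear_cmul[OF linear_svec])
  have inS: "?p + t *\<^sub>R ?d \<in> ?S" for t
    unfolding path Phi0_space_def using V dV y0 dy0 by (auto simp: vecs_def)
  have key: "Phi0 P r xs (?p + t *\<^sub>R ?d) = lft (Psi ((xs, y, V) + t *\<^sub>R (dx, dy, dV)))" for t
  proof -
    have "symm (V + t *\<^sub>R dV)" using V dV by auto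
    note sm = smat_svec[OF this]
    have "(\<Sum>i\<in>J. (y $ i + t * dy $ i) *\<^sub>R grad (gh i) (xs + t *\<^sub>R dx)) = (\<Sum>i\<in>I. (y $ i + t * dy $ i) *\<^sub>R grad (gh i) (xs + t *\<^sub>R dx))"
      by (rule sum.mono_neutral_right) (use I_J y0 dy0 in auto)
    then show ?thesis unfolding path by (simp add: Phi0_def Psi_def lft_def sm vec_eq_iff)
  qed
  have line: "((\<lambda>t. (xs, y, V) + t *\<^sub>R (dx, dy, dV)) has_derivative (\<lambda>t. t *\<^sub>R (dx, dy, dV))) (at 0)"
    by (auto intro!: derivative_eq_intros)
  have "((\<lambda>t. Psi ((xs, y, V) + t *\<^sub>R (dx, dy, dV))) has_derivative (\<lambda>t. DPsi (xs, y, V) (t *\<^sub>R (dx, dy, dV)))) (at (0::real))"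
    by (rule has_derivative_compose[OF line]) (use Psi_derivative[OF xsU] in simp)
  then have 1: "((\<lambda>t. lft (Psi ((xs, y, V) + t *\<^sub>R (dx, dy, dV)))) has_derivative (\<lambda>t. lft (DPsi (xs, y, V) (t *\<^sub>R (dx, dy, dV))))) (at (0::real))"
    by (rule bounded_linear.has_derivative[OF bl])
  have line2: "((\<lambda>t. ?p + t *\<^sub>R ?d) has_derivative (\<lambda>t. t *\<^sub>R ?d)) (at (0::real))"
    by (auto intro!: derivative_eq_intros)
  have 2: "((\<lambda>t. Phi0 P r xs (?p + t *\<^sub>R ?d)) has_derivative (\<lambda>t. D (t *\<^sub>R ?d))) (at (0::real))"
  proof (rule has_derivative_in_compose[OF line2])
    have "range (\<lambda>t. ?p + t *\<^sub>R ?d) \<subseteq> ?S" using inS by blast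
    from has_derivative_subset[OF D this]
    show "(Phi0 P r xs has_derivative D) (at (?p + 0 *\<^sub>R ?d) within range (\<lambda>t. ?p + t *\<^sub>R ?d))" by simp
  qed
  have "(\<lambda>t. D (t *\<^sub>R ?d)) = (\<lambda>t. lft (DPsi (xs, y, V) (t *\<^sub>R (dx, dy, dV))))"
    using has_derivative_unique[OF 2] 1 unfolding key by blast
  from fun_cong[OF this, of 1] have "D ?d = lft 0" using h by simp
  then have "D ?d = 0" using linear_0[OF bounded_linear.linear[OF bl]] by simp
  moreover have "D 0 = 0" using linear_0[OF has_derivative_linear[OF D]] .
  moreover have dS: "?d \<in> ?S" unfolding Phi0_space_def using dV dy0 by (auto simp: vecs_def)
  moreover have "symm (0 :: ((real, 'm) vec, 'm) vec)" by auto
  then have "0 \<in> ?S" unfolding Phi0_space_def zero_prod_def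
    using linear_0[OF linear_svec, symmetric] by (auto simp: vecs_def intro!: image_eqI[of _ _ 0])
  ultimately have "?d = 0" using bij by (metis bij_betw_imp_inj_on inj_onD)
  then show "dx = 0" "dy = 0" "dV = 0" using norm_svec[OF dV] by (auto simp: zero_prod_def)
qed

end

context limit_point
begin

lemma near_limit:
  obtains \<rho> \<eta> B where "0 < \<rho>" "0 < \<eta>" "0 < B"
    "\<And>w. w \<in> cball ws \<rho> \<Longrightarrow> fst w \<in> U"
    "\<And>w i. w \<in> cball ws \<rho> \<Longrightarrow> i \<in> I \<Longrightarrow> \<eta> \<le> fst (snd w) $ i"
    "\<And>w i. w \<in> cball ws \<rho> \<Longrightarrow> i \<in> J \<Longrightarrow> i \<notin> I \<Longrightarrow> gh i (fst w) \<le> - \<eta>"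
    "\<And>w i. w \<in> cball ws \<rho> \<Longrightarrow> \<bar>fst (snd w) $ i\<bar> \<le> B"
proof -
  have fin: "finite I" "finite (J - I)" by simp_all
  have "\<exists>\<eta>>0. \<forall>i. (i \<in> I \<longrightarrow> \<eta> < ys $ i) \<and> (i \<in> J \<and> i \<notin> I \<longrightarrow> gh i xs < - \<eta>)"
  proof -
    \<comment> \<open>the 1 makes the set nonempty if there are no constraints\<close>
  define A where "A = insert 1 ((\<lambda>i. ys $ i) ` I \<union> (\<lambda>i. - gh i xs) ` (J - I))"
    have A: "finite A" "A \<noteq> {}" "\<And>a. a \<in> A \<Longrightarrow> 0 < a" using ysI ghn by (auto simp: A_def)
    then have "0 < Min A" by simp
    moreover have "Min A \<le> a" if "a \<in> A" for a using A that by simp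
    then have "Min A / 2 < a" if "a \<in> A" for a using that \<open>0 < Min A\<close> by fastforce
    from this have "\<forall>i. (i \<in> I \<longrightarrow> Min A / 2 < ys $ i) \<and> (i \<in> J \<and> i \<notin> I \<longrightarrow> gh i xs < - (Min A / 2))"
    proof (intro allI conjI impI)
      assume *: "\<And>a. a \<in> A \<Longrightarrow> Min A / 2 < a"
      fix i
      show "Min A / 2 < ys $ i" if "i \<in> I" by (rule *) (use that in \<open>simp add: A_def\<close>)
      show "gh i xs < - (Min A / 2)" if "i \<in> J \<and> i \<notin> I"
        using *[of "- gh i xs"] that by (auto simp: A_def)
    qed
    ultimately show ?thesis by (intro exI[of _ "Min A / 2"]) simp
  qed
  then obtain \<eta> where \<eta>: "0 < \<eta>" "\<And>i. i \<in> I \<Longrightarrow> \<eta> < ys $ i" "\<And>i. i \<in> J \<Longrightarrow> i \<notin> I \<Longrightarrow> gh i xs < - \<eta>" by auto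
  have y: "((\<lambda>w. fst (snd w) $ i) \<longlongrightarrow> ys $ i) (nhds ws)" for i
  proof -
    have "((\<lambda>w. w) \<longlongrightarrow> ws) (nhds ws)" by (rule filterlim_ident)
    from tendsto_vec_nth[OF tendsto_fst[OF tendsto_snd[OF this]]] show ?thesis by simp
  qed
  have g: "((\<lambda>w. gh i (fst w)) \<longlongrightarrow> gh i xs) (nhds ws)" if "i \<in> J" for i
  proof -
    have "continuous_on U (gh i)" using Ck_on_le[OF ghat_C2(1)[OF that], of 0] by simp
    then have "isCont (gh i) xs" using openU xsU by (simp add: continuous_on_eq_continuous_at)
    then have "(gh i \<longlongrightarrow> gh i xs) (nhds xs)" by (simp add: continuous_at tendsto_at_iff_tendsto_nhds)
    then show ?thesis by (rule filterlim_compose) (auto intro!: tendsto_eq_intros filterlim_ident)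
  qed
  have "\<forall>\<^sub>F w in nhds ws. fst w \<in> U \<and> (\<forall>i\<in>I. \<eta> < fst (snd w) $ i) \<and> (\<forall>i\<in>J - I. gh i (fst w) < - \<eta>) \<and> dist w ws < 1"
  proof (intro eventually_conj eventually_ball_finite fin ballI)
    have "((\<lambda>w. fst w) \<longlongrightarrow> xs) (nhds ws)" by (auto intro!: tendsto_eq_intros filterlim_ident)
    then show "\<forall>\<^sub>F w in nhds ws. fst w \<in> U" using openU xsU by (rule topological_tendstoD)
    show "\<forall>\<^sub>F w in nhds ws. \<eta> < fst (snd w) $ i" if "i \<in> I" for i using order_tendstoD(1)[OF y \<eta>(2)[OF that]] .
    show "\<forall>\<^sub>F w in nhds ws. gh i (fst w) < - \<eta>" if "i \<in> J - I" for i
      using order_tendstoD(2)[OF g \<eta>(3)] that by blast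
    show "\<forall>\<^sub>F w in nhds ws. dist w ws < 1" unfolding eventually_nhds_metric by (intro exI[of _ 1]) auto
  qed
  then obtain d where d: "0 < d" and H: "\<And>w. dist w ws < d \<Longrightarrow> fst w \<in> U \<and> (\<forall>i\<in>I. \<eta> < fst (snd w) $ i) \<and> (\<forall>i\<in>J - I. gh i (fst w) < - \<eta>) \<and> dist w ws < 1"
    unfolding eventually_nhds_metric by blast
  show ?thesis
  proof (rule that[of "d / 2" \<eta> "norm ys + 1"])
    have near: "dist w ws < d" if "w \<in> cball ws (d / 2)" for w
      using that d by (simp add: dist_commute)
    show "0 < d / 2" "0 < \<eta>" "0 < norm ys + 1" using d \<eta> by (auto intro: add_nonneg_pos)
    show "fst w \<in> U" if "w \<in> cball ws (d / 2)" for w using H[OF near[OF that]] by blast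
    show "\<eta> \<le> fst (snd w) $ i" if "w \<in> cball ws (d / 2)" "i \<in> I" for w i using H[OF near[OF that(1)]] that(2) by force
    show "gh i (fst w) \<le> - \<eta>" if "w \<in> cball ws (d / 2)" "i \<in> J" "i \<notin> I" for w i
      using H[OF near[OF that(1)]] that(2,3) by force
    show "\<bar>fst (snd w) $ i\<bar> \<le> norm ys + 1" if "w \<in> cball ws (d / 2)" for w i
    proof -
      have "dist (fst (snd w)) (fst (snd ws)) \<le> dist w ws"
        using dist_fst_le[of "snd w" "snd ws"] dist_snd_le[of w ws] by linarith
      then have "norm (fst (snd w) - ys) < 1" using H[OF near[OF that]] by (simp add: dist_norm)
      then show ?thesis
        using component_le_norm_cart[of "fst (snd w)" i] norm_triangle_ineq2[of "fst (snd w)" ys] by linarith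
    qed
  qed
qed

text \<open>
  Each product of a mass and \<open>gh i x\<close> is at most of order \<open>e\<close>, since \<open>theta\<close> bounds \<open>gh i x\<close> from above; their sum is at
  least \<open>- e\<close>, so no product is below a multiple of \<open>- e\<close>. In every product one factor is bounded away from 0:
  the mass for active \<open>i\<close>, and \<open>gh i x\<close> for inactive \<open>i\<close>.
\<close>

lemma residual_of_iterate:
  obtains \<rho> K where "0 < \<rho>"
    "\<And>x y V m e. (x, masses x y, V) \<in> cball ws \<rho> \<Longrightarrow> carried x y \<Longrightarrow> symm V \<Longrightarrow> Rres P m (x, y, V) \<le> e
       \<Longrightarrow> norm (res m (x, masses x y, V)) \<le> K * e"
proof -
  obtain \<rho> \<eta> B where n: "0 < \<rho>" "0 < \<eta>" "0 < B"
    "\<And>w. w \<in> cball ws \<rho> \<Longrightarrow> fst w \<in> U"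
    "\<And>w i. w \<in> cball ws \<rho> \<Longrightarrow> i \<in> I \<Longrightarrow> \<eta> \<le> fst (snd w) $ i"
    "\<And>w i. w \<in> cball ws \<rho> \<Longrightarrow> i \<in> J \<Longrightarrow> i \<notin> I \<Longrightarrow> gh i (fst w) \<le> - \<eta>"
    "\<And>w i. w \<in> cball ws \<rho> \<Longrightarrow> \<bar>fst (snd w) $ i\<bar> \<le> B"
    by (rule near_limit) blast
  define N where "N = real CARD('p)"
  define C where "C = (1 + N * B) / \<eta>"
  show ?thesis
  proof (rule that[OF n(1), of "1 + N * C + 1"])
    fix x y m e and V :: "((real, 'm) vec, 'm) vec"
    let ?v = "masses x y" and ?w = "(x, masses x y, V)"
    assume w: "?w \<in> cball ws \<rho>" and c: "carried x y" and V: "symm V" and R: "Rres P m (x, y, V) \<le> e"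
    note parts = Rres_parts[OF R]
    have e0: "0 \<le> e" using parts(2) norm_ge_zero order_trans by blast
    have xU: "x \<in> U" using n(4)[OF w] by simp
    have v0: "0 \<le> ?v $ i" and vB: "?v $ i \<le> B" for i using n(7)[OF w, of i] by (auto simp: masses_def)
    have gle: "gh i x \<le> e" if "i \<in> J" for i
      using theta_bounds(1)[OF tau_T[OF that xU], of x] parts(1) by (simp add: ghat_def)
    have termle: "?v $ j * gh j x \<le> B * e" if "j \<in> J" for j
      using mult_mono[OF vB gle[OF that] less_imp_le[OF n(3)] ] v0[of j] e0 n(3) gle[OF that]
      by (smt (verit) mult_mono mult_nonneg_nonneg mult_nonneg_nonpos)
    have low: "- (1 + N * B) * e \<le> ?v $ i * gh i x" if i: "i \<in> J" for i
    proof -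
      have "- e \<le> (\<Sum>j\<in>J. ?v $ j * gh j x)" using parts(3) phi_carried(2)[OF c, of V] by simp
      also have "\<dots> = ?v $ i * gh i x + (\<Sum>j\<in>J - {i}. ?v $ j * gh j x)" using i by (simp add: sum.remove)
      also have "(\<Sum>j\<in>J - {i}. ?v $ j * gh j x) \<le> (\<Sum>j\<in>J - {i}. B * e)" using termle by (intro sum_mono) auto
      also have "\<dots> \<le> N * (B * e)"
        using card_mono[of UNIV "J - {i}"] n(3) e0 by (auto simp: N_def intro!: mult_right_mono)
      finally show ?thesis by (simp add: algebra_simps)
    qed
    have comp: "\<bar>(if i \<in> I then gh i x else ?v $ i)\<bar> \<le> C * e" for i
    proof (cases "i \<in> I")
      case True
      have "gh i x \<le> C * e"
      proof -
        have "1 \<le> 1 + N * B" using n(3) by (simp add: N_def)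
        show ?thesis
        proof (cases "gh i x \<le> 0")
          case True
          have "0 \<le> C * e" using e0 n(2,3) by (simp add: C_def N_def)
          with True show ?thesis by linarith
        next
          case False
          have "\<eta> * gh i x \<le> ?v $ i * gh i x" using n(5)[OF w \<open>i \<in> I\<close>] False by (intro mult_right_mono) auto
          also have "?v $ i * gh i x \<le> B * e" by (rule termle[OF I_J[OF \<open>i \<in> I\<close>]])
          also have "B * e \<le> (1 + N * B) * e"
          proof (rule mult_right_mono[OF _ e0])
            have "1 * B \<le> N * B" using n(3) by (intro mult_right_mono) (simp_all add: N_def Suc_leI)
            then show "B \<le> 1 + N * B" by simp
          qed
          finally show ?thesis using n(2) by (simp add: C_def field_simps)
        qed
      qed
      moreover have "- (C * e) \<le> gh i x"
      proof (cases "0 \<le> gh i x")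
        case True
        have "0 \<le> C * e" using e0 n(2,3) by (simp add: C_def N_def)
        with True show ?thesis by linarith
      next
        case False
        have "- (1 + N * B) * e \<le> ?v $ i * gh i x" by (rule low[OF I_J[OF \<open>i \<in> I\<close>]])
        also have "\<dots> \<le> \<eta> * gh i x" using n(5)[OF w \<open>i \<in> I\<close>] False by (intro mult_right_mono_neg) auto
        finally show ?thesis using n(2) by (simp add: C_def field_simps)
      qed
      ultimately show ?thesis using True by (simp add: abs_le_iff)
    next
      case False
      have "?v $ i \<le> C * e"
      proof (cases "i \<in> J")
        case True
        have "- (1 + N * B) * e \<le> ?v $ i * gh i x" by (rule low[OF True])
        also have "\<dots> \<le> ?v $ i * (- \<eta>)" using n(6)[OF w True False] v0 by (intro mult_left_mono) auto
        finally show ?thesis using n(2) by (simp add: C_def field_simps)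
      next
        case False
        have "0 \<le> C * e" using e0 n(2,3) by (simp add: C_def N_def)
        with False show ?thesis by (simp add: masses_def)
      qed
      then show ?thesis using False v0[of i] by simp
    qed
    have 1: "norm (fst (res m ?w)) \<le> e"
      using parts(2) phi_carried(1)[OF c, of V] by (simp add: res_def central_value_def)
    have 2: "norm (fst (snd (res m ?w))) \<le> N * C * e"
    proof -
      have "norm (fst (snd (res m ?w))) \<le> (\<Sum>i\<in>UNIV. \<bar>fst (snd (res m ?w)) $ i\<bar>)" by (rule norm_le_l1_cart)
      also have "\<dots> \<le> (\<Sum>i\<in>(UNIV::'p set). C * e)"
        using comp by (intro sum_mono) (simp add: res_def central_value_def Psi_def)
      finally show ?thesis by (simp add: N_def mult.assoc)
    qed
    have 3: "norm (snd (snd (res m ?w))) \<le> e"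
      using parts(4) norm_phi3[OF V, of m x y] by (simp add: res_def central_value_def Psi_def)
    have "norm (res m ?w) \<le> norm (fst (res m ?w)) + (norm (fst (snd (res m ?w))) + norm (snd (snd (res m ?w))))"
      using norm_Pair_le[of "fst (res m ?w)" "snd (res m ?w)"] norm_Pair_le[of "fst (snd (res m ?w))" "snd (snd (res m ?w))"]
      by simp
    then show "norm (res m ?w) \<le> (1 + N * C + 1) * e" using 1 2 3 by (simp add: algebra_simps)
  qed
qed

text \<open>
  With the inactive masses equal to 0, the residual function of the measure is bounded by \<open>norm (res \<mu> w)\<close>.
\<close>

lemma trial_in_Nset:
  obtains \<rho> K where "0 < \<rho>" "0 < K"
    "\<And>x v V \<mu> e. (x, v, V) \<in> cball ws \<rho> \<Longrightarrow> inj_on (\<lambda>i. tt i x) J \<Longrightarrow> (\<And>i. i \<notin> I \<Longrightarrow> v $ i = 0) \<Longrightarrow>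
       posdef (Fmap P x) \<Longrightarrow> posdef V \<Longrightarrow> K * norm (res \<mu> (x, v, V)) \<le> e
       \<Longrightarrow> x \<in> U \<and> (\<forall>i\<in>J. 0 \<le> v $ i) \<and> (x, mass x v, V) \<in> Nset P \<mu> e"
proof -
  obtain \<rho> \<eta> B where n: "0 < \<rho>" "0 < \<eta>" "0 < B"
    "\<And>w. w \<in> cball ws \<rho> \<Longrightarrow> fst w \<in> U"
    "\<And>w i. w \<in> cball ws \<rho> \<Longrightarrow> i \<in> I \<Longrightarrow> \<eta> \<le> fst (snd w) $ i"
    "\<And>w i. w \<in> cball ws \<rho> \<Longrightarrow> i \<in> J \<Longrightarrow> i \<notin> I \<Longrightarrow> gh i (fst w) \<le> - \<eta>"
    "\<And>w i. w \<in> cball ws \<rho> \<Longrightarrow> \<bar>fst (snd w) $ i\<bar> \<le> B"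
    by (rule near_limit) blast
  define N where "N = real CARD('p)"
  have N: "0 < N" by (simp add: N_def)
  show ?thesis
  proof (rule that[OF n(1), of "N + 1 + N * B + 1"])
    show "0 < N + 1 + N * B + 1" using N n(3) by (simp add: add_pos_pos)
    fix x :: "real^'n" and v :: "real^'p" and \<mu> e :: real and V :: "((real, 'm) vec, 'm) vec"
    let ?w = "(x, v, V)"
    let ?r = "norm (res \<mu> ?w)"
    assume w: "?w \<in> cball ws \<rho>" and inj: "inj_on (\<lambda>i. tt i x) J" and v0: "\<And>i. i \<notin> I \<Longrightarrow> v $ i = 0"
      and pF: "posdef (Fmap P x)" and pV: "posdef V" and le: "(N + 1 + N * B + 1) * ?r \<le> e"
    have xU: "x \<in> U" using n(4)[OF w] by simp
    have vnn: "0 \<le> v $ i" for i using n(5)[OF w, of i] n(2) v0[of i] by (cases "i \<in> I") auto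
    note mf = mass_facts[OF xU vnn inj]
    have vm: "masses x (mass x v) = v" using mf(3) v0 I_J by (auto simp: masses_def vec_eq_iff)
    have car: "carried x (mass x v)" using mf(1,2) inj xU by (simp add: carried_def Mplus_def)
    have sV: "symm V" using pV by (simp add: posdef_def)
    have gr: "\<bar>gh i x\<bar> \<le> ?r" if "i \<in> I" for i
    proof -
      have "fst (snd (res \<mu> ?w)) $ i = gh i x" using that by (simp add: res_def central_value_def Psi_def)
      then have "\<bar>gh i x\<bar> \<le> norm (fst (snd (res \<mu> ?w)))" using component_le_norm_cart by metis
      also have "\<dots> \<le> norm (snd (res \<mu> ?w))"
        using norm_fst_le[of "fst (snd (res \<mu> ?w))" "snd (snd (res \<mu> ?w))"] by simp
      also have "\<dots> \<le> ?r" using norm_snd_le[of "snd (res \<mu> ?w)" "fst (res \<mu> ?w)"] by simp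
      finally show ?thesis .
    qed
    have cN: "real (card J) \<le> N" unfolding N_def by (simp add: card_mono)
    have th: "\<bar>theta P x\<bar> \<le> N * ?r"
    proof -
      have "theta P x \<le> (\<Sum>i\<in>J. max (gh i x) 0)" by (rule theta_bounds(2)[OF xU])
      also have "\<dots> \<le> (\<Sum>i\<in>J. ?r)"
      proof (rule sum_mono)
        fix i assume "i \<in> J"
        show "max (gh i x) 0 \<le> ?r" using gr[of i] n(6)[OF w \<open>i \<in> J\<close>] n(2) by (cases "i \<in> I") auto
      qed
      also have "\<dots> \<le> N * ?r" using cN by (simp add: mult_right_mono)
      finally show ?thesis using theta_bounds(3)[of x] by simp
    qed
    have p1: "norm (phi1 P (x, mass x v, V)) \<le> ?r"
      using phi_carried(1)[OF car, of V] norm_proj_le(1)[of "res \<mu> ?w"] by (simp add: vm res_def central_value_def)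
    have p2: "\<bar>phi2 P (x, mass x v, V)\<bar> \<le> N * B * ?r"
    proof -
      have "\<bar>phi2 P (x, mass x v, V)\<bar> \<le> (\<Sum>i\<in>J. \<bar>v $ i * gh i x\<bar>)"
        unfolding phi_carried(2)[OF car] vm by (rule sum_abs)
      also have "\<dots> \<le> (\<Sum>i\<in>J. B * ?r)"
      proof (rule sum_mono)
        fix i assume "i \<in> J"
        show "\<bar>v $ i * gh i x\<bar> \<le> B * ?r"
        proof (cases "i \<in> I")
          case True then show ?thesis
            using n(7)[OF w, of i] gr[OF True] by (simp add: abs_mult mult_mono)
        next
          case False then show ?thesis using v0 n(3) by simp
        qed
      qed
      also have "\<dots> \<le> N * (B * ?r)" using cN n(3) by (simp add: mult_right_mono)
      finally show ?thesis by (simp add: mult.assoc)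
    qed
    have p3: "norm (phi3 P \<mu> (x, mass x v, V)) \<le> ?r"
      unfolding norm_phi3[OF sV] using third_le[of ?w \<mu>] by simp
    have "Rres P \<mu> (x, mass x v, V) \<le> (N + 1 + N * B + 1) * ?r"
      using Rres_le[of \<mu> "(x, mass x v, V)"] th p1 p2 p3 by (simp add: algebra_simps)
    then have "(x, mass x v, V) \<in> Nset P \<mu> e" unfolding Nset_def using mf(1) pF pV le by simp
    then show "x \<in> U \<and> (\<forall>i\<in>J. 0 \<le> v $ i) \<and> (x, mass x v, V) \<in> Nset P \<mu> e" using xU vnn by simp
  qed
qed

end

section \<open>The barrier parameters and the tolerances\<close>

context
  fixes a :: params assumes wfa: "wf_params a"
begin

lemma mu_pos: "0 < mu a k"
  using wfa by (induction k) (auto simp: wf_params_def)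

lemma mu_tendsto: "mu a \<longlonglongrightarrow> 0"
proof (rule Lim_null_comparison)
  have "mu a k \<le> mu0 a * beta a ^ k" for k
  proof (induction k)
    case (Suc k)
    have "mu a (Suc k) \<le> beta a * mu a k" by simp
    also have "\<dots> \<le> beta a * (mu0 a * beta a ^ k)" using Suc wfa by (intro mult_left_mono) (auto simp: wf_params_def)
    finally show ?case by (simp add: mult_ac)
  qed simp
  then show "\<forall>\<^sub>F k in sequentially. norm (mu a k) \<le> mu0 a * beta a ^ k"
    using mu_pos by (auto simp: abs_of_pos)
  have "(\<lambda>k. beta a ^ k) \<longlonglongrightarrow> 0" using wfa by (intro LIMSEQ_realpow_zero) (auto simp: wf_params_def)
  then show "(\<lambda>k. mu0 a * beta a ^ k) \<longlonglongrightarrow> 0" by (rule tendsto_mult_right_zero)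
qed

lemma mu_powr_tendsto: "0 < p \<Longrightarrow> (\<lambda>k. mu a k powr p) \<longlonglongrightarrow> 0"
  using mu_pos by (intro tendsto_zero_powrI[OF mu_tendsto tendsto_const]) (auto intro!: always_eventually less_imp_le)

lemma mu_powr_smallo:
  assumes "q < p" shows "(\<lambda>k. mu a k powr p) \<in> o(\<lambda>k. mu a k powr q)"
proof (rule smalloI_tendsto)
  have "(\<lambda>k. mu a k powr p / mu a k powr q) = (\<lambda>k. mu a k powr (p - q))"
    by (simp add: powr_diff)
  then show "(\<lambda>k. mu a k powr p / mu a k powr q) \<longlonglongrightarrow> 0" using mu_powr_tendsto[of "p - q"] assms by simp
  show "\<forall>\<^sub>F k in sequentially. mu a k powr q \<noteq> 0" using mu_pos by (auto simp: less_imp_neq[symmetric])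
qed

lemma mu_powr_1: "(\<lambda>k. mu a k powr 1) = mu a" using mu_pos by (simp add: less_imp_le)

abbreviation (input) "\<nu> \<equiv> 1 + cpar a * alpha a"

text \<open>
  The last inequality compares the exponents of \<open>m\<close> in the new tolerance and in \<open>e\<^sup>2 / \<mu>\<close>; it is equivalent to
  \<open>c * (\<alpha> + 2) \<le> 1\<close>.
\<close>

lemma exponents: "0 < alpha a" "alpha a < 1" "1 < \<nu>" "\<nu> < 1 + alpha a" "\<nu> < 4 / 3"
  "\<nu> * (1 + alpha a) \<le> 2 * (1 + alpha a) - \<nu>"
proof -
  have w: "0 < alpha a" "alpha a < 1" "0 < cpar a" "cpar a \<le> 1 / (alpha a + 2)" using wfa by (auto simp: wf_params_def)
  show "0 < alpha a" "alpha a < 1" "1 < \<nu>" using w by auto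
  have c: "cpar a * (alpha a + 2) \<le> 1" using w by (simp add: field_simps)
  have "cpar a * 2 < cpar a * (alpha a + 2)" using w by (intro mult_strict_left_mono) auto
  then have "cpar a < 1 / 2" using c by simp
  then have "cpar a * alpha a < 1 * alpha a" using w by (intro mult_strict_right_mono) auto
  then show "\<nu> < 1 + alpha a" by simp
  have "cpar a * alpha a * 3 \<le> cpar a * (alpha a + 2)"
    using w mult_left_mono[of "3 * alpha a" "alpha a + 2" "cpar a"] by simp
  moreover have "cpar a * (3 * alpha a) < cpar a * (alpha a + 2)" using w by (intro mult_strict_left_mono) auto
  ultimately show "\<nu> < 4 / 3" using c by simp
  have "alpha a * (cpar a * (alpha a + 2)) \<le> alpha a * 1" using c w by (intro mult_left_mono) auto
  then show "\<nu> * (1 + alpha a) \<le> 2 * (1 + alpha a) - \<nu>" by (simp add: algebra_simps)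
qed

lemma gammas: "0 < gamma1 a" "0 < gamma2 a" "0 < beta a" using wfa by (auto simp: wf_params_def)

text \<open>
  In the minimum defining the next parameter the superlinear term eventually wins.
\<close>

lemma mu_Suc_eventually: "\<forall>\<^sub>F k in sequentially. mu a (Suc k) = gamma2 a * mu a k powr \<nu>"
proof -
  have "(\<lambda>k. gamma2 a * mu a k powr (\<nu> - 1)) \<longlonglongrightarrow> 0"
    using exponents by (intro tendsto_mult_right_zero mu_powr_tendsto) simp
  from order_tendstoD(2)[OF this gammas(3)] show ?thesis
  proof eventually_elim
    case (elim k)
    have "mu a k powr \<nu> = mu a k powr (\<nu> - 1) * mu a k powr 1"
      by (simp only: powr_add[symmetric]) (simp add: add.commute)
    also have "mu a k powr 1 = mu a k" using mu_pos[of k] by simp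
    finally have "gamma2 a * mu a k powr \<nu> = gamma2 a * mu a k powr (\<nu> - 1) * mu a k" by simp
    also have "\<dots> \<le> beta a * mu a k" using elim mu_pos[of k] by (intro mult_right_mono) auto
    finally show ?case by simp
  qed
qed

lemma mu_Suc_bigtheta: "(\<lambda>k. mu a (Suc k)) \<in> O(\<lambda>k. mu a k powr \<nu>)" "(\<lambda>k. mu a k powr \<nu>) \<in> O(\<lambda>k. mu a (Suc k))"
proof -
  show "(\<lambda>k. mu a (Suc k)) \<in> O(\<lambda>k. mu a k powr \<nu>)"
    by (rule bigoI[of _ "gamma2 a"], rule eventually_mono[OF mu_Suc_eventually]) (use gammas in auto)
  show "(\<lambda>k. mu a k powr \<nu>) \<in> O(\<lambda>k. mu a (Suc k))"
    by (rule bigoI[of _ "1 / gamma2 a"], rule eventually_mono[OF mu_Suc_eventually]) (use gammas in auto)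
qed

lemma mu_Suc_small: "(\<lambda>k. mu a (Suc k)) \<in> o(mu a)"
  using landau_o.big_small_trans[OF mu_Suc_bigtheta(1) mu_powr_smallo[OF exponents(3)]] unfolding mu_powr_1 .

lemma eps_small: "eps a \<in> o(\<lambda>k. mu a (Suc k))"
proof -
  have "(\<lambda>k. gamma1 a * mu a k powr (1 + alpha a)) \<in> o(\<lambda>k. mu a (Suc k))"
    using landau_o.small_big_trans[OF mu_powr_smallo[OF exponents(4)] mu_Suc_bigtheta(2)] by simp
  then show ?thesis by (simp add: eps_def[abs_def])
qed

lemma eps_pos: "0 < eps a k" using mu_pos[of k] gammas by (simp add: eps_def)

lemma mu_sq_small: "(\<lambda>k. (mu a k)\<^sup>2) \<in> o(eps a)"
proof -
  have "(\<lambda>k. (mu a k)\<^sup>2) = (\<lambda>k. mu a k powr 2)" using mu_pos by (simp add: powr_numeral less_imp_le)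
  moreover have "(\<lambda>k. mu a k powr 2) \<in> o(\<lambda>k. gamma1 a * mu a k powr (1 + alpha a))"
    using mu_powr_smallo[of "1 + alpha a" 2] exponents gammas by simp
  ultimately show ?thesis by (simp add: eps_def[abs_def])
qed

lemma eps_Suc_lower: "(\<lambda>k. (eps a k)\<^sup>2 / mu a (Suc k)) \<in> O(\<lambda>k. eps a (Suc k))"
proof (rule bigoI)
  let ?C = "(gamma1 a)\<^sup>2 / gamma2 a / (gamma1 a * gamma2 a powr (1 + alpha a))"
  have "\<forall>\<^sub>F k in sequentially. mu a k < 1" using mu_tendsto by (rule order_tendstoD(2)) simp
  then show "\<forall>\<^sub>F k in sequentially. norm ((eps a k)\<^sup>2 / mu a (Suc k)) \<le> ?C * norm (eps a (Suc k))"
    using mu_Suc_eventually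
  proof eventually_elim
    case (elim k)
    have m: "0 < mu a k" "mu a k \<le> 1" using elim mu_pos by (auto intro: less_imp_le)
    have "(eps a k)\<^sup>2 / mu a (Suc k) = (gamma1 a)\<^sup>2 / gamma2 a * ((mu a k powr (1 + alpha a))\<^sup>2 / mu a k powr \<nu>)"
      unfolding eps_def elim(2) by (simp add: power_mult_distrib)
    also have "(mu a k powr (1 + alpha a))\<^sup>2 / mu a k powr \<nu> = mu a k powr (2 * (1 + alpha a) - \<nu>)"
      by (simp only: power2_eq_square powr_add[symmetric] powr_diff[symmetric] mult_2)
    also have "\<dots> \<le> mu a k powr (\<nu> * (1 + alpha a))"
      using m by (intro powr_mono' exponents(6)) auto
    finally have "(eps a k)\<^sup>2 / mu a (Suc k) \<le> (gamma1 a)\<^sup>2 / gamma2 a * mu a k powr (\<nu> * (1 + alpha a))"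
      using gammas by (simp add: mult_left_mono divide_right_mono)
    moreover have "eps a (Suc k) = gamma1 a * gamma2 a powr (1 + alpha a) * mu a k powr (\<nu> * (1 + alpha a))"
      unfolding eps_def elim(2) using gammas m by (simp add: powr_mult powr_powr)
    then have "?C * eps a (Suc k) = (gamma1 a)\<^sup>2 / gamma2 a * mu a k powr (\<nu> * (1 + alpha a))"
      using gammas by (simp add: field_simps)
    ultimately show ?case using eps_pos[of "Suc k"] mu_pos[of "Suc k"] by simp
  qed
qed

end

section \<open>Convergence of the algorithm\<close>

context limit_point
begin

lemma take_step_full:
  assumes "posdef (FF w)" "posdef (VV w)" "symm (VV d)" "posdef (FF (w + d))" "posdef (VV (w + d))"
  shows "take_step P \<delta> w d = w + d"
proof -
  have "steplen \<delta> (FF w) (Flin P (fst d)) = 1"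
    using assms by (intro steplen_full symm_FF) (simp_all add: Fmap_add)
  moreover have "steplen \<delta> (VV w) (VV d) = 1" using assms by (intro steplen_full) simp_all
  ultimately show ?thesis by (simp add: take_step_def split_def prod_eq_iff)
qed

lemma direction_inactive:
  assumes "direction \<mu> w d" "i \<notin> I" shows "fst (snd (w + d)) $ i = 0"
proof -
  have "fst (snd (Psi w + DPsi w d)) $ i = 0" using assms(1) unfolding direction_def by (simp add: central_value_def third_component_def)
  then show ?thesis using assms(2) by (simp add: Psi_def DPsi_def split_def)
qed

lemma inactive_vecs: assumes "\<And>i. i \<notin> I \<Longrightarrow> v $ i = 0" shows "v \<in> vecs J"
  unfolding vecs_def using assms I_J by blast

lemma step22_direction:
  assumes "fst w \<in> U" "fst (snd w) \<in> vecs J" "posdef (FF w)"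
  shows "step22 P r \<mu> xs I w d \<longleftrightarrow> direction \<mu> w d"
proof -
  have "(0, 0, \<mu> *\<^sub>R mat 1 - pert_at w d) = central_value \<mu> - third_component (pert_at w d)" by (simp add: central_value_def third_component_def)
  then show ?thesis
    using step22_iff[OF assms, of \<mu> "VV w" "fst d" "fst (snd d)" "VV d"]
    by (simp add: direction_def pert_at_def)
qed

text \<open>
  The reduction at \<open>xb\<close> agrees with the one at the limit.
\<close>

definition same_base :: "real^'n \<Rightarrow> bool" where
  "same_base xb \<longleftrightarrow> nbhd r xb = U \<and> idx r xb = J \<and> (\<forall>i\<in>J. \<forall>x\<in>U. tau r xb i x = tt i x)"

lemma step22_base:
  assumes sb: "same_base xb" and x: "fst w \<in> U"
  shows "step22 P r \<mu> xb I w d \<longleftrightarrow> step22 P r \<mu> xs I w d"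
proof -
  note b = sb[unfolded same_base_def]
  have "newton_a P r xb w d \<longleftrightarrow> newton_a P r xs w d"
    using base_change(1)[of xb "fst w" "fst (snd w)" "VV w" d] b x by simp
  moreover have "lin_ghat P r xb (fst w) dx i = lin_ghat P r xs (fst w) dx i" if "i \<in> J" for i dx
    using base_change(2)[of xb "fst w"] b x that by blast
  ultimately show ?thesis
    using b I_J unfolding step22_def split_def by (simp add: prod.collapse)
qed

text \<open>
  All terms of the complementarity sum are nonpositive, so each is 0. Where the linearized constraint does not vanish, the
  new mass does; the first half step thus solves the equations of the second one.
\<close>

lemma step21_imp_direction:
  assumes sb: "same_base (fst w)" and x: "fst w \<in> U" and y: "fst (snd w) \<in> vecs J" and F: "posdef (FF w)"
    and s: "step21 P r \<mu> (fst w) w d" and act: "Jact P r (fst w) d = I"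
  shows "direction \<mu> w d"
proof -
  have id: "idx r (fst w) = J" using sb by (simp add: same_base_def)
  let ?l = "\<lambda>i. lin_ghat P r (fst w) (fst w) (fst d) i" and ?y = "\<lambda>i. fst (snd w) $ i + fst (snd d) $ i"
  have s': "fst (snd d) \<in> vecs J" "symm (VV d)" "newton_a P r (fst w) w d" "newton_b P \<mu> w d"
    "\<And>i. i \<in> J \<Longrightarrow> 0 \<le> ?y i \<and> ?l i \<le> 0" "(\<Sum>i\<in>J. ?y i * ?l i) = 0"
    using s unfolding step21_def split_def id by (auto simp: prod.collapse)
  have "(\<Sum>i\<in>J. - (?y i * ?l i)) = 0" using s'(6) by (simp add: sum_negf)
  then have z: "?y i * ?l i = 0" if "i \<in> J" for i
    using s'(5) that by (subst (asm) sum_nonneg_eq_0_iff) (auto simp: mult_nonneg_nonpos)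
  have l0: "?l i = 0 \<longleftrightarrow> i \<in> I" if "i \<in> J" for i using act that unfolding Jact_def id by blast
  have "step22 P r \<mu> (fst w) I w d"
    unfolding step22_def split_def id using s'(1-4) l0 I_J z by (auto simp: prod.collapse)
  then show ?thesis using step22_base[OF sb x] step22_direction[OF x y F] by blast
qed

lemma carriedI:
  assumes "x \<in> U" "inj_on (\<lambda>i. tt i x) J" "y \<in> Mplus P" "discrete_measure P y" "msupp P y \<subseteq> (\<lambda>i. tt i x) ` J"
  shows "carried x y"
proof -
  have y: "sets y = sets RT" "finite_measure y" using assms(3) by (auto simp: Mplus_def)
  have f: "finite (msupp P y)" "msupp P y \<subseteq> T" using assms(5) by (auto simp: msupp_def dest: finite_subset)
  have sp: "space y = T" using sets_eq_imp_space_eq[OF y(1)] space_R by simp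
  have "T - msupp P y \<in> sets y" using finite_sets_R[OF f] sets.compl_sets[of "msupp P y" y] by (simp add: y sp)
  then have "emeasure y (T - (\<lambda>i. tt i x) ` J) \<le> emeasure y (T - msupp P y)"
    using assms(5) by (intro emeasure_mono) auto
  then show ?thesis using assms y by (simp add: carried_def discrete_measure_def)
qed

lemma norm_coords_diff:
  assumes "symm V" "symm V'"
  shows "norm ((x, v, svec V) - (x', v', svec V')) = norm ((x, v, V) - (x', v', V'))"
proof -
  have "norm (svec V - svec V') = norm (V - V')"
    using norm_svec[of "V - V'"] assms by (simp add: linear_diff[OF linear_svec]) blast
  then show ?thesis by (simp add: norm_prod_def)
qed

lemma to_vec_masses: "to_vec r xs (x, y, V) = (x, masses x y, V)"
  by (simp add: to_vec_def masses_def)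

lemma of_vec_mass:
  assumes "same_base xb" "x \<in> U"
  shows "of_vec P r xb (x, v, V) = (x, mass x v, V)"
proof -
  have "(\<lambda>A. \<Sum>i\<in>idx r xb. ennreal (v $ i) * indicator A (tau r xb i x)) = (\<lambda>A. \<Sum>i\<in>J. ennreal (v $ i) * indicator A (tt i x))"
    using assms by (intro ext sum.cong) (auto simp: same_base_def)
  then show ?thesis by (simp add: of_vec_def mass_def)
qed

lemma to_vec_base:
  assumes "same_base xb" "fst w \<in> U" shows "to_vec r xb w = to_vec r xs w"
proof -
  obtain x y V where w: "w = (x, y, V)" by (metis prod.exhaust)
  have "x \<in> U" using assms(2) w by simp
  then have e: "tau r xb i x = tt i x" if "i \<in> J" for i using assms(1) that unfolding same_base_def by blast
  have id: "idx r xb = J" using assms(1) by (simp add: same_base_def)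
  show ?thesis by (simp add: w to_vec_def e id vec_eq_iff)
qed

context
  fixes a w dh d1 ym
  assumes wfa: "wf_params a" and alg: "algorithm2 P \<sigma> r a w dh d1"
    and lim: "(\<lambda>k. coords r xs (w k)) \<longlonglongrightarrow> coords r xs (xs, ym, Vs)" and ys: "ys = masses xs ym"
    and base: "\<forall>\<^sub>F k in sequentially. same_base (fst (w k)) \<and> discrete_measure P (fst (snd (w k))) \<and>
        msupp P (fst (snd (w k))) \<subseteq> (\<lambda>i. tt i (fst (w k))) ` J"
    and act: "\<forall>\<^sub>F k in sequentially. Jact P r (fst (w k)) (dh k) = I"
begin

text \<open>
  The index is shifted by one because only the iterates from \<open>w 1\<close> on are known to lie in a neighbourhood of the central path.
\<close>

abbreviation "Wk k \<equiv> to_vec r xs (w (Suc k))"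
abbreviation "D1k k \<equiv> dh (Suc k)"
abbreviation "D2k k \<equiv> d1 (Suc k)"

lemma to_vec_parts: "fst (to_vec r xs z) = fst z" "fst (snd (to_vec r xs z)) = masses (fst z) (fst (snd z))"
  "snd (snd (to_vec r xs z)) = snd (snd z)"
  using to_vec_masses[of "fst z" "fst (snd z)" "snd (snd z)"] by simp_all

lemma iterate_in_Nset: "w (Suc k) \<in> Nset P (mu a k) (eps a k)"
proof (cases "step23_accepts P r a k (w k) (dh k) (d1 k)")
  case True
  then have eq: "w (Suc k) = of_vec P r (fst (w k)) (trial_point P r a (w k) (dh k) (d1 k))"
    using alg unfolding algorithm2_def by presburger
  obtain x v V where t: "trial_point P r a (w k) (dh k) (d1 k) = (x, v, V)" by (metis prod.exhaust)
  show ?thesis using True unfolding eq step23_accepts_def t by simp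
next
  case False
  then show ?thesis using alg unfolding algorithm2_def by presburger
qed

lemma iterate_parts: "fst (snd (w (Suc k))) \<in> Mplus P" "posdef (VV (Wk k))" "posdef (FF (Wk k))"
    "Rres P (mu a k) (w (Suc k)) \<le> eps a k" "symm (VV (Wk k))"
  using iterate_in_Nset[of k] by (auto simp: Nset_def to_vec_parts posdef_def)

lemma coords_diff: "err r w (xs, ym, Vs) (Suc k) = norm (Wk k - ws)"
proof -
  have c: "coords r xs z = (fst z, masses (fst z) (fst (snd z)), svec (snd (snd z)))" for z
    unfolding coords_def using to_vec_masses[of "fst z" "fst (snd z)" "snd (snd z)"] by simp
  have W: "Wk k = (fst (w (Suc k)), masses (fst (w (Suc k))) (fst (snd (w (Suc k)))), snd (snd (w (Suc k))))"
    using to_vec_masses[of "fst (w (Suc k))" "fst (snd (w (Suc k)))" "snd (snd (w (Suc k)))"] by simp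
  show ?thesis
    unfolding err_def fst_conv c W snd_conv ys
    by (rule norm_coords_diff) (use iterate_parts(5)[of k] symY in \<open>simp_all add: to_vec_parts\<close>)
qed

lemma err_tendsto: "err r w (xs, ym, Vs) \<longlonglongrightarrow> 0"
  unfolding err_def[abs_def] fst_conv using lim by (simp add: LIM_zero tendsto_norm_zero)

lemma Wk_tendsto: "Wk \<longlonglongrightarrow> ws"
proof -
  have "(\<lambda>k. norm (Wk k - ws)) \<longlonglongrightarrow> 0" using LIMSEQ_Suc[OF err_tendsto] unfolding coords_diff .
  then show ?thesis by (simp add: LIM_zero_cancel tendsto_norm_zero_iff)
qed

lemma iterates_carried: "\<forall>\<^sub>F k in sequentially. same_base (fst (w (Suc k))) \<and> fst (w (Suc k)) \<in> U \<and>
    inj_on (\<lambda>i. tt i (fst (w (Suc k)))) J \<and> carried (fst (w (Suc k))) (fst (snd (w (Suc k))))"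
proof -
  have f: "(\<lambda>k. fst (w (Suc k))) \<longlonglongrightarrow> xs" using tendsto_fst[OF Wk_tendsto] by (simp add: to_vec_parts)
  have "\<forall>\<^sub>F k in sequentially. inj_on (\<lambda>i. tt i (fst (w (Suc k)))) J"
    by (rule eventually_compose_filterlim[OF eventually_inj f])
  moreover have "\<forall>\<^sub>F k in sequentially. fst (w (Suc k)) \<in> U" using f openU xsU by (rule topological_tendstoD)
  moreover note eventually_sequentially_Suc[THEN iffD2, OF base]
  ultimately show ?thesis
  proof eventually_elim
    case (elim k)
    then show ?case using carriedI[of "fst (w (Suc k))" "fst (snd (w (Suc k)))"] iterate_parts(1)[of k] by blast
  qed
qed

lemma masses_vecs: "masses x y \<in> vecs J" by (simp add: vecs_def masses_def)

lemma iterate_stage: "stage Wk (mu a) (eps a)"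
  unfolding stage_def
proof (intro conjI)
  show "\<forall>\<^sub>F k in sequentially. symm (VV (Wk k)) \<and> 0 < mu a k \<and> 0 < eps a k"
    using iterate_parts(5) mu_pos[OF wfa] eps_pos[OF wfa] by simp
  show "Wk \<longlonglongrightarrow> ws" by (rule Wk_tendsto)
  show "mu a \<longlonglongrightarrow> 0" by (rule mu_tendsto[OF wfa])
  show "eps a \<in> o(mu a)" by (rule landau_o.small_trans[OF eps_small[OF wfa] mu_Suc_small[OF wfa]])
  obtain \<rho> K where r: "0 < \<rho>"
    "\<And>x y V m e. (x, masses x y, V) \<in> cball ws \<rho> \<Longrightarrow> carried x y \<Longrightarrow> symm V \<Longrightarrow> Rres P m (x, y, V) \<le> e
       \<Longrightarrow> norm (res m (x, masses x y, V)) \<le> K * e"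
    by (rule residual_of_iterate) blast
  have "\<forall>\<^sub>F k in sequentially. norm (norm (res (mu a k) (Wk k))) \<le> K * norm (eps a k)"
    using eventually_cball[OF Wk_tendsto r(1)] iterates_carried
  proof eventually_elim
    case (elim k)
    obtain x y V where w: "w (Suc k) = (x, y, V)" by (metis prod.exhaust)
    have W: "Wk k = (x, masses x y, V)" unfolding w by (rule to_vec_masses)
    have "norm (res (mu a k) (x, masses x y, V)) \<le> K * eps a k"
      using elim iterate_parts(4,5)[of k] by (intro r(2)) (simp_all add: w W to_vec_masses)
    then show ?case using eps_pos[OF wfa, of k] by (simp add: W)
  qed
  then show "(\<lambda>k. norm (res (mu a k) (Wk k))) \<in> O(eps a)" by (rule bigoI)
qed

lemma step21_direction_eventually: "\<forall>\<^sub>F k in sequentially. direction (mu a (Suc k)) (Wk k) (D1k k)"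
  using iterates_carried eventually_sequentially_Suc[THEN iffD2, OF act]
proof eventually_elim
  case (elim k)
  have f: "fst (Wk k) = fst (w (Suc k))" by (rule to_vec_parts)
  have "step21 P r (mu a (Suc k)) (fst (w (Suc k))) (to_vec r (fst (w (Suc k))) (w (Suc k))) (dh (Suc k))"
    using alg unfolding algorithm2_def by blast
  then have "step21 P r (mu a (Suc k)) (fst (Wk k)) (Wk k) (D1k k)"
    using to_vec_base[of "fst (w (Suc k))" "w (Suc k)"] elim f by simp
  moreover have "fst (snd (Wk k)) \<in> vecs J" unfolding to_vec_parts by (rule masses_vecs)
  ultimately show ?case
    using elim iterate_parts(3)[of k] by (intro step21_imp_direction) (simp_all only: f)
qed

lemmas iterate_rates = iterate_stage step21_direction_eventually always_eventually[OF allI[OF mu_pos[OF wfa, of "Suc _"]]]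
  mu_Suc_small[OF wfa] eps_small[OF wfa] mu_sq_small[OF wfa]

abbreviation "Xk k \<equiv> Wk k + D1k k"

lemma half_stage_k: "stage Xk (\<lambda>k. mu a (Suc k)) (eps a)"
  by (rule half_stage[OF iterate_rates])

lemma half_point_eventually: "\<forall>\<^sub>F k in sequentially. half_point P r a (w (Suc k)) (D1k k) = Xk k \<and>
    posdef (FF (Xk k)) \<and> posdef (VV (Xk k)) \<and> fst (Xk k) \<in> U \<and> fst (snd (Xk k)) \<in> vecs J \<and> (\<forall>i. i \<notin> I \<longrightarrow> fst (snd (Xk k)) $ i = 0)"
proof -
  obtain b where pd: "\<forall>\<^sub>F k in sequentially. posdef (FF (Xk k)) \<and> posdef (VV (Xk k)) \<and> coercive (b * mu a (Suc k)) (FF (Xk k))"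
    by (rule stage_posdef[OF half_stage_k])
  obtain \<rho> where b: "0 < \<rho>" "\<And>w. w \<in> cball ws \<rho> \<Longrightarrow> fst w \<in> U" by (rule local_bounds) blast
  show ?thesis
    using pd eventually_cball[OF stageD(2)[OF half_stage_k] b(1)] step21_direction_eventually iterates_carried
  proof eventually_elim
    case (elim k)
    have d: "symm (VV (D1k k))" using elim(3) by (simp add: direction_def)
    have p: "posdef (FF (Xk k))" "posdef (VV (Xk k))" using elim(1) by blast+
    have "take_step P (delta a) (Wk k) (D1k k) = Xk k"
      by (rule take_step_full[OF iterate_parts(3,2) d p])
    moreover have "to_vec r (fst (w (Suc k))) (w (Suc k)) = Wk k" using to_vec_base elim(4) by blast
    ultimately have "half_point P r a (w (Suc k)) (D1k k) = Xk k" by (simp only: half_point_def)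
    moreover have "fst (snd (Xk k)) $ i = 0" if "i \<notin> I" for i by (rule direction_inactive[OF elim(3) that])
    moreover from this have "fst (snd (Xk k)) \<in> vecs J" by (rule inactive_vecs)
    ultimately show ?case using p b(2)[OF elim(2)] by blast
  qed
qed

lemma step22_direction_eventually: "\<forall>\<^sub>F k in sequentially. direction (mu a (Suc k)) (Xk k) (D2k k) \<and>
   step22_direction P r a (Suc k) (w (Suc k)) (D1k k) (D2k k)"
  using half_point_eventually iterates_carried eventually_sequentially_Suc[THEN iffD2, OF act] direction_exists[OF half_stage_k, of "\<lambda>k. mu a (Suc k)"]
proof eventually_elim
  case (elim k)
  have h: "half_point P r a (w (Suc k)) (D1k k) = Xk k" and xU: "fst (Xk k) \<in> U" and y: "fst (snd (Xk k)) \<in> vecs J"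
    and F: "posdef (FF (Xk k))" using elim(1) by blast+
  have sb: "same_base (fst (w (Suc k)))" using elim(2) by blast
  have "nbhd r (fst (w (Suc k))) = U" using sb by (simp add: same_base_def)
  then have iff: "step22_direction P r a (Suc k) (w (Suc k)) (D1k k) d \<longleftrightarrow> direction (mu a (Suc k)) (Xk k) d" for d
    unfolding step22_direction_def h elim(3) using xU step22_base[OF sb xU] step22_direction[OF xU y F] by blast
  have "(\<exists>d. step22_direction P r a (Suc k) (w (Suc k)) (D1k k) d) \<longrightarrow>
      step22_direction P r a (Suc k) (w (Suc k)) (D1k k) (D2k k)"
    using alg unfolding algorithm2_def by blast
  then show ?case using elim(4) unfolding iff by blast
qed

lemma step22_only: "\<forall>\<^sub>F k in sequentially. direction (mu a (Suc k)) (Xk k) (D2k k)"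
  using step22_direction_eventually by eventually_elim blast

lemmas trial_facts = trial_stage[OF iterate_rates step22_only] trial_residual[OF iterate_rates step22_only]

abbreviation "Yk k \<equiv> Xk k + D2k k"

lemma accepted_eventually: "\<forall>\<^sub>F k in sequentially. step23_accepts P r a (Suc k) (w (Suc k)) (D1k k) (D2k k)"
proof -
  obtain \<rho> K where t: "0 < \<rho>" "0 < K"
    "\<And>x v V \<mu> e. (x, v, V) \<in> cball ws \<rho> \<Longrightarrow> inj_on (\<lambda>i. tt i x) J \<Longrightarrow> (\<And>i. i \<notin> I \<Longrightarrow> v $ i = 0) \<Longrightarrow>
       posdef (Fmap P x) \<Longrightarrow> posdef V \<Longrightarrow> K * norm (res \<mu> (x, v, V)) \<le> e
       \<Longrightarrow> x \<in> U \<and> (\<forall>i\<in>J. 0 \<le> v $ i) \<and> (x, mass x v, V) \<in> Nset P \<mu> e"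
    by (rule trial_in_Nset) blast
  obtain b where pd: "\<forall>\<^sub>F k in sequentially. posdef (FF (Yk k)) \<and> posdef (VV (Yk k)) \<and> coercive (b * mu a (Suc k)) (FF (Yk k))"
    by (rule stage_posdef[OF trial_facts(1)])
  note lim = stageD(2)[OF trial_facts(1)]
  have "(\<lambda>k. fst (Yk k)) \<longlonglongrightarrow> xs" using tendsto_fst[OF lim] by simp
  note inj = eventually_compose_filterlim[OF eventually_inj this]
  have "0 < 1 / K" using t(2) by simp
  from landau_o.smallD[OF landau_o.small_big_trans[OF trial_facts(2) eps_Suc_lower[OF wfa]] this]
  have "\<forall>\<^sub>F k in sequentially. norm (norm (res (mu a (Suc k)) (Yk k))) \<le> 1 / K * norm (eps a (Suc k))" .
  then show ?thesis
    using pd inj eventually_cball[OF lim t(1)] half_point_eventually step22_direction_eventually iterates_carried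
  proof eventually_elim
    case (elim k)
    obtain x v V where Y: "Yk k = (x, v, V)" by (metis prod.exhaust)
    have h: "half_point P r a (w (Suc k)) (D1k k) = Xk k" and pX: "posdef (FF (Xk k))" "posdef (VV (Xk k))"
      using elim(5) by blast+
    have d: "direction (mu a (Suc k)) (Xk k) (D2k k)" using elim(6) by blast
    then have d': "symm (VV (D2k k))" by (simp add: direction_def)
    have pY: "posdef (FF (Yk k))" "posdef (VV (Yk k))" using elim(2) by blast+
    have "take_step P (delta a) (Xk k) (D2k k) = Yk k" by (rule take_step_full[OF pX d' pY])
    then have tr: "trial_point P r a (w (Suc k)) (D1k k) (D2k k) = (x, v, V)"
      unfolding trial_point_def h Y .
    have "K * norm (res (mu a (Suc k)) (Yk k)) \<le> eps a (Suc k)"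
      using elim(1) t(2) eps_pos[OF wfa, of "Suc k"] by (simp add: field_simps)
    moreover have "fst (snd (Yk k)) $ i = 0" if "i \<notin> I" for i by (rule direction_inactive[OF d that])
    ultimately have N: "x \<in> U \<and> (\<forall>i\<in>J. 0 \<le> v $ i) \<and> (x, mass x v, V) \<in> Nset P (mu a (Suc k)) (eps a (Suc k))"
      using elim(3,4) pY unfolding Y fst_conv snd_conv by (intro t(3)) auto
    have sb: "same_base (fst (w (Suc k)))" using elim(7) by blast
    have ov: "of_vec P r (fst (w (Suc k))) (x, v, V) = (x, mass x v, V)"
      by (rule of_vec_mass[OF sb]) (use N in blast)
    show ?case
      unfolding step23_accepts_def tr split using elim(6) N sb ov by (simp add: same_base_def)
  qed
qed

text \<open>
  Once \<open>stage_dist\<close> is known for the iterates, the rate is that of the barrier parameters; it does not depend on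
  the way in which the next iterate was found.
\<close>

lemma superlinear_convergence:
  "(\<forall>\<^sub>F k in sequentially.
      step23_accepts P r a k (w k) (dh k) (d1 k) \<and>
      w (Suc k) = of_vec P r (fst (w k)) (trial_point P r a (w k) (dh k) (d1 k))) \<and>
   (\<lambda>k. err r w (xs, ym, Vs) (Suc k)) \<in> O(\<lambda>k. err r w (xs, ym, Vs) k powr (1 + cpar a * alpha a)) \<and>
   err r w (xs, ym, Vs) \<longlonglongrightarrow> 0 \<and>
   (\<lambda>k. err r w (xs, ym, Vs) (Suc k)) \<in> o(err r w (xs, ym, Vs)) \<and>
   1 + cpar a * alpha a \<in> {1<..<4/3}"
proof (intro conjI)
  have "\<forall>\<^sub>F k in sequentially. step23_accepts P r a k (w k) (dh k) (d1 k)"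
    using eventually_sequentially_Suc[THEN iffD1, OF accepted_eventually] .
  then show "\<forall>\<^sub>F k in sequentially.
      step23_accepts P r a k (w k) (dh k) (d1 k) \<and>
      w (Suc k) = of_vec P r (fst (w k)) (trial_point P r a (w k) (dh k) (d1 k))"
  proof eventually_elim
    case (elim k)
    then show ?case using alg unfolding algorithm2_def by presburger
  qed
  let ?e = "err r w (xs, ym, Vs)" and ?p = "1 + cpar a * alpha a"
  have up: "(\<lambda>k. ?e (Suc k)) \<in> O(mu a)" and lo: "mu a \<in> O(\<lambda>k. ?e (Suc k))"
    unfolding coords_diff by (rule stage_dist[OF iterate_stage])+
  have up2: "(\<lambda>k. ?e (Suc (Suc k))) \<in> O(\<lambda>k. mu a (Suc k))"
  proof -
    obtain C where "\<forall>\<^sub>F k in sequentially. norm (?e (Suc k)) \<le> C * norm (mu a k)" using landau_o.bigE[OF up] by blast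
    then have "\<forall>\<^sub>F k in sequentially. norm (?e (Suc (Suc k))) \<le> C * norm (mu a (Suc k))"
      by (rule eventually_sequentially_Suc[THEN iffD2])
    then show ?thesis by (rule bigoI)
  qed
  have enn: "0 \<le> ?e k" for k by (simp add: err_def)
  have "(\<lambda>k. mu a k powr ?p) \<in> O(\<lambda>k. ?e (Suc k) powr ?p)"
  proof -
    obtain C where C: "0 < C" "\<forall>\<^sub>F k in sequentially. norm (mu a k) \<le> C * norm (?e (Suc k))" using landau_o.bigE[OF lo] by blast
    have "\<forall>\<^sub>F k in sequentially. norm (mu a k powr ?p) \<le> C powr ?p * norm (?e (Suc k) powr ?p)"
      using C(2)
    proof eventually_elim
      case (elim k)
      have "mu a k powr ?p \<le> (C * ?e (Suc k)) powr ?p"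
        using elim mu_pos[OF wfa, of k] enn exponents(3)[OF wfa] by (intro powr_mono2) auto
      then show ?case using C(1) enn by (simp add: powr_mult)
    qed
    then show ?thesis by (rule bigoI)
  qed
  from landau_o.big_trans[OF landau_o.big_trans[OF up2 mu_Suc_bigtheta(1)[OF wfa]] this]
  have "(\<lambda>k. ?e (Suc (Suc k))) \<in> O(\<lambda>k. ?e (Suc k) powr ?p)" .
  then obtain C where "\<forall>\<^sub>F k in sequentially. norm (?e (Suc (Suc k))) \<le> C * norm (?e (Suc k) powr ?p)"
    using landau_o.bigE by blast
  then have "\<forall>\<^sub>F k in sequentially. norm (?e (Suc k)) \<le> C * norm (?e k powr ?p)"
    by (rule eventually_sequentially_Suc[THEN iffD1])
  then show "(\<lambda>k. ?e (Suc k)) \<in> O(\<lambda>k. ?e k powr ?p)" by (rule bigoI)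
  show "?e \<longlonglongrightarrow> 0" by (rule err_tendsto)
  have s: "(\<lambda>k. ?e (Suc (Suc k))) \<in> o(\<lambda>k. ?e (Suc k))"
    by (rule landau_o.small_big_trans[OF landau_o.big_small_trans[OF up2 mu_Suc_small[OF wfa]] lo])
  show "(\<lambda>k. ?e (Suc k)) \<in> o(?e)"
  proof (rule landau_o.smallI)
    fix C :: real assume "0 < C"
    from landau_o.smallD[OF s this] have "\<forall>\<^sub>F k in sequentially. norm (?e (Suc (Suc k))) \<le> C * norm (?e (Suc k))" .
    then show "\<forall>\<^sub>F k in sequentially. norm (?e (Suc k)) \<le> C * norm (?e k)"
      by (rule eventually_sequentially_Suc[THEN iffD1])
  qed
  show "?p \<in> {1<..<4/3}" using exponents(3,5)[OF wfa] by simp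
qed

end

end

theorem theorem4:
  fixes P :: "('n::finite, 'm::{finite,linorder}, 'q::finite) sisdp"
    and \<sigma> :: real
    and r :: "('n, 'q, 'p::finite) reduction"
    and a :: params
    and w :: "nat \<Rightarrow> ('n, 'm, 'q) iterate"
    and dh d1 :: "nat \<Rightarrow> ('n, 'm, 'p) vpoint"
    and ws :: "('n, 'm, 'q) iterate"
  assumes "wf_sisdp P"
    and "0 < \<sigma>"
    and "wf_params a"
    and "algorithm2 P \<sigma> r a w dh d1"
    and "assumption_B P \<sigma> r w ws"
    and "assumption_C P r w dh ws"
  shows "(\<forall>\<^sub>F k in sequentially.
            step23_accepts P r a k (w k) (dh k) (d1 k) \<and>
            w (Suc k) = of_vec P r (fst (w k)) (trial_point P r a (w k) (dh k) (d1 k))) \<and>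
         (\<lambda>k. err r w ws (Suc k)) \<in> O(\<lambda>k. err r w ws k powr (1 + cpar a * alpha a)) \<and>
         err r w ws \<longlonglongrightarrow> 0 \<and>
         (\<lambda>k. err r w ws (Suc k)) \<in> o(err r w ws) \<and>
         1 + cpar a * alpha a \<in> {1<..<4/3}"
proof -
  obtain xs ym Vs where ws: "ws = (xs, ym, Vs)" by (metis prod.exhaust)
  note B = assms(5)[unfolded assumption_B_def ws fst_conv]
  interpret reduced_sisdp P \<sigma> r xs
    using assms(1,2) B assms(6)[unfolded assumption_C_def] by unfold_locales blast+
  have tv: "to_vec r xs (xs, ym, Vs) = (xs, masses xs ym, Vs)" by (simp add: to_vec_def masses_def)
  let ?ys = "masses xs ym"
  have SC: "posdef (Fmap P xs + Vs)" and sc: "\<And>i. i \<in> J \<Longrightarrow> - gh i xs + ?ys $ i > 0"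
    and act: "\<forall>\<^sub>F k in sequentially. Jact P r (fst (w k)) (dh k) = I"
    and D: "\<exists>D. (Phi0 P r xs has_derivative D) (at (xs, (\<chi> i. if i \<in> I then ?ys $ i else 0), svec Vs) within Phi0_space P r xs) \<and>
             bij_betw D (Phi0_space P r xs) (Phi0_space P r xs)"
    using assms(6) unfolding assumption_C_def ws fst_conv tv by auto
  have K: "KKT P (xs, ym, Vs)" using B by blast
  then have psd: "psd (Fmap P xs)" "psd Vs" "sprod (Fmap P xs) Vs = 0" by (simp_all add: KKT_def)
  note kp = KKT_Psi[OF K sc]
  have yeq: "(\<chi> i. if i \<in> I then ?ys $ i else 0) = ?ys" using kp(4) by (auto simp: vec_eq_iff)
  have sV: "symm Vs" using psd(2) by (simp add: psd_def)
  obtain Q c where Q: "complementary_pair (Fmap P xs) Vs Q c"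
    using complementary_pair_exists[OF psd SC] by blast
  interpret limit_point P \<sigma> r xs Vs Q c ?ys
  proof (rule limit_point.intro[OF _ Q], unfold_locales)
    show "Psi (xs, ?ys, Vs) = 0" by (rule kp(2))
    show "0 < ?ys $ i" if "i \<in> I" for i by (rule kp(3)[OF _ that])
    show "?ys $ i = 0" if "i \<notin> I" for i by (rule kp(4)[OF _ that])
    show "gh i xs < 0" if "i \<in> J" "i \<notin> I" for i by (rule kp(5)[OF _ that])
    fix h assume h: "DPsi (xs, ?ys, Vs) h = 0" "symm (snd (snd h))"
    obtain dx dy dV where hh: "h = (dx, dy, dV)" by (metis prod.exhaust)
    obtain D' where D': "(Phi0 P r xs has_derivative D') (at (xs, ?ys, svec Vs) within Phi0_space P r xs)"
      "bij_betw D' (Phi0_space P r xs) (Phi0_space P r xs)" using D unfolding yeq by blast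
    have "dx = 0" "dy = 0" "dV = 0"
      using DPsi_nonsingular[OF sV _ D'] kp(4) h unfolding hh by auto
    then show "h = 0" by (simp add: hh zero_prod_def)
  qed
  show ?thesis
    unfolding ws
  proof (rule superlinear_convergence[OF assms(3,4)])
    show "(\<lambda>k. coords r xs (w k)) \<longlonglongrightarrow> coords r xs (xs, ym, Vs)" using B by blast
    have U: "\<forall>\<^sub>F k in sequentially. nbhd r (fst (w k)) = nbhd r xs \<and> idx r (fst (w k)) = idx r xs \<and>
        (\<forall>i\<in>idx r xs. \<forall>x\<in>nbhd r xs. tau r (fst (w k)) i x = tau r xs i x) \<and>
        discrete_measure P (fst (snd (w k))) \<and>
        msupp P (fst (snd (w k))) \<subseteq> (\<lambda>i. tau r xs i (fst (w k))) ` idx r xs" using B by blast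
    then show "\<forall>\<^sub>F k in sequentially. same_base (fst (w k)) \<and> discrete_measure P (fst (snd (w k))) \<and>
        msupp P (fst (snd (w k))) \<subseteq> (\<lambda>i. tt i (fst (w k))) ` J"
      by eventually_elim (simp add: same_base_def)
    show "\<forall>\<^sub>F k in sequentially. Jact P r (fst (w k)) (dh k) = I" by (rule act)
  qed simp
qed

end
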